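(* Let $\{(\rho^{\{i\}},V^{\{i\}},K^{\{i\}})\}_{i\in I}$ be an RE data for $\mathcal{H}$ with coefficients in $\mathcal{A}$. Then the union $$\{(\rho^{\{i\}},V^{\{i\}},K^{\{i\}})\}_{i\in I}\ \cup\ \{(\rho^{\{i\}}\otimes\rho^{\{j\}},\,V^{\{i\}}\otimes V^{\{j\}},\,K^{\{i,j\}})\}_{(i,j)\in I\times I},$$ where $$K^{\{i,j\}}=\bigl(R^{\{i,j\}}\bigr)^{-1}K^{\{i\}}_1R^{\{i,j\}}K^{\{j\}}_2\in \mathrm{End}(V^{\{i\}}\otimes V^{\{j\}})\otimes\mathcal{A},\qquad i,j\in I,$$ is an RE data, too.
   Context: $\mathbf{k}$ is a commutative algebra over a field of characteristic zero; all algebras and tensor products are over $\mathbf{k}$. $\mathcal{H}$ is a quasitriangular Hopf algebra over $\mathbf{k}$ with coproduct $\Delta$, counit $\varepsilon$, antipode $\gamma$ and (invertible) universal R-matrix $\mathcal{R}\in\mathcal{H}\otimes\mathcal{H}$, i.e. $(\Delta\otimes\mathrm{id})(\mathcal{R})=\mathcal{R}_{13}\mathcal{R}_{23}$, $(\mathrm{id}\otimes\Delta)(\mathcal{R})=\mathcal{R}_{13}\mathcal{R}_{12}$, and $\mathcal{R}\Delta(x)=\Delta^{op}(x)\mathcal{R}$ for all $x\in\mathcal{H}$, where $\Delta^{op}$ is the opposite coproduct. $\mathcal{A}$ is an associative algebra. The tensor product representation $\rho\otimes\rho'$ of $\mathcal{H}$ is $x\mapsto(\rho\otimes\rho')(\Delta(x))$.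 For representations $\rho^{\{i\}}$ of $\mathcal{H}$ on modules $V^{\{i\}}$, $i\in I$, put $R^{\{i,j\}}=(\rho^{\{i\}}\otimes\rho^{\{j\}})(\mathcal{R})\in\mathrm{End}(V^{\{i\}})\otimes\mathrm{End}(V^{\{j\}})$. Let $R^{\{j,i\}}_{21}\in\mathrm{End}(V^{\{i\}})\otimes\mathrm{End}(V^{\{j\}})$ be the image of $R^{\{j,i\}}$ under the flip of tensor factors. In $\mathrm{End}(V^{\{i\}})\otimes\mathrm{End}(V^{\{j\}})\otimes\mathcal{A}$, the element $K^{\{i\}}_1$ (resp. $K^{\{j\}}_2$) is $K^{\{i\}}\in\mathrm{End}(V^{\{i\}})\otimes\mathcal{A}$ (resp. $K^{\{j\}}\in\mathrm{End}(V^{\{j\}})\otimes\mathcal{A}$) placed in the first (resp. second) End factor and in $\mathcal{A}$, with the identity in the remaining factor. Definition. An RE data (for $\mathcal{H}$, with coefficients in $\mathcal{A}$) is a set of triples $\{(\rho^{\{i\}},V^{\{i\}},K^{\{i\}})\}_{i\in I}$, where $\rho^{\{i\}}$ are finite dimensional representations of $\mathcal{H}$ on $V^{\{i\}}$ and the matrices $K^{\{i\}}\in\mathrm{End}(V^{\{i\}})\otimes\mathcal{A}$ satisfy $$R^{\{j,i\}}_{21}K^{\{i\}}_1R^{\{i,j\}}K^{\{j\}}_2=K^{\{j\}}_2R^{\{j,i\}}_{21}K^{\{i\}}_1R^{\{i,j\}}$$ in $\mathrm{End}(V^{\{i\}}\otimes V^{\{j\}})\otimes\mathcal{A}$ for all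 $i,j\in I$ (including $i=j$). *)

theory Defs
  imports "HOL-Algebra.Algebra"
begin

section \<open>Associative algebras over a commutative ring\<close>

text \<open>
  The library locale \<open>algebra\<close> requires a commutative multiplication. As there, an algebra is
  carried by a module record; for plain modules the fields \<open>mult\<close> and \<open>one\<close> have no meaning
  and are never used.
\<close>

locale assoc_algebra = module + ring M +
  assumes smult_mult_left:
      "\<lbrakk>c \<in> carrier R; x \<in> carrier M; y \<in> carrier M\<rbrakk> \<Longrightarrow>
        (c \<odot>\<^bsub>M\<^esub> x) \<otimes>\<^bsub>M\<^esub> y = c \<odot>\<^bsub>M\<^esub> (x \<otimes>\<^bsub>M\<^esub> y)"
    and smult_mult_right:
      "\<lbrakk>c \<in> carrier R; x \<in> carrier M; y \<in> carrier M\<rbrakk> \<Longrightarrow>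
        x \<otimes>\<^bsub>M\<^esub> (c \<odot>\<^bsub>M\<^esub> y) = c \<odot>\<^bsub>M\<^esub> (x \<otimes>\<^bsub>M\<^esub> y)"

definition linear_maps :: "'k ring \<Rightarrow> ('k, 'm) module \<Rightarrow> ('k, 'n) module \<Rightarrow> ('m \<Rightarrow> 'n) set" where
  "linear_maps k M N = {f \<in> carrier M \<rightarrow> carrier N.
     (\<forall>x\<in>carrier M. \<forall>y\<in>carrier M. f (x \<oplus>\<^bsub>M\<^esub> y) = f x \<oplus>\<^bsub>N\<^esub> f y) \<and>
     (\<forall>c\<in>carrier k. \<forall>x\<in>carrier M. f (c \<odot>\<^bsub>M\<^esub> x) = c \<odot>\<^bsub>N\<^esub> f x)}"

definition algebra_homs :: "'k ring \<Rightarrow> ('k, 'a) module \<Rightarrow> ('k, 'b) module \<Rightarrow> ('a \<Rightarrow> 'b) set" where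
  "algebra_homs k A B = ring_hom A B \<inter> linear_maps k A B"

text \<open>Endomorphisms are extensional functions, so that equality in \<open>End_algebra\<close> is equality on
  the carrier.\<close>

definition End_algebra :: "'k ring \<Rightarrow> ('k, 'v) module \<Rightarrow> ('k, 'v \<Rightarrow> 'v) module" where
  "End_algebra k V =
     \<lparr>carrier = linear_maps k V V \<inter> extensional (carrier V),
      monoid.mult = compose (carrier V),
      one = (\<lambda>v\<in>carrier V. v),
      ring.zero = (\<lambda>v\<in>carrier V. \<zero>\<^bsub>V\<^esub>),
      ring.add = (\<lambda>f g. \<lambda>v\<in>carrier V. f v \<oplus>\<^bsub>V\<^esub> g v),
      smult = (\<lambda>c f. \<lambda>v\<in>carrier V. c \<odot>\<^bsub>V\<^esub> f v)\<rparr>"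

definition free_of_finite_rank :: "'k ring \<Rightarrow> ('k, 'v) module \<Rightarrow> bool" where
  "free_of_finite_rank k V \<longleftrightarrow> module k V \<and>
     (\<exists>B. finite B \<and> B \<subseteq> carrier V \<and>
       (\<forall>v\<in>carrier V. \<exists>!c. c \<in> B \<rightarrow>\<^sub>E carrier k \<and> v = (\<Oplus>\<^bsub>V\<^esub>b\<in>B. c b \<odot>\<^bsub>V\<^esub> b)))"


section \<open>Tensor products over a commutative ring\<close>

text \<open>
  \<open>M \<otimes> N\<close> is the free module on \<open>carrier M \<times> carrier N\<close> modulo the submodule generated by the
  bilinearity relations.
\<close>

definition free_module :: "'k ring \<Rightarrow> 's set \<Rightarrow> ('k, 's \<Rightarrow> 'k) module" where
  "free_module k S =
     \<lparr>carrier = {f. (\<forall>s. f s \<in> carrier k) \<and> (\<forall>s. s \<notin> S \<longrightarrow> f s = \<zero>\<^bsub>k\<^esub>) \<and>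
                    finite {s. f s \<noteq> \<zero>\<^bsub>k\<^esub>}},
      monoid.mult = undefined,
      one = undefined,
      ring.zero = (\<lambda>s. \<zero>\<^bsub>k\<^esub>),
      ring.add = (\<lambda>f g s. f s \<oplus>\<^bsub>k\<^esub> g s),
      smult = (\<lambda>c f s. c \<otimes>\<^bsub>k\<^esub> f s)\<rparr>"

definition free_gen :: "'k ring \<Rightarrow> 's \<Rightarrow> 's \<Rightarrow> 'k" where
  "free_gen k s = (\<lambda>t. if t = s then \<one>\<^bsub>k\<^esub> else \<zero>\<^bsub>k\<^esub>)"

definition free_lift :: "'k ring \<Rightarrow> ('k, 'p) module \<Rightarrow> ('s \<Rightarrow> 'p) \<Rightarrow> ('s \<Rightarrow> 'k) \<Rightarrow> 'p" where
  "free_lift k P \<phi> f = (\<Oplus>\<^bsub>P\<^esub>s\<in>{s. f s \<noteq> \<zero>\<^bsub>k\<^esub>}. f s \<odot>\<^bsub>P\<^esub> \<phi> s)"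

definition tensor_relators ::
  "'k ring \<Rightarrow> ('k, 'm) module \<Rightarrow> ('k, 'n) module \<Rightarrow> ('m \<times> 'n \<Rightarrow> 'k) set" where
  "tensor_relators k M N =
     (let F = free_module k (carrier M \<times> carrier N); e = (\<lambda>x y. free_gen k (x, y)) in
       {e (x \<oplus>\<^bsub>M\<^esub> x') y \<ominus>\<^bsub>F\<^esub> (e x y \<oplus>\<^bsub>F\<^esub> e x' y) | x x' y.
          x \<in> carrier M \<and> x' \<in> carrier M \<and> y \<in> carrier N} \<union>
       {e x (y \<oplus>\<^bsub>N\<^esub> y') \<ominus>\<^bsub>F\<^esub> (e x y \<oplus>\<^bsub>F\<^esub> e x y') | x y y'.
          x \<in> carrier M \<and> y \<in> carrier N \<and> y' \<in> carrier N} \<union>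
       {e (c \<odot>\<^bsub>M\<^esub> x) y \<ominus>\<^bsub>F\<^esub> (c \<odot>\<^bsub>F\<^esub> e x y) | c x y.
          c \<in> carrier k \<and> x \<in> carrier M \<and> y \<in> carrier N} \<union>
       {e x (c \<odot>\<^bsub>N\<^esub> y) \<ominus>\<^bsub>F\<^esub> (c \<odot>\<^bsub>F\<^esub> e x y) | c x y.
          c \<in> carrier k \<and> x \<in> carrier M \<and> y \<in> carrier N})"

definition tensor_null ::
  "'k ring \<Rightarrow> ('k, 'm) module \<Rightarrow> ('k, 'n) module \<Rightarrow> ('m \<times> 'n \<Rightarrow> 'k) set" where
  "tensor_null k M N =
     \<Inter>{U. submodule U k (free_module k (carrier M \<times> carrier N)) \<and> tensor_relators k M N \<subseteq> U}"

definition tensor_module ::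
  "'k ring \<Rightarrow> ('k, 'm) module \<Rightarrow> ('k, 'n) module \<Rightarrow> ('k, ('m \<times> 'n \<Rightarrow> 'k) set) module" where
  "tensor_module k M N =
     (let F = free_module k (carrier M \<times> carrier N); U = tensor_null k M N in
       \<lparr>carrier = a_rcosets\<^bsub>F\<^esub> U,
        monoid.mult = undefined,
        one = undefined,
        ring.zero = U,
        ring.add = set_add F,
        smult = (\<lambda>c p. \<Union>f\<in>p. U +>\<^bsub>F\<^esub> (c \<odot>\<^bsub>F\<^esub> f))\<rparr>)"

definition pure_tensor ::
  "'k ring \<Rightarrow> ('k, 'm) module \<Rightarrow> ('k, 'n) module \<Rightarrow> 'm \<Rightarrow> 'n \<Rightarrow> ('m \<times> 'n \<Rightarrow> 'k) set" where
  "pure_tensor k M N x y =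
     tensor_null k M N +>\<^bsub>free_module k (carrier M \<times> carrier N)\<^esub> free_gen k (x, y)"

text \<open>
  For bilinear \<open>\<phi>\<close>, \<open>tensor_lift k P \<phi>\<close> is the linear map on \<open>M \<otimes> N\<close> sending
  \<open>x \<otimes> y\<close> to \<open>\<phi> x y\<close>: all representatives of a class then have the same image.
\<close>

definition tensor_lift ::
  "'k ring \<Rightarrow> ('k, 'p) module \<Rightarrow> ('m \<Rightarrow> 'n \<Rightarrow> 'p) \<Rightarrow> ('m \<times> 'n \<Rightarrow> 'k) set \<Rightarrow> 'p" where
  "tensor_lift k P \<phi> p = the_elem (free_lift k P (\<lambda>(x, y). \<phi> x y) ` p)"

text \<open>The product is the bilinear one with
  \<open>(a \<otimes> b) (a' \<otimes> b') = a a' \<otimes> b b'\<close>.\<close>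

definition tensor_algebra ::
  "'k ring \<Rightarrow> ('k, 'a) module \<Rightarrow> ('k, 'b) module \<Rightarrow> ('k, ('a \<times> 'b \<Rightarrow> 'k) set) module" where
  "tensor_algebra k A B = (tensor_module k A B)
     \<lparr>monoid.mult := (\<lambda>p q.
        tensor_lift k (tensor_module k A B)
          (\<lambda>a b. tensor_lift k (tensor_module k A B)
            (\<lambda>a' b'. pure_tensor k A B (a \<otimes>\<^bsub>A\<^esub> a') (b \<otimes>\<^bsub>B\<^esub> b')) q) p),
      one := pure_tensor k A B \<one>\<^bsub>A\<^esub> \<one>\<^bsub>B\<^esub>\<rparr>"

text \<open>\<open>f \<otimes> g\<close> with values in \<open>M' \<otimes> N'\<close>.\<close>

definition tensor_map ::
  "'k ring \<Rightarrow> ('k, 'm2) module \<Rightarrow> ('k, 'n2) module \<Rightarrow> ('m \<Rightarrow> 'm2) \<Rightarrow> ('n \<Rightarrow> 'n2) \<Rightarrow>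
    ('m \<times> 'n \<Rightarrow> 'k) set \<Rightarrow> ('m2 \<times> 'n2 \<Rightarrow> 'k) set" where
  "tensor_map k M' N' f g =
     tensor_lift k (tensor_module k M' N') (\<lambda>x y. pure_tensor k M' N' (f x) (g y))"

text \<open>The flip \<open>M \<otimes> N \<rightarrow> N \<otimes> M\<close>.\<close>

definition tensor_flip ::
  "'k ring \<Rightarrow> ('k, 'm) module \<Rightarrow> ('k, 'n) module \<Rightarrow>
    ('m \<times> 'n \<Rightarrow> 'k) set \<Rightarrow> ('n \<times> 'm \<Rightarrow> 'k) set" where
  "tensor_flip k M N = tensor_lift k (tensor_module k N M) (\<lambda>x y. pure_tensor k N M y x)"

text \<open>The canonical map \<open>L \<otimes> (M \<otimes> N) \<rightarrow> (L \<otimes> M) \<otimes> N\<close>.\<close>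

definition tensor_assoc ::
  "'k ring \<Rightarrow> ('k, 'l) module \<Rightarrow> ('k, 'm) module \<Rightarrow> ('k, 'n) module \<Rightarrow>
    ('l \<times> ('m \<times> 'n \<Rightarrow> 'k) set \<Rightarrow> 'k) set \<Rightarrow> (('l \<times> 'm \<Rightarrow> 'k) set \<times> 'n \<Rightarrow> 'k) set" where
  "tensor_assoc k L M N =
     (let LM = tensor_module k L M; T = tensor_module k LM N in
       tensor_lift k T (\<lambda>x. tensor_lift k T (\<lambda>y z.
         pure_tensor k LM N (pure_tensor k L M x y) z)))"

text \<open>
  Leg notation in \<open>(A \<otimes> B) \<otimes> C\<close>: an element of \<open>A \<otimes> B\<close>, \<open>A \<otimes> C\<close> or
  \<open>B \<otimes> C\<close> is placed in the indicated factors, with the unit in the remaining one.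
\<close>

abbreviation tensor3 where
  "tensor3 k A B C \<equiv> tensor_algebra k (tensor_algebra k A B) C"

definition leg12 where
  "leg12 k A B C t = pure_tensor k (tensor_algebra k A B) C t \<one>\<^bsub>C\<^esub>"

definition leg13 where
  "leg13 k A B C =
     tensor_map k (tensor_algebra k A B) C (\<lambda>x. pure_tensor k A B x \<one>\<^bsub>B\<^esub>) (\<lambda>z. z)"

definition leg23 where
  "leg23 k A B C =
     tensor_map k (tensor_algebra k A B) C (\<lambda>y. pure_tensor k A B \<one>\<^bsub>A\<^esub> y) (\<lambda>z. z)"


section \<open>Quasitriangular Hopf algebras\<close>

text \<open>
  \<open>\<Delta>\<close> is the coproduct, \<open>\<epsilon>\<close> the counit and \<open>\<gamma>\<close> the antipode. Identities involving
  \<open>id \<otimes> \<Delta>\<close> are compared in \<open>(H \<otimes> H) \<otimes> H\<close>.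
\<close>

locale hopf_algebra = H: assoc_algebra k H
  for k :: "'k ring" and H :: "('k, 'h) module"
  and \<Delta> :: "'h \<Rightarrow> ('h \<times> 'h \<Rightarrow> 'k) set" and \<epsilon> :: "'h \<Rightarrow> 'k" and \<gamma> :: "'h \<Rightarrow> 'h" +
  assumes coproduct: "\<Delta> \<in> algebra_homs k H (tensor_algebra k H H)"
    and counit: "\<epsilon> \<in> ring_hom H k"
    and counit_smult:
      "\<lbrakk>c \<in> carrier k; x \<in> carrier H\<rbrakk> \<Longrightarrow> \<epsilon> (c \<odot>\<^bsub>H\<^esub> x) = c \<otimes>\<^bsub>k\<^esub> \<epsilon> x"
    and antipode: "\<gamma> \<in> linear_maps k H H"
    and coassoc: "x \<in> carrier H \<Longrightarrow>
      tensor_map k (tensor_algebra k H H) H \<Delta> (\<lambda>z. z) (\<Delta> x) =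
      tensor_assoc k H H H (tensor_map k H (tensor_algebra k H H) (\<lambda>z. z) \<Delta> (\<Delta> x))"
    and counit_left: "x \<in> carrier H \<Longrightarrow> tensor_lift k H (\<lambda>y z. \<epsilon> y \<odot>\<^bsub>H\<^esub> z) (\<Delta> x) = x"
    and counit_right: "x \<in> carrier H \<Longrightarrow> tensor_lift k H (\<lambda>y z. \<epsilon> z \<odot>\<^bsub>H\<^esub> y) (\<Delta> x) = x"
    and antipode_left: "x \<in> carrier H \<Longrightarrow>
      tensor_lift k H (\<lambda>y z. \<gamma> y \<otimes>\<^bsub>H\<^esub> z) (\<Delta> x) = \<epsilon> x \<odot>\<^bsub>H\<^esub> \<one>\<^bsub>H\<^esub>"
    and antipode_right: "x \<in> carrier H \<Longrightarrow>
      tensor_lift k H (\<lambda>y z. y \<otimes>\<^bsub>H\<^esub> \<gamma> z) (\<Delta> x) = \<epsilon> x \<odot>\<^bsub>H\<^esub> \<one>\<^bsub>H\<^esub>"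

locale quasitriangular_hopf_algebra = hopf_algebra k H \<Delta> \<epsilon> \<gamma>
  for k :: "'k ring" and H :: "('k, 'h) module"
  and \<Delta> :: "'h \<Rightarrow> ('h \<times> 'h \<Rightarrow> 'k) set" and \<epsilon> :: "'h \<Rightarrow> 'k" and \<gamma> :: "'h \<Rightarrow> 'h"
  and \<R> :: "('h \<times> 'h \<Rightarrow> 'k) set" +
  assumes R_invertible: "\<R> \<in> Units (tensor_algebra k H H)"
    and R_coproduct_left:
      "tensor_map k (tensor_algebra k H H) H \<Delta> (\<lambda>z. z) \<R> =
       leg13 k H H H \<R> \<otimes>\<^bsub>tensor3 k H H H\<^esub> leg23 k H H H \<R>"
    and R_coproduct_right:
      "tensor_assoc k H H H (tensor_map k H (tensor_algebra k H H) (\<lambda>z. z) \<Delta> \<R>) =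
       leg13 k H H H \<R> \<otimes>\<^bsub>tensor3 k H H H\<^esub> leg12 k H H H \<R>"
    and R_intertwines: "x \<in> carrier H \<Longrightarrow>
      \<R> \<otimes>\<^bsub>tensor_algebra k H H\<^esub> \<Delta> x =
      tensor_flip k H H (\<Delta> x) \<otimes>\<^bsub>tensor_algebra k H H\<^esub> \<R>"


section \<open>Representations and RE data\<close>

text \<open>The canonical algebra homomorphism \<open>End V \<otimes> End W \<rightarrow> End (V \<otimes> W)\<close>.\<close>

definition End_tensor ::
  "'k ring \<Rightarrow> ('k, 'v) module \<Rightarrow> ('k, 'w) module \<Rightarrow>
    (('v \<Rightarrow> 'v) \<times> ('w \<Rightarrow> 'w) \<Rightarrow> 'k) set \<Rightarrow>
    ('v \<times> 'w \<Rightarrow> 'k) set \<Rightarrow> ('v \<times> 'w \<Rightarrow> 'k) set" where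
  "End_tensor k V W =
     tensor_lift k (End_algebra k (tensor_module k V W))
       (\<lambda>f g. restrict (tensor_map k V W f g) (carrier (tensor_module k V W)))"

definition tensor_rep ::
  "'k ring \<Rightarrow> ('h \<Rightarrow> ('h \<times> 'h \<Rightarrow> 'k) set) \<Rightarrow>
    ('h \<Rightarrow> 'v \<Rightarrow> 'v) \<Rightarrow> ('k, 'v) module \<Rightarrow> ('h \<Rightarrow> 'w \<Rightarrow> 'w) \<Rightarrow> ('k, 'w) module \<Rightarrow>
    'h \<Rightarrow> ('v \<times> 'w \<Rightarrow> 'k) set \<Rightarrow> ('v \<times> 'w \<Rightarrow> 'k) set" where
  "tensor_rep k \<Delta> \<rho> V \<sigma> W x =
     End_tensor k V W (tensor_map k (End_algebra k V) (End_algebra k W) \<rho> \<sigma> (\<Delta> x))"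

text \<open>The image of the universal R-matrix in \<open>End V \<otimes> End W\<close>.\<close>

definition R_image ::
  "'k ring \<Rightarrow> ('h \<times> 'h \<Rightarrow> 'k) set \<Rightarrow>
    ('h \<Rightarrow> 'v \<Rightarrow> 'v) \<Rightarrow> ('k, 'v) module \<Rightarrow> ('h \<Rightarrow> 'w \<Rightarrow> 'w) \<Rightarrow> ('k, 'w) module \<Rightarrow>
    (('v \<Rightarrow> 'v) \<times> ('w \<Rightarrow> 'w) \<Rightarrow> 'k) set" where
  "R_image k \<R> \<rho> V \<sigma> W = tensor_map k (End_algebra k V) (End_algebra k W) \<rho> \<sigma> \<R>"

type_synonym ('k, 'h, 'a, 'v) re_triple =
  "('h \<Rightarrow> 'v \<Rightarrow> 'v) \<times> ('k, 'v) module \<times> (('v \<Rightarrow> 'v) \<times> 'a \<Rightarrow> 'k) set"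

definition re_triple ::
  "'k ring \<Rightarrow> ('k, 'h) module \<Rightarrow> ('k, 'a) module \<Rightarrow> ('k, 'h, 'a, 'v) re_triple \<Rightarrow> bool" where
  "re_triple k H A = (\<lambda>(\<rho>, V, K).
     free_of_finite_rank k V \<and>
     \<rho> \<in> algebra_homs k H (End_algebra k V) \<and>
     K \<in> carrier (tensor_algebra k (End_algebra k V) A))"

text \<open>
  The reflection equation for an ordered pair of triples, in \<open>(End V \<otimes> End W) \<otimes> A\<close>. The
  underlying modules may live on different types.
\<close>

definition reflection_eq ::
  "'k ring \<Rightarrow> ('h \<times> 'h \<Rightarrow> 'k) set \<Rightarrow> ('k, 'a) module \<Rightarrow>
    ('k, 'h, 'a, 'v) re_triple \<Rightarrow> ('k, 'h, 'a, 'w) re_triple \<Rightarrow> bool" where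
  "reflection_eq k \<R> A = (\<lambda>(\<rho>, V, K) (\<sigma>, W, L).
     let EV = End_algebra k V; EW = End_algebra k W; T = tensor3 k EV EW A;
         R = leg12 k EV EW A (R_image k \<R> \<rho> V \<sigma> W);
         R21 = leg12 k EV EW A (tensor_flip k EW EV (R_image k \<R> \<sigma> W \<rho> V));
         K1 = leg13 k EV EW A K;
         L2 = leg23 k EV EW A L
     in R21 \<otimes>\<^bsub>T\<^esub> K1 \<otimes>\<^bsub>T\<^esub> R \<otimes>\<^bsub>T\<^esub> L2 = L2 \<otimes>\<^bsub>T\<^esub> R21 \<otimes>\<^bsub>T\<^esub> K1 \<otimes>\<^bsub>T\<^esub> R)"

definition RE_data ::
  "'k ring \<Rightarrow> ('k, 'h) module \<Rightarrow> ('h \<times> 'h \<Rightarrow> 'k) set \<Rightarrow> ('k, 'a) module \<Rightarrow>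
    ('k, 'h, 'a, 'v) re_triple set \<Rightarrow> bool" where
  "RE_data k H \<R> A S \<longleftrightarrow>
     (\<forall>t\<in>S. re_triple k H A t) \<and> (\<forall>s\<in>S. \<forall>t\<in>S. reflection_eq k \<R> A s t)"

text \<open>
  The union of two sets of triples whose modules live on different types is not a set in HOL.
  The following spells out what it means for such a union to be an RE data; on a common type it
  coincides with \<open>RE_data\<close> of the union.
\<close>

definition RE_data_union ::
  "'k ring \<Rightarrow> ('k, 'h) module \<Rightarrow> ('h \<times> 'h \<Rightarrow> 'k) set \<Rightarrow> ('k, 'a) module \<Rightarrow>
    ('k, 'h, 'a, 'v) re_triple set \<Rightarrow> ('k, 'h, 'a, 'w) re_triple set \<Rightarrow> bool" where
  "RE_data_union k H \<R> A S S' \<longleftrightarrow>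
     (\<forall>t\<in>S. re_triple k H A t) \<and> (\<forall>t\<in>S'. re_triple k H A t) \<and>
     (\<forall>s\<in>S. \<forall>t\<in>S. reflection_eq k \<R> A s t) \<and> (\<forall>s\<in>S. \<forall>t\<in>S'. reflection_eq k \<R> A s t) \<and>
     (\<forall>s\<in>S'. \<forall>t\<in>S. reflection_eq k \<R> A s t) \<and> (\<forall>s\<in>S'. \<forall>t\<in>S'. reflection_eq k \<R> A s t)"

lemma RE_data_union_same_type: "RE_data_union k H \<R> A S S' \<longleftrightarrow> RE_data k H \<R> A (S \<union> S')"
  unfolding RE_data_union_def RE_data_def by blast

text \<open>
  The matrix \<open>R\<^sup>-\<^sup>1 K\<^sub>1 R L\<^sub>2\<close> of a pair of triples, computed in
  \<open>(End V \<otimes> End W) \<otimes> A\<close> and carried to \<open>End (V \<otimes> W) \<otimes> A\<close>.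
\<close>

definition fused_K ::
  "'k ring \<Rightarrow> ('h \<times> 'h \<Rightarrow> 'k) set \<Rightarrow> ('k, 'a) module \<Rightarrow>
    ('k, 'h, 'a, 'v) re_triple \<Rightarrow> ('k, 'h, 'a, 'w) re_triple \<Rightarrow>
    ((('v \<times> 'w \<Rightarrow> 'k) set \<Rightarrow> ('v \<times> 'w \<Rightarrow> 'k) set) \<times> 'a \<Rightarrow> 'k) set" where
  "fused_K k \<R> A = (\<lambda>(\<rho>, V, K) (\<sigma>, W, L).
     let EV = End_algebra k V; EW = End_algebra k W; T = tensor3 k EV EW A;
         R = R_image k \<R> \<rho> V \<sigma> W
     in tensor_map k (End_algebra k (tensor_module k V W)) A (End_tensor k V W) (\<lambda>a. a)
          (leg12 k EV EW A (inv\<^bsub>tensor_algebra k EV EW\<^esub> R) \<otimes>\<^bsub>T\<^esub> leg13 k EV EW A K \<otimes>\<^bsub>T\<^esub>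
           leg12 k EV EW A R \<otimes>\<^bsub>T\<^esub> leg23 k EV EW A L))"

end

theory Submission
  imports Defs
begin

text \<open>
  The reflection equation can be tested in any algebra \<open>S\<close> receiving pairwise commuting
  homomorphisms from the two endomorphism algebras and from the coefficient algebra. In \<open>S\<close>
  write \<open>R\<^bsub>xy\<^esub>\<close> and \<open>K\<^sub>x\<close> for the images of the R-matrices and of the K-matrices.
  The quasitriangular axioms give the Yang--Baxter equation
  \<open>R\<^bsub>xy\<^esub> R\<^bsub>xz\<^esub> R\<^bsub>yz\<^esub> = R\<^bsub>yz\<^esub> R\<^bsub>xz\<^esub> R\<^bsub>xy\<^esub>\<close> and factorise the R-matrices of a
  tensor product \<open>ab\<close> against \<open>c\<close> as \<open>R\<^bsub>ac\<^esub> R\<^bsub>bc\<^esub>\<close> and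
  \<open>R\<^bsub>cb\<^esub> R\<^bsub>ca\<^esub>\<close>. With these relations the third matrix \<open>K\<^sub>c\<close> moves through the fused
  matrix of \<open>a\<close> and \<open>b\<close> as soon as the reflection equation holds for \<open>(a, c)\<close> and
  \<open>(b, c)\<close>, and similarly with the roles exchanged. Taking \<open>c\<close> to be a fused triple settles the remaining pairs, so that tensor products
  of four endomorphism algebras never occur.
\<close>

section \<open>Linear maps\<close>

text \<open>The fused R-matrices live over \<open>End (V \<otimes> W)\<close>, the given ones over
  \<open>End V\<close> and \<open>End W\<close>, and the comparison at hand is the one-way
  homomorphism \<open>End_tensor\<close>. Hence everything is pushed forward into a common target:
  with the triple tensor algebra of \<open>End (V \<otimes> W)\<close>, \<open>End U\<close> and
  \<open>A\<close> as \<open>S\<close>, composing its first inclusion with \<open>End_tensor\<close>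
  gives commuting maps from \<open>End V\<close> and \<open>End W\<close>, along which the given
  equations become identities in \<open>S\<close>. The joint map of a triple tensor algebra with its
  canonical inclusions is the identity, so an identity in this \<open>S\<close> is the reflection
  equation itself. This also removes re-bracketing: \<open>hom_prod\<close> turns every placement of
  legs into a plain product in \<open>S\<close>, and fusion becomes a calculation with words in a
  monoid. Finite rank is a separate matter, settled on the modules: the products of basis vectors
  form a basis of \<open>V \<otimes> W\<close>, with products of coordinate functionals as dual
  family.\<close>

lemma linear_mapsI:
  assumes "\<And>x. x \<in> carrier M \<Longrightarrow> f x \<in> carrier N"
    and "\<And>x y. \<lbrakk>x \<in> carrier M; y \<in> carrier M\<rbrakk> \<Longrightarrow> f (x \<oplus>\<^bsub>M\<^esub> y) = f x \<oplus>\<^bsub>N\<^esub> f y"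
    and "\<And>c x. \<lbrakk>c \<in> carrier k; x \<in> carrier M\<rbrakk> \<Longrightarrow> f (c \<odot>\<^bsub>M\<^esub> x) = c \<odot>\<^bsub>N\<^esub> f x"
  shows "f \<in> linear_maps k M N"
  using assms by (simp add: linear_maps_def)

lemma linear_maps_closed: "f \<in> linear_maps k M N \<Longrightarrow> x \<in> carrier M \<Longrightarrow> f x \<in> carrier N"
  by (auto simp: linear_maps_def)

lemma linear_maps_add:
  "f \<in> linear_maps k M N \<Longrightarrow> x \<in> carrier M \<Longrightarrow> y \<in> carrier M \<Longrightarrow>
    f (x \<oplus>\<^bsub>M\<^esub> y) = f x \<oplus>\<^bsub>N\<^esub> f y"
  by (auto simp: linear_maps_def)

lemma linear_maps_smult:
  "f \<in> linear_maps k M N \<Longrightarrow> c \<in> carrier k \<Longrightarrow> x \<in> carrier M \<Longrightarrow>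
    f (c \<odot>\<^bsub>M\<^esub> x) = c \<odot>\<^bsub>N\<^esub> f x"
  by (auto simp: linear_maps_def)

lemma linear_maps_cong:
  "(\<And>x. x \<in> carrier M \<Longrightarrow> f x = g x) \<Longrightarrow> module k M \<Longrightarrow> f \<in> linear_maps k M N \<longleftrightarrow> g \<in> linear_maps k M N"
proof -
  assume *: "\<And>x. x \<in> carrier M \<Longrightarrow> f x = g x" and "module k M"
  interpret module k M by fact
  show ?thesis unfolding linear_maps_def using * by (auto simp: Pi_def)
qed

lemma linear_maps_zero:
  assumes "module k M" "module k N" "f \<in> linear_maps k M N"
  shows "f \<zero>\<^bsub>M\<^esub> = \<zero>\<^bsub>N\<^esub>"
proof -
  interpret M: module k M by fact
  interpret N: module k N by fact
  have "f \<zero>\<^bsub>M\<^esub> = f (\<zero>\<^bsub>k\<^esub> \<odot>\<^bsub>M\<^esub> \<zero>\<^bsub>M\<^esub>)" by simp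
  also have "\<dots> = \<zero>\<^bsub>k\<^esub> \<odot>\<^bsub>N\<^esub> f \<zero>\<^bsub>M\<^esub>"
    using assms(3) by (rule linear_maps_smult) auto
  finally show ?thesis using linear_maps_closed[OF assms(3), of "\<zero>\<^bsub>M\<^esub>"] by simp
qed

lemma linear_maps_minus:
  assumes "module k M" "module k N" "f \<in> linear_maps k M N" "x \<in> carrier M"
  shows "f (\<ominus>\<^bsub>M\<^esub> x) = \<ominus>\<^bsub>N\<^esub> f x"
proof -
  interpret M: module k M by fact
  interpret N: module k N by fact
  have "f x \<oplus>\<^bsub>N\<^esub> f (\<ominus>\<^bsub>M\<^esub> x) = \<zero>\<^bsub>N\<^esub>"
    using linear_maps_add[OF assms(3), of x "\<ominus>\<^bsub>M\<^esub> x"] linear_maps_zero[OF assms(1-3)] assms(4)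
    by (simp add: M.r_neg)
  then show ?thesis using assms linear_maps_closed[OF assms(3)]
    by (metis M.a_inv_closed N.M.minus_equality N.M.a_comm)
qed

lemma linear_maps_compose:
  "f \<in> linear_maps k M N \<Longrightarrow> g \<in> linear_maps k N P \<Longrightarrow> (\<lambda>x. g (f x)) \<in> linear_maps k M P"
  by (auto simp: linear_maps_def Pi_def)

lemma linear_maps_id: "(\<lambda>x. x) \<in> linear_maps k M M"
  by (auto simp: linear_maps_def)

lemma linear_maps_finsum:
  assumes "module k M" "module k N" "f \<in> linear_maps k M N" "g \<in> S \<rightarrow> carrier M"
  shows "f (\<Oplus>\<^bsub>M\<^esub>s\<in>S. g s) = (\<Oplus>\<^bsub>N\<^esub>s\<in>S. f (g s))"
proof -
  interpret M: module k M by fact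
  interpret N: module k N by fact
  show ?thesis using assms(4)
  proof (induction S rule: infinite_finite_induct)
    \<comment> \<open>\<open>finsum\<close> over an infinite set is zero by default, so this case
      reduces to preservation of zero.\<close>
    case (infinite S)
    then show ?case using linear_maps_zero[OF assms(1-3)] by simp
  next
    case empty
    then show ?case using linear_maps_zero[OF assms(1-3)] by simp
  next
    case (insert s S)
    have fg: "(\<lambda>s. f (g s)) \<in> S \<rightarrow> carrier N" "f (g s) \<in> carrier N"
      using insert.prems linear_maps_closed[OF assms(3)] by auto
    have "f (\<Oplus>\<^bsub>M\<^esub>t\<in>insert s S. g t) = f (g s \<oplus>\<^bsub>M\<^esub> (\<Oplus>\<^bsub>M\<^esub>t\<in>S. g t))"
      using insert by (subst M.M.finsum_insert) auto
    also have "\<dots> = f (g s) \<oplus>\<^bsub>N\<^esub> f (\<Oplus>\<^bsub>M\<^esub>t\<in>S. g t)"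
      using insert.prems by (intro linear_maps_add[OF assms(3)]) auto
    also have "\<dots> = (\<Oplus>\<^bsub>N\<^esub>t\<in>insert s S. f (g t))"
      using insert fg by (subst N.M.finsum_insert) auto
    finally show ?case .
  qed
qed

lemma linear_maps_add_fun:
  assumes "module k N" "f \<in> linear_maps k M N" "g \<in> linear_maps k M N"
  shows "(\<lambda>x. f x \<oplus>\<^bsub>N\<^esub> g x) \<in> linear_maps k M N"
proof -
  interpret N: module k N by fact
  show ?thesis
    using linear_maps_closed[OF assms(2)] linear_maps_closed[OF assms(3)]
      linear_maps_add[OF assms(2)] linear_maps_add[OF assms(3)]
      linear_maps_smult[OF assms(2)] linear_maps_smult[OF assms(3)]
    by (intro linear_mapsI) (simp_all add: N.smult_r_distr N.M.a_ac)
qed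

lemma linear_maps_smult_fun:
  assumes "module k N" "f \<in> linear_maps k M N" "c \<in> carrier k"
  shows "(\<lambda>x. c \<odot>\<^bsub>N\<^esub> f x) \<in> linear_maps k M N"
proof -
  interpret N: module k N by fact
  show ?thesis
    using linear_maps_closed[OF assms(2)] linear_maps_add[OF assms(2)] linear_maps_smult[OF assms(2)]
      assms(3)
    by (intro linear_mapsI) (simp_all add: N.smult_r_distr N.smult_assoc1[symmetric] N.R.m_comm)
qed

section \<open>Free modules\<close>

lemma free_module_simps:
  "f \<in> carrier (free_module k S) \<longleftrightarrow> (\<forall>s. f s \<in> carrier k) \<and> (\<forall>s. s \<notin> S \<longrightarrow> f s = \<zero>\<^bsub>k\<^esub>) \<and>
                    finite {s. f s \<noteq> \<zero>\<^bsub>k\<^esub>}"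
  "\<zero>\<^bsub>free_module k S\<^esub> = (\<lambda>s. \<zero>\<^bsub>k\<^esub>)"
  "f \<oplus>\<^bsub>free_module k S\<^esub> g = (\<lambda>s. f s \<oplus>\<^bsub>k\<^esub> g s)"
  "c \<odot>\<^bsub>free_module k S\<^esub> f = (\<lambda>s. c \<otimes>\<^bsub>k\<^esub> f s)"
  by (simp_all add: free_module_def)

lemma free_module_module:
  assumes "cring k"
  shows "module k (free_module k S)"
proof -
  interpret cring k by fact
  let ?F = "free_module k S"
  have add: "f \<oplus>\<^bsub>?F\<^esub> g \<in> carrier ?F" if "f \<in> carrier ?F" "g \<in> carrier ?F" for f g
  proof -
    have "{s. f s \<oplus>\<^bsub>k\<^esub> g s \<noteq> \<zero>\<^bsub>k\<^esub>} \<subseteq> {s. f s \<noteq> \<zero>\<^bsub>k\<^esub>} \<union> {s. g s \<noteq> \<zero>\<^bsub>k\<^esub>}" by auto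
    then show ?thesis
      using that unfolding free_module_simps by (auto intro: finite_subset)
  qed
  have smult: "c \<odot>\<^bsub>?F\<^esub> f \<in> carrier ?F" if "c \<in> carrier k" "f \<in> carrier ?F" for c f
  proof -
    have "{s. c \<otimes>\<^bsub>k\<^esub> f s \<noteq> \<zero>\<^bsub>k\<^esub>} \<subseteq> {s. f s \<noteq> \<zero>\<^bsub>k\<^esub>}" using that by auto
    then show ?thesis
      using that unfolding free_module_simps by (auto intro: finite_subset)
  qed
  \<comment> \<open>The negative is taken as \<open>-1\<close> times \<open>f\<close>, so that its
    finite support comes from closure under scaling.\<close>
  have inv: "\<exists>g\<in>carrier ?F. g \<oplus>\<^bsub>?F\<^esub> f = \<zero>\<^bsub>?F\<^esub>" if "f \<in> carrier ?F" for f
  proof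
    show "(\<ominus>\<^bsub>k\<^esub> \<one>\<^bsub>k\<^esub>) \<odot>\<^bsub>?F\<^esub> f \<in> carrier ?F" by (rule smult[OF _ that]) simp
    show "((\<ominus>\<^bsub>k\<^esub> \<one>\<^bsub>k\<^esub>) \<odot>\<^bsub>?F\<^esub> f) \<oplus>\<^bsub>?F\<^esub> f = \<zero>\<^bsub>?F\<^esub>"
      using that by (auto simp: free_module_simps l_minus l_neg)
  qed
  show ?thesis
  proof (rule moduleI)
    show "abelian_group ?F"
      by (rule abelian_groupI) (use add inv in \<open>auto simp: free_module_simps a_ac\<close>)
  qed (use assms smult in \<open>auto simp: free_module_simps l_distr r_distr m_assoc\<close>)
qed

lemma free_gen_closed:
  assumes "cring k" "s \<in> S"
  shows "free_gen k s \<in> carrier (free_module k S)"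
proof -
  interpret cring k by fact
  have "{t. free_gen k s t \<noteq> \<zero>\<^bsub>k\<^esub>} \<subseteq> {s}" by (auto simp: free_gen_def)
  then show ?thesis using assms(2) by (auto simp: free_module_simps free_gen_def)
qed

text \<open>Induction on a finite set covering the support, removing one coefficient at a
  time.\<close>

lemma free_module_induct [consumes 2, case_names zero add]:
  assumes "cring k" and f: "f \<in> carrier (free_module k S)"
    and zero: "P \<zero>\<^bsub>free_module k S\<^esub>"
    and step: "\<And>f c s. \<lbrakk>f \<in> carrier (free_module k S); P f; c \<in> carrier k; s \<in> S\<rbrakk> \<Longrightarrow>
      P (f \<oplus>\<^bsub>free_module k S\<^esub> c \<odot>\<^bsub>free_module k S\<^esub> free_gen k s)"
  shows "P f"
proof -
  interpret cring k by fact
  have "P f" if "finite T" "f \<in> carrier (free_module k S)" "{s. f s \<noteq> \<zero>\<^bsub>k\<^esub>} \<subseteq> T" for T f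
    using that
  proof (induction T arbitrary: f)
    case empty
    then have "f = \<zero>\<^bsub>free_module k S\<^esub>" by (auto simp: free_module_simps)
    then show ?case using assms(3) by simp
  next
    case (insert t T)
    define g where "g = f(t := \<zero>\<^bsub>k\<^esub>)"
    have "{s. g s \<noteq> \<zero>\<^bsub>k\<^esub>} \<subseteq> {s. f s \<noteq> \<zero>\<^bsub>k\<^esub>}" by (auto simp: g_def)
    then have g: "g \<in> carrier (free_module k S)"
      using insert.prems(1) finite_subset[OF \<open>{s. g s \<noteq> \<zero>\<^bsub>k\<^esub>} \<subseteq> _\<close>] by (simp add: free_module_simps) (simp add: g_def)
    have "P g" using insert.prems by (intro insert.IH g) (auto simp: g_def)
    show ?case
    proof (cases "t \<in> S")
      case True
      have ft: "f s \<in> carrier k" for s using insert.prems(1) by (auto simp: free_module_simps)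
      have "f = g \<oplus>\<^bsub>free_module k S\<^esub> f t \<odot>\<^bsub>free_module k S\<^esub> free_gen k t"
        using ft by (auto simp: free_module_simps g_def free_gen_def)
      then show ?thesis using step[OF g \<open>P g\<close> _ True, of "f t"] ft by simp
    next
      \<comment> \<open>The covering set may contain points outside \<open>S\<close>;
        \<open>f\<close> vanishes there, so deleting the coefficient changes nothing.\<close>
      case False
      then have "f = g" using insert.prems(1) by (auto simp: g_def free_module_simps)
      then show ?thesis using \<open>P g\<close> by simp
    qed
  qed
  then show ?thesis using f by (auto simp: free_module_simps)
qed

text \<open>\<open>free_lift\<close> sums over the support of its own argument, and supports change
  under addition and scaling. Padding with zero terms brings the sums to be compared to one index
  set.\<close>

lemma free_lift_superset:
  assumes "module k P" "\<phi> \<in> S \<rightarrow> carrier P" "f \<in> carrier (free_module k S)"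
    and "finite T" "{s. f s \<noteq> \<zero>\<^bsub>k\<^esub>} \<subseteq> T" "T \<subseteq> S"
  shows "free_lift k P \<phi> f = (\<Oplus>\<^bsub>P\<^esub>s\<in>T. f s \<odot>\<^bsub>P\<^esub> \<phi> s)"
proof -
  interpret P: module k P by fact
  have "f s \<odot>\<^bsub>P\<^esub> \<phi> s \<in> carrier P" if "s \<in> T" for s
    using assms that by (auto simp: free_module_simps Pi_def)
  moreover have "f s \<odot>\<^bsub>P\<^esub> \<phi> s = \<zero>\<^bsub>P\<^esub>" if "s \<in> T - {s. f s \<noteq> \<zero>\<^bsub>k\<^esub>}" for s
    using assms(2,6) that by (auto simp: Pi_def)
  ultimately show ?thesis unfolding free_lift_def
    using assms(4,5) by (intro P.M.add.finprod_mono_neutral_cong_left) auto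
qed

lemma free_lift_linear:
  assumes "module k P" "\<phi> \<in> S \<rightarrow> carrier P"
  shows "free_lift k P \<phi> \<in> linear_maps k (free_module k S) P"
proof -
  interpret P: module k P by fact
  interpret F: module k "free_module k S" by (rule free_module_module) unfold_locales
  let ?F = "free_module k S" and ?s = "\<lambda>f. {s. f s \<noteq> \<zero>\<^bsub>k\<^esub>}"
  have S: "?s f \<subseteq> S" "finite (?s f)" if "f \<in> carrier ?F" for f
    using that by (auto simp: free_module_simps)
  note lift = free_lift_superset[OF assms]
  have cl: "(\<lambda>s. f s \<odot>\<^bsub>P\<^esub> \<phi> s) \<in> T \<rightarrow> carrier P" if "f \<in> carrier ?F" "T \<subseteq> S" for f T
    using that assms(2) by (auto simp: free_module_simps Pi_def)
  show ?thesis
  proof (rule linear_mapsI)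
    fix f assume f: "f \<in> carrier ?F"
    then show "free_lift k P \<phi> f \<in> carrier P"
      unfolding free_lift_def by (intro P.M.finsum_closed cl S)
  next
    fix f g assume fg: "f \<in> carrier ?F" "g \<in> carrier ?F"
    let ?T = "?s f \<union> ?s g"
    have T: "finite ?T" "?T \<subseteq> S" using S fg by auto
    have "free_lift k P \<phi> (f \<oplus>\<^bsub>?F\<^esub> g) = (\<Oplus>\<^bsub>P\<^esub>s\<in>?T. (f \<oplus>\<^bsub>?F\<^esub> g) s \<odot>\<^bsub>P\<^esub> \<phi> s)"
      using F.M.a_closed[OF fg] T by (intro lift) (auto simp: free_module_simps(3))
    also have "\<dots> = (\<Oplus>\<^bsub>P\<^esub>s\<in>?T. f s \<odot>\<^bsub>P\<^esub> \<phi> s \<oplus>\<^bsub>P\<^esub> g s \<odot>\<^bsub>P\<^esub> \<phi> s)"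
      using fg T(2) assms(2)
      by (intro P.M.finsum_cong') (auto simp: free_module_simps P.smult_l_distr Pi_def subset_iff)
    also have "\<dots> = (\<Oplus>\<^bsub>P\<^esub>s\<in>?T. f s \<odot>\<^bsub>P\<^esub> \<phi> s) \<oplus>\<^bsub>P\<^esub> (\<Oplus>\<^bsub>P\<^esub>s\<in>?T. g s \<odot>\<^bsub>P\<^esub> \<phi> s)"
      using cl fg T(2) by (intro P.M.finsum_addf) auto
    also have "\<dots> = free_lift k P \<phi> f \<oplus>\<^bsub>P\<^esub> free_lift k P \<phi> g"
      using fg T by (simp add: lift[of _ ?T])
    finally show "free_lift k P \<phi> (f \<oplus>\<^bsub>?F\<^esub> g) = free_lift k P \<phi> f \<oplus>\<^bsub>P\<^esub> free_lift k P \<phi> g" .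
  next
    fix c f assume c: "c \<in> carrier k" and f: "f \<in> carrier ?F"
    let ?T = "?s f"
    note T = S[OF f]
    have "free_lift k P \<phi> (c \<odot>\<^bsub>?F\<^esub> f) = (\<Oplus>\<^bsub>P\<^esub>s\<in>?T. (c \<odot>\<^bsub>?F\<^esub> f) s \<odot>\<^bsub>P\<^esub> \<phi> s)"
      using F.smult_closed[OF c f] c f T by (intro lift) (auto simp: free_module_simps(4))
    also have "\<dots> = (\<Oplus>\<^bsub>P\<^esub>s\<in>?T. c \<odot>\<^bsub>P\<^esub> (f s \<odot>\<^bsub>P\<^esub> \<phi> s))"
      using c f T(1) assms(2)
      by (intro P.M.finsum_cong') (auto simp: free_module_simps P.smult_assoc1 Pi_def subset_iff)
    also have "\<dots> = c \<odot>\<^bsub>P\<^esub> (\<Oplus>\<^bsub>P\<^esub>s\<in>?T. f s \<odot>\<^bsub>P\<^esub> \<phi> s)"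
      using c f T cl by (intro P.finsum_smult_ldistr[symmetric]) auto
    also have "\<dots> = c \<odot>\<^bsub>P\<^esub> free_lift k P \<phi> f"
      unfolding free_lift_def ..
    finally show "free_lift k P \<phi> (c \<odot>\<^bsub>?F\<^esub> f) = c \<odot>\<^bsub>P\<^esub> free_lift k P \<phi> f" .
  qed
qed

lemma free_lift_gen:
  assumes "module k P" "\<phi> \<in> S \<rightarrow> carrier P" "s \<in> S"
  shows "free_lift k P \<phi> (free_gen k s) = \<phi> s"
proof -
  interpret P: module k P by fact
  have s: "\<phi> s \<in> carrier P" using assms by auto
  have "free_lift k P \<phi> (free_gen k s) = (\<Oplus>\<^bsub>P\<^esub>t\<in>{s}. free_gen k s t \<odot>\<^bsub>P\<^esub> \<phi> t)"
    using assms(3) by (intro free_lift_superset[OF assms(1,2)] free_gen_closed P.R.is_cring)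
      (auto simp: free_gen_def)
  also have "\<dots> = \<phi> s" using s by (simp add: free_gen_def)
  finally show ?thesis .
qed

section \<open>Tensor products of modules\<close>

text \<open>Needed because \<open>tensor_null\<close> is defined as an intersection; nonemptiness of
  the family keeps the intersection inside the carrier.\<close>

lemma submodule_Inter:
  assumes "module k M" "\<U> \<noteq> {}" "\<And>U. U \<in> \<U> \<Longrightarrow> submodule U k M"
  shows "submodule (\<Inter>\<U>) k M"
proof -
  interpret module k M by fact
  note E = submoduleE[OF assms(3)]
  show ?thesis
  proof (rule submoduleI)
    show "\<zero>\<^bsub>M\<^esub> \<in> \<Inter>\<U>"
    proof
      fix U assume "U \<in> \<U>"
      interpret submodule U k M by (rule assms) fact
      \<comment> \<open>A submodule is a subgroup of the additive group viewed multiplicatively, so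
        \<open>one_closed\<close> speaks about zero.\<close>
      show "\<zero>\<^bsub>M\<^esub> \<in> U" using one_closed by simp
    qed
    show "\<Inter>\<U> \<subseteq> carrier M" using E(1) assms(2) by blast
    show "\<And>a. a \<in> \<Inter>\<U> \<Longrightarrow> \<ominus>\<^bsub>M\<^esub> a \<in> \<Inter>\<U>" using E(3) by blast
    show "\<And>a b. \<lbrakk>a \<in> \<Inter>\<U>; b \<in> \<Inter>\<U>\<rbrakk> \<Longrightarrow> a \<oplus>\<^bsub>M\<^esub> b \<in> \<Inter>\<U>" using E(5) by blast
    show "\<And>a x. \<lbrakk>a \<in> carrier k; x \<in> \<Inter>\<U>\<rbrakk> \<Longrightarrow> a \<odot>\<^bsub>M\<^esub> x \<in> \<Inter>\<U>" using E(4) by blast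
  qed
qed

text \<open>Serves the universal property: once the kernel of a linear map contains the relators, it
  takes part in the intersection \<open>tensor_null\<close> and hence contains it.\<close>

lemma submodule_kernel:
  assumes "module k M" "module k N" "f \<in> linear_maps k M N"
  shows "submodule {x \<in> carrier M. f x = \<zero>\<^bsub>N\<^esub>} k M"
proof -
  interpret M: module k M by fact
  interpret N: module k N by fact
  show ?thesis
    by (rule M.submoduleI) (use linear_maps_zero[OF assms] linear_maps_minus[OF assms]
        linear_maps_add[OF assms(3)] linear_maps_smult[OF assms(3)] in auto)
qed

lemma tensor_relators_subset:
  assumes "module k M" "module k N"
  shows "tensor_relators k M N \<subseteq> carrier (free_module k (carrier M \<times> carrier N))"
proof -
  interpret M: module k M by fact
  interpret N: module k N by fact
  interpret F: module k "free_module k (carrier M \<times> carrier N)"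
    by (rule free_module_module) unfold_locales
  have "free_gen k (x, y) \<in> carrier (free_module k (carrier M \<times> carrier N))"
    if "x \<in> carrier M" "y \<in> carrier N" for x y
    using that by (intro free_gen_closed M.R.is_cring) auto
  then show ?thesis unfolding tensor_relators_def Let_def
    by (auto intro!: F.M.minus_closed F.M.a_closed F.smult_closed)
qed

lemma tensor_null_submodule:
  assumes "module k M" "module k N"
  shows "submodule (tensor_null k M N) k (free_module k (carrier M \<times> carrier N))"
proof -
  interpret M: module k M by fact
  interpret F: module k "free_module k (carrier M \<times> carrier N)"
    by (rule free_module_module) unfold_locales
  \<comment> \<open>The full carrier is a submodule containing the relators, so the intersection is
    not over the empty family.\<close>
  show ?thesis unfolding tensor_null_def
    using tensor_relators_subset[OF assms] F.carrier_is_submodule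
    by (intro submodule_Inter F.module_axioms) auto
qed

lemma tensor_relators_null: "tensor_relators k M N \<subseteq> tensor_null k M N"
  unfolding tensor_null_def by blast

locale module_pair = M: module k M + N: module k N
  for k :: "'k ring" and M :: "('k, 'm) module" and N :: "('k, 'n) module"
begin

abbreviation "T \<equiv> tensor_module k M N"

end

text \<open>Cosets and representatives are confined to this locale. What can be said through pure
  tensors and lifts alone is exported to \<open>module_pair\<close> afterwards, and later arguments
  use only that.\<close>

locale tensor_quotient = module_pair
begin

abbreviation "F \<equiv> free_module k (carrier M \<times> carrier N)"
abbreviation "U \<equiv> tensor_null k M N"
abbreviation "cls f \<equiv> U +>\<^bsub>F\<^esub> f"

sublocale F: module k F
  by (rule free_module_module) unfold_locales

lemma U_submodule: "submodule U k F"
  by (rule tensor_null_submodule) unfold_locales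

sublocale U: abelian_subgroup U F
  by (intro abelian_subgroupI3 additive_subgroup.intro submodule.axioms(1)[OF U_submodule])
    unfold_locales

lemma tensor_module_simps:
  "carrier T = a_rcosets\<^bsub>F\<^esub> U" "\<zero>\<^bsub>T\<^esub> = U" "add T = set_add F"
  "smult T = (\<lambda>c p. \<Union>f\<in>p. U +>\<^bsub>F\<^esub> (c \<odot>\<^bsub>F\<^esub> f))"
  by (simp_all add: tensor_module_def Let_def)

lemma carrier_T: "carrier T = cls ` carrier F"
  by (auto simp: tensor_module_simps A_RCOSETS_def')

lemma cls_closed: "f \<in> carrier F \<Longrightarrow> cls f \<in> carrier T"
  by (simp add: carrier_T)

lemma cls_eq: 
  assumes "f \<in> carrier F" "g \<in> carrier F"
  shows "cls f = cls g \<longleftrightarrow> f \<ominus>\<^bsub>F\<^esub> g \<in> U"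
proof
  assume "cls f = cls g"
  then show "f \<ominus>\<^bsub>F\<^esub> g \<in> U"
    using U.a_rcos_self[OF assms(1)] U.a_rcos_module_imp[OF assms(2), of f]
    by (simp add: a_minus_def)
next
  assume "f \<ominus>\<^bsub>F\<^esub> g \<in> U"
  then have "f \<in> cls g"
    using U.a_rcos_module_rev[OF assms(2,1)] by (simp add: a_minus_def)
  then show "cls f = cls g"
    using U.a_repr_independence'[OF _ assms(2)] U.a_subgroup by auto
qed

lemma cls_add: "\<lbrakk>f \<in> carrier F; g \<in> carrier F\<rbrakk> \<Longrightarrow> cls f \<oplus>\<^bsub>T\<^esub> cls g = cls (f \<oplus>\<^bsub>F\<^esub> g)"
  by (simp add: tensor_module_simps U.a_rcos_sum)

lemma mem_cls:
  assumes "f \<in> carrier F" "g \<in> cls f"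
  shows "g \<in> carrier F" "g \<ominus>\<^bsub>F\<^esub> f \<in> U"
  using assms U.a_elemrcos_carrier U.a_rcos_module_imp by (auto simp: a_minus_def)

text \<open>Scaling a class is defined as a union over all representatives. Since \<open>U\<close>
  is closed under scaling, all members of this union are the same coset.\<close>

lemma cls_smult:
  assumes "c \<in> carrier k" "f \<in> carrier F"
  shows "c \<odot>\<^bsub>T\<^esub> cls f = cls (c \<odot>\<^bsub>F\<^esub> f)"
proof -
  have "cls (c \<odot>\<^bsub>F\<^esub> g) = cls (c \<odot>\<^bsub>F\<^esub> f)" if "g \<in> cls f" for g
  proof -
    note g = mem_cls[OF assms(2) that]
    have "(c \<odot>\<^bsub>F\<^esub> g) \<ominus>\<^bsub>F\<^esub> (c \<odot>\<^bsub>F\<^esub> f) = c \<odot>\<^bsub>F\<^esub> (g \<ominus>\<^bsub>F\<^esub> f)"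
      using g(1) assms by (simp add: a_minus_def F.smult_r_distr F.smult_r_minus)
    also have "\<dots> \<in> U" using submodule.smult_closed[OF U_submodule assms(1) g(2)] .
    finally show ?thesis using g assms by (subst cls_eq) auto
  qed
  moreover have "f \<in> cls f" by (rule U.a_rcos_self) fact
  ultimately have "(\<Union>g\<in>cls f. cls (c \<odot>\<^bsub>F\<^esub> g)) = cls (c \<odot>\<^bsub>F\<^esub> f)"
    by (intro SUP_eq_const) blast+
  then show ?thesis by (simp only: tensor_module_simps)
qed

lemma T_module: "module k T"
proof (rule moduleI)
  show "cring k" by (rule M.R.is_cring)
  show "abelian_group T"
  proof (rule abelian_groupI)
    show "\<zero>\<^bsub>T\<^esub> \<in> carrier T"
      by (simp add: tensor_module_simps U.a_subgroup_in_rcosets)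
    fix p q r assume "p \<in> carrier T" "q \<in> carrier T" "r \<in> carrier T"
    then obtain f g h where f: "p = cls f" "q = cls g" "r = cls h"
        "f \<in> carrier F" "g \<in> carrier F" "h \<in> carrier F"
      by (auto simp: carrier_T)
    then show "p \<oplus>\<^bsub>T\<^esub> q \<in> carrier T" "p \<oplus>\<^bsub>T\<^esub> q \<oplus>\<^bsub>T\<^esub> r = p \<oplus>\<^bsub>T\<^esub> (q \<oplus>\<^bsub>T\<^esub> r)"
        "p \<oplus>\<^bsub>T\<^esub> q = q \<oplus>\<^bsub>T\<^esub> p" 
      by (simp_all add: cls_closed cls_add F.M.a_ac)
    have zero: "\<zero>\<^bsub>T\<^esub> = cls \<zero>\<^bsub>F\<^esub>"
      using U.a_subset by (simp add: tensor_module_simps)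
    show "\<zero>\<^bsub>T\<^esub> \<oplus>\<^bsub>T\<^esub> p = p"
      using f by (simp add: zero cls_add)
    show "\<exists>q\<in>carrier T. q \<oplus>\<^bsub>T\<^esub> p = \<zero>\<^bsub>T\<^esub>"
      using f by (intro bexI[of _ "cls (\<ominus>\<^bsub>F\<^esub> f)"]) (simp_all add: zero cls_add cls_closed F.M.l_neg)
  qed
next
  show "\<And>p. p \<in> carrier T \<Longrightarrow> \<one>\<^bsub>k\<^esub> \<odot>\<^bsub>T\<^esub> p = p"
    by (auto simp: carrier_T cls_smult)
  fix a p assume a: "a \<in> carrier k" and "p \<in> carrier T"
  then obtain f where f: "p = cls f" "f \<in> carrier F" by (auto simp: carrier_T)
  show "a \<odot>\<^bsub>T\<^esub> p \<in> carrier T"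
    using a f by (simp_all add: cls_closed cls_smult)
  show "a \<odot>\<^bsub>T\<^esub> (p \<oplus>\<^bsub>T\<^esub> q) = a \<odot>\<^bsub>T\<^esub> p \<oplus>\<^bsub>T\<^esub> a \<odot>\<^bsub>T\<^esub> q" if "q \<in> carrier T" for q
    using a f that by (auto simp: carrier_T cls_smult cls_add F.smult_r_distr)
  fix b assume b: "b \<in> carrier k"
  show "(a \<oplus>\<^bsub>k\<^esub> b) \<odot>\<^bsub>T\<^esub> p = a \<odot>\<^bsub>T\<^esub> p \<oplus>\<^bsub>T\<^esub> b \<odot>\<^bsub>T\<^esub> p"
      "(a \<otimes>\<^bsub>k\<^esub> b) \<odot>\<^bsub>T\<^esub> p = a \<odot>\<^bsub>T\<^esub> (b \<odot>\<^bsub>T\<^esub> p)"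
    using a b f by (simp_all add: cls_smult cls_add F.smult_l_distr F.smult_assoc1)
qed

lemma pure_eq: "pure_tensor k M N x y = cls (free_gen k (x, y))"
  by (simp add: pure_tensor_def)

lemma gen_closed: "\<lbrakk>x \<in> carrier M; y \<in> carrier N\<rbrakk> \<Longrightarrow> free_gen k (x, y) \<in> carrier F"
  by (rule free_gen_closed) (auto intro: M.R.is_cring)

end

section \<open>Bilinear maps and the universal property of the tensor product\<close>

definition bilinear_maps ::
  "'k ring \<Rightarrow> ('k, 'm) module \<Rightarrow> ('k, 'n) module \<Rightarrow> ('k, 'p) module \<Rightarrow> ('m \<Rightarrow> 'n \<Rightarrow> 'p) set" where
  "bilinear_maps k M N P = {\<phi>. (\<forall>x\<in>carrier M. \<phi> x \<in> linear_maps k N P) \<and>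
     (\<forall>y\<in>carrier N. (\<lambda>x. \<phi> x y) \<in> linear_maps k M P)}"

lemma bilinear_mapsI:
  assumes "\<And>x. x \<in> carrier M \<Longrightarrow> \<phi> x \<in> linear_maps k N P"
    and "\<And>y. y \<in> carrier N \<Longrightarrow> (\<lambda>x. \<phi> x y) \<in> linear_maps k M P"
  shows "\<phi> \<in> bilinear_maps k M N P"
  using assms by (auto simp: bilinear_maps_def)

lemma bilinear_maps_linear:
  assumes "\<phi> \<in> bilinear_maps k M N P"
  shows "x \<in> carrier M \<Longrightarrow> \<phi> x \<in> linear_maps k N P"
    and "y \<in> carrier N \<Longrightarrow> (\<lambda>x. \<phi> x y) \<in> linear_maps k M P"
  using assms by (auto simp: bilinear_maps_def)

lemma bilinear_maps_closed:
  "\<phi> \<in> bilinear_maps k M N P \<Longrightarrow> x \<in> carrier M \<Longrightarrow> y \<in> carrier N \<Longrightarrow> \<phi> x y \<in> carrier P"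
  using linear_maps_closed[OF bilinear_maps_linear(1)] .

context tensor_quotient
begin

text \<open>Each of the four families of relators is one of the four laws of bilinearity, read
  modulo \<open>U\<close>.\<close>

lemma pure_bilinear: "pure_tensor k M N \<in> bilinear_maps k M N T"
proof -
  have rel: "cls f = cls g" if "f \<ominus>\<^bsub>F\<^esub> g \<in> tensor_relators k M N" "f \<in> carrier F" "g \<in> carrier F" for f g
    using that tensor_relators_null by (subst cls_eq) auto
  have add1: "cls (free_gen k (x \<oplus>\<^bsub>M\<^esub> x', y)) = cls (free_gen k (x, y) \<oplus>\<^bsub>F\<^esub> free_gen k (x', y))"
    if "x \<in> carrier M" "x' \<in> carrier M" "y \<in> carrier N" for x x' y
    using that by (intro rel F.M.a_closed gen_closed M.M.a_closed) (auto simp: tensor_relators_def Let_def)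
  have add2: "cls (free_gen k (x, y \<oplus>\<^bsub>N\<^esub> y')) = cls (free_gen k (x, y) \<oplus>\<^bsub>F\<^esub> free_gen k (x, y'))"
    if "x \<in> carrier M" "y \<in> carrier N" "y' \<in> carrier N" for x y y'
    using that by (intro rel F.M.a_closed gen_closed N.M.a_closed) (auto simp: tensor_relators_def Let_def)
  have smult1: "cls (free_gen k (c \<odot>\<^bsub>M\<^esub> x, y)) = cls (c \<odot>\<^bsub>F\<^esub> free_gen k (x, y))"
    if "c \<in> carrier k" "x \<in> carrier M" "y \<in> carrier N" for c x y
    using that by (intro rel F.smult_closed gen_closed M.smult_closed) (auto simp: tensor_relators_def Let_def)
  have smult2: "cls (free_gen k (x, c \<odot>\<^bsub>N\<^esub> y)) = cls (c \<odot>\<^bsub>F\<^esub> free_gen k (x, y))"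
    if "c \<in> carrier k" "x \<in> carrier M" "y \<in> carrier N" for c x y
    using that by (intro rel F.smult_closed gen_closed N.smult_closed) (auto simp: tensor_relators_def Let_def)
  show ?thesis
    by (intro bilinear_mapsI linear_mapsI)
      (simp_all add: pure_eq cls_closed cls_add cls_smult gen_closed add1 add2 smult1 smult2)
qed

text \<open>Bilinearity of \<open>\<phi>\<close> puts the relators, and therefore \<open>U\<close>,
  into the kernel of the free lift. All representatives of a class then have one image, and this is
  the singleton that \<open>the_elem\<close> reads off.\<close>

lemma tensor_lift_cls:
  assumes P: "module k P" and \<phi>: "\<phi> \<in> bilinear_maps k M N P" and f: "f \<in> carrier F"
  shows "tensor_lift k P \<phi> (cls f) = free_lift k P (\<lambda>(x, y). \<phi> x y) f"
proof -
  interpret P: module k P by fact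
  let ?l = "free_lift k P (\<lambda>(x, y). \<phi> x y)"
  have cl: "(\<lambda>(x, y). \<phi> x y) \<in> carrier M \<times> carrier N \<rightarrow> carrier P"
    using bilinear_maps_closed[OF \<phi>] by auto
  note lin = free_lift_linear[OF P cl]
  note add = linear_maps_add[OF lin] and minus = linear_maps_minus[OF F.module_axioms P lin]
    and smult = linear_maps_smult[OF lin] and lcl = linear_maps_closed[OF lin]
  have gen: "?l (free_gen k (x, y)) = \<phi> x y" if "x \<in> carrier M" "y \<in> carrier N" for x y
    using free_lift_gen[OF P cl, of "(x, y)"] that by simp
  have lm: "?l (g \<ominus>\<^bsub>F\<^esub> h) = ?l g \<ominus>\<^bsub>P\<^esub> ?l h" if "g \<in> carrier F" "h \<in> carrier F" for g h
    using that by (simp add: a_minus_def add minus)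
  note \<phi>1 = linear_maps_add[OF bilinear_maps_linear(1)[OF \<phi>]] linear_maps_add[OF bilinear_maps_linear(2)[OF \<phi>]]
     linear_maps_smult[OF bilinear_maps_linear(1)[OF \<phi>]] linear_maps_smult[OF bilinear_maps_linear(2)[OF \<phi>]]
  have "tensor_relators k M N \<subseteq> {g \<in> carrier F. ?l g = \<zero>\<^bsub>P\<^esub>}"
    unfolding tensor_relators_def Let_def
    by (auto simp: lm add smult gen gen_closed \<phi>1 bilinear_maps_closed[OF \<phi>] F.M.minus_closed
        P.M.minus_eq P.M.r_neg)
  then have "U \<subseteq> {g \<in> carrier F. ?l g = \<zero>\<^bsub>P\<^esub>}"
    unfolding tensor_null_def using submodule_kernel[OF F.module_axioms P lin] by blast
  then have "?l g = ?l f" if "g \<in> cls f" for g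
    using mem_cls[OF f that] lm[of g f] f lcl P.M.minus_equality[of "?l g" "\<ominus>\<^bsub>P\<^esub> ?l f"]
    by (auto simp: a_minus_def)
  moreover have "f \<in> cls f" by (rule U.a_rcos_self) fact
  ultimately have "?l ` cls f = {?l f}" by blast
  then show ?thesis by (simp add: tensor_lift_def)
qed

lemma tensor_lift_linear:
  assumes P: "module k P" and \<phi>: "\<phi> \<in> bilinear_maps k M N P"
  shows "tensor_lift k P \<phi> \<in> linear_maps k T P"
proof -
  have cl: "(\<lambda>(x, y). \<phi> x y) \<in> carrier M \<times> carrier N \<rightarrow> carrier P"
    using bilinear_maps_closed[OF \<phi>] by auto
  note lin = free_lift_linear[OF P cl]
  show ?thesis
    by (rule linear_mapsI)
      (auto simp: carrier_T cls_add cls_smult tensor_lift_cls[OF assms] linear_maps_add[OF lin]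
        linear_maps_smult[OF lin] linear_maps_closed[OF lin])
qed

lemma tensor_lift_pure:
  assumes P: "module k P" and \<phi>: "\<phi> \<in> bilinear_maps k M N P"
    and "x \<in> carrier M" "y \<in> carrier N"
  shows "tensor_lift k P \<phi> (pure_tensor k M N x y) = \<phi> x y"
proof -
  have cl: "(\<lambda>(x, y). \<phi> x y) \<in> carrier M \<times> carrier N \<rightarrow> carrier P"
    using bilinear_maps_closed[OF \<phi>] by auto
  show ?thesis
    using assms(3,4) free_lift_gen[OF P cl, of "(x, y)"]
    by (simp add: pure_eq tensor_lift_cls[OF P \<phi>] gen_closed)
qed

text \<open>There is no case for scalar multiples, because a scalar can be absorbed into the left
  factor of a pure tensor.\<close>

lemma tensor_induct [consumes 1, case_names zero pure add]:
  assumes p: "p \<in> carrier T"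
    and zero: "Q \<zero>\<^bsub>T\<^esub>"
    and pure: "\<And>x y. \<lbrakk>x \<in> carrier M; y \<in> carrier N\<rbrakk> \<Longrightarrow> Q (pure_tensor k M N x y)"
    and add: "\<And>p q. \<lbrakk>p \<in> carrier T; q \<in> carrier T; Q p; Q q\<rbrakk> \<Longrightarrow> Q (p \<oplus>\<^bsub>T\<^esub> q)"
  shows "Q p"
proof -
  obtain f where f: "f \<in> carrier F" and p: "p = cls f" using p by (auto simp: carrier_T)
  have "Q (cls f)" using M.R.is_cring f
  proof (induction f rule: free_module_induct)
    case zero
    have "cls \<zero>\<^bsub>F\<^esub> = \<zero>\<^bsub>T\<^esub>"
      using U.a_subset by (simp add: tensor_module_simps)
    then show ?case using assms(2) by simp
  next
    case (add f c s)
    obtain x y where s: "s = (x, y)" "x \<in> carrier M" "y \<in> carrier N" using \<open>s \<in> _\<close> by auto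
    have c: "c \<in> carrier k" by fact
    have "cls (f \<oplus>\<^bsub>F\<^esub> c \<odot>\<^bsub>F\<^esub> free_gen k s) = cls f \<oplus>\<^bsub>T\<^esub> c \<odot>\<^bsub>T\<^esub> pure_tensor k M N x y"
      using add s by (simp add: cls_add cls_smult pure_eq gen_closed)
    also have "c \<odot>\<^bsub>T\<^esub> pure_tensor k M N x y = pure_tensor k M N (c \<odot>\<^bsub>M\<^esub> x) y"
      using linear_maps_smult[OF bilinear_maps_linear(2)[OF pure_bilinear s(3)] c s(2)] by simp
    finally show ?case
      using add s assms(4)[of "cls f" "pure_tensor k M N (c \<odot>\<^bsub>M\<^esub> x) y"] pure[of "c \<odot>\<^bsub>M\<^esub> x" y]
        bilinear_maps_closed[OF pure_bilinear, of "c \<odot>\<^bsub>M\<^esub> x" y]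
      by (simp add: cls_closed)
  qed
  then show ?thesis using p by simp
qed

end

context module_pair
begin

lemmas T_module = tensor_quotient.T_module[OF tensor_quotient.intro[OF module_pair_axioms]]
lemmas pure_bilinear = tensor_quotient.pure_bilinear[OF tensor_quotient.intro[OF module_pair_axioms]]
lemmas tensor_lift_linear = tensor_quotient.tensor_lift_linear[OF tensor_quotient.intro[OF module_pair_axioms]]
lemmas tensor_lift_pure = tensor_quotient.tensor_lift_pure[OF tensor_quotient.intro[OF module_pair_axioms]]
lemmas tensor_induct [consumes 1, case_names zero pure add] =
  tensor_quotient.tensor_induct[OF tensor_quotient.intro[OF module_pair_axioms]]

text \<open>The standard way to prove identities below: both sides are exhibited as linear maps in
  one chosen tensor, and the values at pure tensors are compared. Identities in several tensors are
  handled one argument at a time.\<close>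

lemma tensor_ext:
  assumes P: "module k P" and f: "f \<in> linear_maps k T P" and g: "g \<in> linear_maps k T P"
    and eq: "\<And>x y. \<lbrakk>x \<in> carrier M; y \<in> carrier N\<rbrakk> \<Longrightarrow>
      f (pure_tensor k M N x y) = g (pure_tensor k M N x y)"
    and p: "p \<in> carrier T"
  shows "f p = g p"
  using p
proof (induction p rule: tensor_induct)
  case zero
  then show ?case using linear_maps_zero[OF T_module P f] linear_maps_zero[OF T_module P g] by simp
next
  case (pure x y)
  then show ?case by (rule eq)
next
  case (add p q)
  then show ?case using linear_maps_add[OF f] linear_maps_add[OF g] by simp
qed

end

text \<open>Handles lifts that depend on a parameter, as they occur in nested lifts. For linearity
  in \<open>x\<close>, the lift at a sum and the sum of the lifts are both linear in
  \<open>p\<close>, so they are compared on pure tensors, where the claim is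
  \<open>lin\<close>.\<close>

lemma (in module_pair) tensor_lift_bilinear:
  assumes P: "module k P" and L: "module k L"
    and \<phi>: "\<And>x. x \<in> carrier L \<Longrightarrow> \<phi> x \<in> bilinear_maps k M N P"
    and lin: "\<And>a b. \<lbrakk>a \<in> carrier M; b \<in> carrier N\<rbrakk> \<Longrightarrow> (\<lambda>x. \<phi> x a b) \<in> linear_maps k L P"
  shows "(\<lambda>x. tensor_lift k P (\<phi> x)) \<in> bilinear_maps k L T P"
proof (rule bilinear_mapsI)
  interpret P: module k P by fact
  interpret L: module k L by fact
  note lft = tensor_lift_linear[OF P \<phi>] and pure = tensor_lift_pure[OF P \<phi>]
  show "tensor_lift k P (\<phi> x) \<in> linear_maps k T P" if "x \<in> carrier L" for x
    using that by (rule lft)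
  fix p assume p: "p \<in> carrier T"
  show "(\<lambda>x. tensor_lift k P (\<phi> x) p) \<in> linear_maps k L P"
  proof (rule linear_mapsI)
    show "tensor_lift k P (\<phi> x) p \<in> carrier P" if "x \<in> carrier L" for x
      using linear_maps_closed[OF lft] that p .
  next
    fix x y assume xy: "x \<in> carrier L" "y \<in> carrier L"
    show "tensor_lift k P (\<phi> (x \<oplus>\<^bsub>L\<^esub> y)) p = tensor_lift k P (\<phi> x) p \<oplus>\<^bsub>P\<^esub> tensor_lift k P (\<phi> y) p"
      by (rule tensor_ext[OF P _ _ _ p])
        (intro lft linear_maps_add_fun P L.M.a_closed xy | simp add: xy pure linear_maps_add[OF lin])+
  next
    fix c x assume cx: "c \<in> carrier k" "x \<in> carrier L"
    show "tensor_lift k P (\<phi> (c \<odot>\<^bsub>L\<^esub> x)) p = c \<odot>\<^bsub>P\<^esub> tensor_lift k P (\<phi> x) p"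
      by (rule tensor_ext[OF P _ _ _ p])
        (intro lft linear_maps_smult_fun P L.smult_closed cx | simp add: cx pure linear_maps_smult[OF lin])+
  qed
qed

lemma (in module_pair) tensor_map_bilinear:
  assumes "module k M'" "module k N'" "f \<in> linear_maps k M' M" "g \<in> linear_maps k N' N"
  shows "(\<lambda>x y. pure_tensor k M N (f x) (g y)) \<in> bilinear_maps k M' N' T"
  using linear_maps_compose[OF assms(3) bilinear_maps_linear(2)[OF pure_bilinear]]
    linear_maps_compose[OF assms(4) bilinear_maps_linear(1)[OF pure_bilinear]]
    linear_maps_closed[OF assms(3)] linear_maps_closed[OF assms(4)]
  by (intro bilinear_mapsI) auto

lemma (in module_pair) tensor_map_linear:
  assumes "module k M'" "module k N'" "f \<in> linear_maps k M' M" "g \<in> linear_maps k N' N"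
  shows "tensor_map k M N f g \<in> linear_maps k (tensor_module k M' N') T"
  unfolding tensor_map_def
  by (intro module_pair.tensor_lift_linear module_pair.intro assms T_module tensor_map_bilinear)

lemma (in module_pair) tensor_map_pure:
  assumes "module k M'" "module k N'" "f \<in> linear_maps k M' M" "g \<in> linear_maps k N' N"
    and "x \<in> carrier M'" "y \<in> carrier N'"
  shows "tensor_map k M N f g (pure_tensor k M' N' x y) = pure_tensor k M N (f x) (g y)"
  unfolding tensor_map_def
  by (intro module_pair.tensor_lift_pure module_pair.intro assms T_module tensor_map_bilinear)

lemma (in module_pair) flip_bilinear:
  "(\<lambda>y x. pure_tensor k M N x y) \<in> bilinear_maps k N M T"
  using bilinear_maps_linear[OF pure_bilinear] by (intro bilinear_mapsI)

lemma (in module_pair) tensor_flip_linear: "tensor_flip k N M \<in> linear_maps k (tensor_module k N M) T"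
  unfolding tensor_flip_def
  by (intro module_pair.tensor_lift_linear module_pair.intro T_module flip_bilinear
      M.module_axioms N.module_axioms)

lemma (in module_pair) tensor_flip_pure:
  assumes "x \<in> carrier M" "y \<in> carrier N"
  shows "tensor_flip k N M (pure_tensor k N M y x) = pure_tensor k M N x y"
  unfolding tensor_flip_def
  by (intro module_pair.tensor_lift_pure module_pair.intro T_module flip_bilinear assms
      M.module_axioms N.module_axioms)

section \<open>Algebras and their homomorphisms\<close>

lemma assoc_algebra_module: "assoc_algebra k A \<Longrightarrow> module k A"
  by (simp add: assoc_algebra_def)

lemma algebra_homs_linear: "f \<in> algebra_homs k A B \<Longrightarrow> f \<in> linear_maps k A B"
  by (simp add: algebra_homs_def)

lemma algebra_homs_closed: "f \<in> algebra_homs k A B \<Longrightarrow> x \<in> carrier A \<Longrightarrow> f x \<in> carrier B"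
  by (auto simp: algebra_homs_def intro: linear_maps_closed)

lemma algebra_homs_mult:
  "f \<in> algebra_homs k A B \<Longrightarrow> x \<in> carrier A \<Longrightarrow> y \<in> carrier A \<Longrightarrow>
    f (x \<otimes>\<^bsub>A\<^esub> y) = f x \<otimes>\<^bsub>B\<^esub> f y"
  by (simp add: algebra_homs_def ring_hom_mult)

lemma algebra_homs_one: "f \<in> algebra_homs k A B \<Longrightarrow> f \<one>\<^bsub>A\<^esub> = \<one>\<^bsub>B\<^esub>"
  by (simp add: algebra_homs_def ring_hom_one)

lemma algebra_homsI:
  assumes "f \<in> linear_maps k A B"
    and "\<And>x y. \<lbrakk>x \<in> carrier A; y \<in> carrier A\<rbrakk> \<Longrightarrow> f (x \<otimes>\<^bsub>A\<^esub> y) = f x \<otimes>\<^bsub>B\<^esub> f y"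
    and "f \<one>\<^bsub>A\<^esub> = \<one>\<^bsub>B\<^esub>"
  shows "f \<in> algebra_homs k A B"
  unfolding algebra_homs_def
  by (intro IntI ring_hom_memI linear_maps_closed[OF assms(1)] linear_maps_add[OF assms(1)] assms)

lemma algebra_homs_compose:
  "f \<in> algebra_homs k A B \<Longrightarrow> g \<in> algebra_homs k B C \<Longrightarrow> (\<lambda>x. g (f x)) \<in> algebra_homs k A C"
  by (rule algebra_homsI)
    (auto simp: algebra_homs_closed[of f k A B] algebra_homs_mult[of _ k] algebra_homs_one[of _ k]
      intro: linear_maps_compose[OF algebra_homs_linear algebra_homs_linear])

lemma algebra_homs_id: "(\<lambda>x. x) \<in> algebra_homs k A A"
  by (intro algebra_homsI linear_maps_id) auto

lemma mult_bilinear: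
  assumes "assoc_algebra k A"
  shows "monoid.mult A \<in> bilinear_maps k A A A"
proof -
  interpret assoc_algebra k A by fact
  show ?thesis
    by (intro bilinear_mapsI linear_mapsI) (auto simp: r_distr l_distr smult_mult_left smult_mult_right)
qed

section \<open>The tensor product of algebras\<close>

lemma tensor_algebra_simps [simp]:
  "carrier (tensor_algebra k A B) = carrier (tensor_module k A B)"
  "add (tensor_algebra k A B) = add (tensor_module k A B)"
  "ring.zero (tensor_algebra k A B) = ring.zero (tensor_module k A B)"
  "smult (tensor_algebra k A B) = smult (tensor_module k A B)"
  "one (tensor_algebra k A B) = pure_tensor k A B \<one>\<^bsub>A\<^esub> \<one>\<^bsub>B\<^esub>"
  by (simp_all add: tensor_algebra_def)

lemma linear_maps_tensor_algebra [simp]: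
  "linear_maps k (tensor_algebra k A B) P = linear_maps k (tensor_module k A B) P"
  "linear_maps k Q (tensor_algebra k A B) = linear_maps k Q (tensor_module k A B)"
  by (simp_all add: linear_maps_def)

text \<open>In iterated products the inner factor appears both as a \<open>tensor_algebra\<close>
  and as a \<open>tensor_module\<close>. These records differ only in multiplication and unit, which
  the tensor product of modules does not read.\<close>

lemma tensor_null_tensor_algebra:
  "tensor_null k (tensor_algebra k A B) C = tensor_null k (tensor_module k A B) C"
  "tensor_null k C (tensor_algebra k A B) = tensor_null k C (tensor_module k A B)"
  by (simp_all only: tensor_null_def tensor_relators_def tensor_algebra_simps)

lemma tensor_module_tensor_algebra:
  "tensor_module k (tensor_algebra k A B) C = tensor_module k (tensor_module k A B) C"
  "tensor_module k C (tensor_algebra k A B) = tensor_module k C (tensor_module k A B)"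
  by (simp_all only: tensor_module_def tensor_null_tensor_algebra tensor_algebra_simps)

lemma pure_tensor_tensor_algebra:
  "pure_tensor k (tensor_algebra k A B) C = pure_tensor k (tensor_module k A B) C"
  "pure_tensor k C (tensor_algebra k A B) = pure_tensor k C (tensor_module k A B)"
  by (intro ext, simp only: pure_tensor_def tensor_null_tensor_algebra tensor_algebra_simps)+

locale algebra_pair = A: assoc_algebra k A + B: assoc_algebra k B
  for k :: "'k ring" and A :: "('k, 'a) module" and B :: "('k, 'b) module"
begin

sublocale module_pair k A B by unfold_locales
sublocale T: module k T by (rule T_module)

abbreviation "TA \<equiv> tensor_algebra k A B"
abbreviation "pt \<equiv> pure_tensor k A B"

lemma pure_closed: "x \<in> carrier A \<Longrightarrow> y \<in> carrier B \<Longrightarrow> pt x y \<in> carrier T"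
  by (rule bilinear_maps_closed[OF pure_bilinear])

lemma mult_inner_bilinear:
  assumes "a \<in> carrier A" "b \<in> carrier B"
  shows "(\<lambda>a' b'. pt (a \<otimes>\<^bsub>A\<^esub> a') (b \<otimes>\<^bsub>B\<^esub> b')) \<in> bilinear_maps k A B T"
  using assms
  by (intro tensor_map_bilinear A.module_axioms B.module_axioms
      bilinear_maps_linear(1)[OF mult_bilinear[OF A.assoc_algebra_axioms]] bilinear_maps_linear(1)[OF mult_bilinear[OF B.assoc_algebra_axioms]])

text \<open>For linearity in one of \<open>a\<close> and \<open>b\<close> the other is fixed and the
  inner lift is viewed as a lift with a parameter, to which \<open>tensor_lift_bilinear\<close>
  applies.\<close>

lemma mult_outer_bilinear:
  assumes "q \<in> carrier T"
  shows "(\<lambda>a b. tensor_lift k T (\<lambda>a' b'. pt (a \<otimes>\<^bsub>A\<^esub> a') (b \<otimes>\<^bsub>B\<^esub> b')) q) \<in> bilinear_maps k A B T"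
proof (rule bilinear_mapsI)
  fix a assume a: "a \<in> carrier A"
  have "(\<lambda>b. tensor_lift k T (\<lambda>a' b'. pt (a \<otimes>\<^bsub>A\<^esub> a') (b \<otimes>\<^bsub>B\<^esub> b'))) \<in> bilinear_maps k B T T"
    using a by (intro tensor_lift_bilinear T_module B.module_axioms mult_inner_bilinear
        linear_maps_compose[OF bilinear_maps_linear(2)[OF mult_bilinear[OF B.assoc_algebra_axioms]] bilinear_maps_linear(1)[OF pure_bilinear]]) auto
  then show "(\<lambda>b. tensor_lift k T (\<lambda>a' b'. pt (a \<otimes>\<^bsub>A\<^esub> a') (b \<otimes>\<^bsub>B\<^esub> b')) q) \<in> linear_maps k B T"
    using assms by (rule bilinear_maps_linear(2))
next
  fix b assume b: "b \<in> carrier B"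
  have "(\<lambda>a. tensor_lift k T (\<lambda>a' b'. pt (a \<otimes>\<^bsub>A\<^esub> a') (b \<otimes>\<^bsub>B\<^esub> b'))) \<in> bilinear_maps k A T T"
    using b by (intro tensor_lift_bilinear T_module A.module_axioms mult_inner_bilinear
        linear_maps_compose[OF bilinear_maps_linear(2)[OF mult_bilinear[OF A.assoc_algebra_axioms]] bilinear_maps_linear(2)[OF pure_bilinear]]) auto
  then show "(\<lambda>a. tensor_lift k T (\<lambda>a' b'. pt (a \<otimes>\<^bsub>A\<^esub> a') (b \<otimes>\<^bsub>B\<^esub> b')) q) \<in> linear_maps k A T"
    using assms by (rule bilinear_maps_linear(2))
qed

lemma TA_mult_def:
  "p \<otimes>\<^bsub>TA\<^esub> q =
    tensor_lift k T (\<lambda>a b. tensor_lift k T (\<lambda>a' b'. pt (a \<otimes>\<^bsub>A\<^esub> a') (b \<otimes>\<^bsub>B\<^esub> b')) q) p"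
  by (simp add: tensor_algebra_def)

lemma TA_mult_bilinear: "monoid.mult TA \<in> bilinear_maps k T T T"
proof (rule bilinear_mapsI)
  fix q assume q: "q \<in> carrier T"
  show "(\<lambda>p. p \<otimes>\<^bsub>TA\<^esub> q) \<in> linear_maps k T T"
    unfolding TA_mult_def by (intro tensor_lift_linear T_module mult_outer_bilinear q)
next
  fix p assume p: "p \<in> carrier T"
  have "(\<lambda>q. tensor_lift k T (\<lambda>a b. tensor_lift k T (\<lambda>a' b'. pt (a \<otimes>\<^bsub>A\<^esub> a') (b \<otimes>\<^bsub>B\<^esub> b')) q))
    \<in> bilinear_maps k T T T"
    by (intro tensor_lift_bilinear T_module mult_outer_bilinear tensor_lift_linear mult_inner_bilinear)
  then show "monoid.mult TA p \<in> linear_maps k T T"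
    using bilinear_maps_linear(2)[OF _ p] by (simp add: TA_mult_def[abs_def])
qed

lemma TA_mult_pure:
  assumes "a \<in> carrier A" "b \<in> carrier B" "a' \<in> carrier A" "b' \<in> carrier B"
  shows "pt a b \<otimes>\<^bsub>TA\<^esub> pt a' b' = pt (a \<otimes>\<^bsub>A\<^esub> a') (b \<otimes>\<^bsub>B\<^esub> b')"
  using assms
  by (simp add: TA_mult_def tensor_lift_pure[OF T_module] mult_outer_bilinear mult_inner_bilinear pure_closed)

lemma TA_algebra: "assoc_algebra k TA"
proof -
  note m1 = bilinear_maps_linear(1)[OF TA_mult_bilinear] and m2 = bilinear_maps_linear(2)[OF TA_mult_bilinear]
  note cl = bilinear_maps_closed[OF TA_mult_bilinear]
  note add1 = linear_maps_add[OF m1] and add2 = linear_maps_add[OF m2]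
  have 0: "p \<otimes>\<^bsub>TA\<^esub> \<zero>\<^bsub>T\<^esub> = \<zero>\<^bsub>T\<^esub>" "\<zero>\<^bsub>T\<^esub> \<otimes>\<^bsub>TA\<^esub> p = \<zero>\<^bsub>T\<^esub>" if "p \<in> carrier T" for p
    using linear_maps_zero[OF T_module T_module m1[OF that]] linear_maps_zero[OF T_module T_module m2[OF that]]
    by auto
  have one: "pt \<one>\<^bsub>A\<^esub> \<one>\<^bsub>B\<^esub> \<in> carrier T" by (intro pure_closed) auto
  \<comment> \<open>Associativity is trilinear: arbitrary tensors replace pure ones first in the
    left, then in the middle and then in the right argument.\<close>
  have assoc_pure: "p \<otimes>\<^bsub>TA\<^esub> pt a b \<otimes>\<^bsub>TA\<^esub> pt a' b' = p \<otimes>\<^bsub>TA\<^esub> (pt a b \<otimes>\<^bsub>TA\<^esub> pt a' b')"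
    if "p \<in> carrier T" "a \<in> carrier A" "b \<in> carrier B" "a' \<in> carrier A" "b' \<in> carrier B" for p a b a' b'
    by (rule tensor_ext[OF T_module _ _ _ that(1)])
      (intro linear_maps_compose[OF m2 m2] m2 cl pure_closed that
        | simp add: TA_mult_pure A.m_assoc B.m_assoc that)+
  have assoc_pure2: "p \<otimes>\<^bsub>TA\<^esub> q \<otimes>\<^bsub>TA\<^esub> pt a' b' = p \<otimes>\<^bsub>TA\<^esub> (q \<otimes>\<^bsub>TA\<^esub> pt a' b')"
    if "p \<in> carrier T" "q \<in> carrier T" "a' \<in> carrier A" "b' \<in> carrier B" for p q a' b'
    by (rule tensor_ext[OF T_module _ _ _ that(2)])
      (intro linear_maps_compose[OF m1 m2] linear_maps_compose[OF m2 m1] cl pure_closed that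
        | simp add: assoc_pure that)+
  have assoc: "p \<otimes>\<^bsub>TA\<^esub> q \<otimes>\<^bsub>TA\<^esub> r = p \<otimes>\<^bsub>TA\<^esub> (q \<otimes>\<^bsub>TA\<^esub> r)"
    if "p \<in> carrier T" "q \<in> carrier T" "r \<in> carrier T" for p q r
    by (rule tensor_ext[OF T_module _ _ _ that(3)])
      (intro linear_maps_compose[OF m1 m1] m1 cl that | simp add: assoc_pure2 that)+
  have one1: "pt \<one>\<^bsub>A\<^esub> \<one>\<^bsub>B\<^esub> \<otimes>\<^bsub>TA\<^esub> p = p" if "p \<in> carrier T" for p
    by (rule tensor_ext[OF T_module _ _ _ that]) (intro m1 linear_maps_id one | simp add: TA_mult_pure)+
  have one2: "p \<otimes>\<^bsub>TA\<^esub> pt \<one>\<^bsub>A\<^esub> \<one>\<^bsub>B\<^esub> = p" if "p \<in> carrier T" for p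
    by (rule tensor_ext[OF T_module _ _ _ that]) (intro m2 linear_maps_id one | simp add: TA_mult_pure)+
  have mod: "module k TA"
  proof (rule moduleI)
    show "abelian_group TA"
      by (rule abelian_groupI) (auto simp: T.M.a_ac intro: bexI[of _ "\<ominus>\<^bsub>T\<^esub> _"] T.M.l_neg)
  qed (auto simp: A.R.is_cring T.smult_l_distr T.smult_r_distr T.smult_assoc1)
  moreover have "ring TA"
    by (rule ringI) (use mod in \<open>auto intro!: monoidI simp: module_def cl one one1 one2 assoc add1 add2\<close>)
  ultimately show ?thesis
    by (auto simp: assoc_algebra_def assoc_algebra_axioms_def linear_maps_smult[OF m1] linear_maps_smult[OF m2])
qed

sublocale TA: assoc_algebra k TA by (rule TA_algebra)

lemma pure_left_hom: "(\<lambda>x. pt x \<one>\<^bsub>B\<^esub>) \<in> algebra_homs k A TA"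
  by (intro algebra_homsI) (auto intro: bilinear_maps_linear(2)[OF pure_bilinear] simp: TA_mult_pure)

lemma pure_right_hom: "(\<lambda>y. pt \<one>\<^bsub>A\<^esub> y) \<in> algebra_homs k B TA"
  by (intro algebra_homsI) (auto intro: bilinear_maps_linear(1)[OF pure_bilinear] simp: TA_mult_pure)

text \<open>Both sides of the multiplication law are linear in each argument, so the law on pure
  tensors suffices; the left argument is freed in fact \<open>1\<close>, the right one in the
  conclusion.\<close>

lemma tensor_lift_hom:
  assumes S: "assoc_algebra k S" and \<phi>: "\<phi> \<in> bilinear_maps k A B S"
    and mult: "\<And>a b a' b'. \<lbrakk>a \<in> carrier A; b \<in> carrier B; a' \<in> carrier A; b' \<in> carrier B\<rbrakk> \<Longrightarrow>
      \<phi> (a \<otimes>\<^bsub>A\<^esub> a') (b \<otimes>\<^bsub>B\<^esub> b') = \<phi> a b \<otimes>\<^bsub>S\<^esub> \<phi> a' b'"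
    and one: "\<phi> \<one>\<^bsub>A\<^esub> \<one>\<^bsub>B\<^esub> = \<one>\<^bsub>S\<^esub>"
  shows "tensor_lift k S \<phi> \<in> algebra_homs k TA S"
proof (rule algebra_homsI)
  interpret S: assoc_algebra k S by fact
  note P = assoc_algebra_module[OF S]
  let ?f = "tensor_lift k S \<phi>"
  note L = tensor_lift_linear[OF P \<phi>] and pure = tensor_lift_pure[OF P \<phi>]
  note m1 = bilinear_maps_linear(1)[OF TA_mult_bilinear] and m2 = bilinear_maps_linear(2)[OF TA_mult_bilinear]
  note s1 = bilinear_maps_linear(1)[OF mult_bilinear[OF S.assoc_algebra_axioms]] and s2 = bilinear_maps_linear(2)[OF mult_bilinear[OF S.assoc_algebra_axioms]]
  show "?f \<in> linear_maps k TA S" using L by simp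
  show "?f \<one>\<^bsub>TA\<^esub> = \<one>\<^bsub>S\<^esub>" by (simp add: pure one)
  fix p q assume "p \<in> carrier TA" "q \<in> carrier TA"
  then have p: "p \<in> carrier T" and q: "q \<in> carrier T" by auto
  have 1: "?f (p \<otimes>\<^bsub>TA\<^esub> pt a' b') = ?f p \<otimes>\<^bsub>S\<^esub> ?f (pt a' b')"
    if "a' \<in> carrier A" "b' \<in> carrier B" for a' b'
    by (rule tensor_ext[OF P _ _ _ p])
      (intro linear_maps_compose[OF m2 L] linear_maps_compose[OF L s2] linear_maps_closed[OF L] pure_closed that
        | simp add: TA_mult_pure pure mult that)+
  show "?f (p \<otimes>\<^bsub>TA\<^esub> q) = ?f p \<otimes>\<^bsub>S\<^esub> ?f q"
    by (rule tensor_ext[OF P _ _ _ q])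
      (intro linear_maps_compose[OF m1 L] linear_maps_compose[OF L s1] linear_maps_closed[OF L p] p 1)+
qed

end

section \<open>Products of commuting homomorphisms\<close>

text \<open>For commuting algebra homomorphisms this is the map
  \<open>A \<otimes> B \<rightarrow> S\<close> of the universal property of the tensor product of
  algebras. It replaces leg notation: an element of \<open>A \<otimes> B\<close> is placed in
  \<open>S\<close> through \<open>\<alpha>\<close> and \<open>\<beta>\<close>, in either order of
  the two places.\<close>

definition hom_prod ::
  "'k ring \<Rightarrow> ('k, 's) module \<Rightarrow> ('a \<Rightarrow> 's) \<Rightarrow> ('b \<Rightarrow> 's) \<Rightarrow> ('a \<times> 'b \<Rightarrow> 'k) set \<Rightarrow> 's" where
  "hom_prod k S \<alpha> \<beta> = tensor_lift k S (\<lambda>x y. \<alpha> x \<otimes>\<^bsub>S\<^esub> \<beta> y)"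

context module_pair
begin

lemma hom_prod_bilinear:
  assumes "assoc_algebra k S" "\<alpha> \<in> linear_maps k M S" "\<beta> \<in> linear_maps k N S"
  shows "(\<lambda>x y. \<alpha> x \<otimes>\<^bsub>S\<^esub> \<beta> y) \<in> bilinear_maps k M N S"
  using linear_maps_closed[OF assms(2)] linear_maps_closed[OF assms(3)]
  by (intro bilinear_mapsI linear_maps_compose[OF assms(2) bilinear_maps_linear(2)[OF mult_bilinear]]
     linear_maps_compose[OF assms(3) bilinear_maps_linear(1)[OF mult_bilinear]] assms(1))

lemma hom_prod_linear:
  assumes "assoc_algebra k S" "\<alpha> \<in> linear_maps k M S" "\<beta> \<in> linear_maps k N S"
  shows "hom_prod k S \<alpha> \<beta> \<in> linear_maps k T S"
  unfolding hom_prod_def by (intro tensor_lift_linear hom_prod_bilinear assoc_algebra_module assms)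

lemma hom_prod_pure:
  assumes "assoc_algebra k S" "\<alpha> \<in> linear_maps k M S" "\<beta> \<in> linear_maps k N S"
    and "x \<in> carrier M" "y \<in> carrier N"
  shows "hom_prod k S \<alpha> \<beta> (pure_tensor k M N x y) = \<alpha> x \<otimes>\<^bsub>S\<^esub> \<beta> y"
  unfolding hom_prod_def by (intro tensor_lift_pure hom_prod_bilinear assoc_algebra_module assms)

text \<open>Naturality. It evaluates the R-matrix of two representations in \<open>S\<close> as a
  product of maps out of \<open>H\<close>, applied to the universal R-matrix.\<close>

lemma hom_prod_tensor_map:
  assumes S: "assoc_algebra k S" and \<alpha>: "\<alpha> \<in> linear_maps k M S" and \<beta>: "\<beta> \<in> linear_maps k N S"
    and M': "module k M'" and N': "module k N'" 
    and f: "f \<in> linear_maps k M' M" and g: "g \<in> linear_maps k N' N"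
    and p: "p \<in> carrier (tensor_module k M' N')"
  shows "hom_prod k S \<alpha> \<beta> (tensor_map k M N f g p) = hom_prod k S (\<lambda>x. \<alpha> (f x)) (\<lambda>y. \<beta> (g y)) p"
proof -
  interpret P': module_pair k M' N' using M' N' by (rule module_pair.intro)
  note fa = linear_maps_compose[OF f \<alpha>] and gb = linear_maps_compose[OF g \<beta>]
  note cl = linear_maps_closed[OF f] linear_maps_closed[OF g]
  show ?thesis
    by (rule P'.tensor_ext[OF assoc_algebra_module[OF S] _ _ _ p])
      (intro linear_maps_compose[OF tensor_map_linear[OF M' N' f g] hom_prod_linear[OF S \<alpha> \<beta>]]
          P'.hom_prod_linear[OF S fa gb]
        | simp add: tensor_map_pure[OF M' N' f g] hom_prod_pure[OF S \<alpha> \<beta>] P'.hom_prod_pure[OF S fa gb] cl)+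
qed

text \<open>The maps are total functions, and the equalities between them are available on the
  carriers only.\<close>

lemma hom_prod_cong:
  assumes S: "assoc_algebra k S" and \<alpha>: "\<alpha> \<in> linear_maps k M S" and \<beta>: "\<beta> \<in> linear_maps k N S"
    and \<alpha>': "\<And>x. x \<in> carrier M \<Longrightarrow> \<alpha>' x = \<alpha> x" and \<beta>': "\<And>y. y \<in> carrier N \<Longrightarrow> \<beta>' y = \<beta> y"
    and p: "p \<in> carrier T"
  shows "hom_prod k S \<alpha>' \<beta>' p = hom_prod k S \<alpha> \<beta> p"
proof -
  have l: "\<alpha>' \<in> linear_maps k M S" "\<beta>' \<in> linear_maps k N S"
    using linear_maps_cong[OF \<alpha>' M.module_axioms] linear_maps_cong[OF \<beta>' N.module_axioms] \<alpha> \<beta> by auto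
  show ?thesis
    by (rule tensor_ext[OF assoc_algebra_module[OF S] _ _ _ p])
      (intro hom_prod_linear S l \<alpha> \<beta> | simp add: hom_prod_pure[OF S] l \<alpha> \<beta> \<alpha>' \<beta>')+
qed

end

locale hom_pair = algebra_pair k A B + S: assoc_algebra k S
  for k :: "'k ring" and A :: "('k, 'a) module" and B :: "('k, 'b) module"
    and S :: "('k, 's) module" +
  fixes \<alpha> :: "'a \<Rightarrow> 's" and \<beta> :: "'b \<Rightarrow> 's"
  assumes left_hom: "\<alpha> \<in> algebra_homs k A S" and right_hom: "\<beta> \<in> algebra_homs k B S"
    and commutes: "\<And>x y. \<lbrakk>x \<in> carrier A; y \<in> carrier B\<rbrakk> \<Longrightarrow> \<alpha> x \<otimes>\<^bsub>S\<^esub> \<beta> y = \<beta> y \<otimes>\<^bsub>S\<^esub> \<alpha> x"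
begin

abbreviation "joint \<equiv> hom_prod k S \<alpha> \<beta>"

lemmas left_linear = algebra_homs_linear[OF left_hom]
lemmas right_linear = algebra_homs_linear[OF right_hom]
lemmas left_closed = algebra_homs_closed[OF left_hom]
lemmas right_closed = algebra_homs_closed[OF right_hom]
lemmas prod_linear = hom_prod_linear[OF S.assoc_algebra_axioms left_linear right_linear]
lemmas prod_pure = hom_prod_pure[OF S.assoc_algebra_axioms left_linear right_linear]
lemmas prod_closed = linear_maps_closed[OF prod_linear]
lemmas prod_tensor_map = hom_prod_tensor_map[OF S.assoc_algebra_axioms left_linear right_linear]
lemmas prod_cong = hom_prod_cong[OF S.assoc_algebra_axioms left_linear right_linear]

lemma prod_hom: "joint \<in> algebra_homs k TA S"
  unfolding hom_prod_def
proof (rule tensor_lift_hom)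
  fix a b a' b' assume *: "a \<in> carrier A" "b \<in> carrier B" "a' \<in> carrier A" "b' \<in> carrier B"
  \<comment> \<open>Moving \<open>\<beta> b\<close> past \<open>\<alpha> a'\<close> is where
    commutation makes the joint map multiplicative.\<close>
  have "\<alpha> a' \<otimes>\<^bsub>S\<^esub> (\<beta> b \<otimes>\<^bsub>S\<^esub> \<beta> b') = \<beta> b \<otimes>\<^bsub>S\<^esub> (\<alpha> a' \<otimes>\<^bsub>S\<^esub> \<beta> b')"
    using * commutes[of a' b] S.m_assoc[of "\<alpha> a'" "\<beta> b" "\<beta> b'"] S.m_assoc[of "\<beta> b" "\<alpha> a'" "\<beta> b'"]
    by (simp add: left_closed right_closed)
  then show "\<alpha> (a \<otimes>\<^bsub>A\<^esub> a') \<otimes>\<^bsub>S\<^esub> \<beta> (b \<otimes>\<^bsub>B\<^esub> b') = \<alpha> a \<otimes>\<^bsub>S\<^esub> \<beta> b \<otimes>\<^bsub>S\<^esub> (\<alpha> a' \<otimes>\<^bsub>S\<^esub> \<beta> b')"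
    using * by (simp add: algebra_homs_mult[OF left_hom] algebra_homs_mult[OF right_hom] S.m_assoc
        left_closed right_closed)
qed (auto simp: algebra_homs_one[OF left_hom] algebra_homs_one[OF right_hom]
    intro: S.assoc_algebra_axioms hom_prod_bilinear[OF _ left_linear right_linear])

lemmas prod_mult = algebra_homs_mult[OF prod_hom, simplified]

text \<open>The centraliser of \<open>s\<close> is closed under sums and products. It contains the
  images of \<open>\<alpha>\<close> and \<open>\<beta>\<close>, hence everything that the joint map
  produces from them.\<close>

lemma prod_commutes:
  assumes s: "s \<in> carrier S"
    and left: "\<And>x. x \<in> carrier A \<Longrightarrow> s \<otimes>\<^bsub>S\<^esub> \<alpha> x = \<alpha> x \<otimes>\<^bsub>S\<^esub> s"
    and right: "\<And>y. y \<in> carrier B \<Longrightarrow> s \<otimes>\<^bsub>S\<^esub> \<beta> y = \<beta> y \<otimes>\<^bsub>S\<^esub> s"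
    and p: "p \<in> carrier T"
  shows "s \<otimes>\<^bsub>S\<^esub> joint p = joint p \<otimes>\<^bsub>S\<^esub> s"
proof -
  note mb = mult_bilinear[OF S.assoc_algebra_axioms]
  have eq: "s \<otimes>\<^bsub>S\<^esub> (\<alpha> x \<otimes>\<^bsub>S\<^esub> \<beta> y) = \<alpha> x \<otimes>\<^bsub>S\<^esub> \<beta> y \<otimes>\<^bsub>S\<^esub> s"
    if "x \<in> carrier A" "y \<in> carrier B" for x y
    using that s left_closed right_closed
    by (metis S.m_assoc left right)
  show ?thesis
    by (rule tensor_ext[OF S.module_axioms _ _ _ p])
      (intro linear_maps_compose[OF prod_linear bilinear_maps_linear(1)[OF mb s]]
        linear_maps_compose[OF prod_linear bilinear_maps_linear(2)[OF mb s]]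
        | simp add: prod_pure eq)+
qed

lemma hom_pair_swap: "hom_pair k B A S \<beta> \<alpha>"
  by unfold_locales (simp_all add: left_hom right_hom commutes)

text \<open>As the two images commute, flipping the tensor amounts to exchanging the homomorphisms.
  The flipped R-matrix of the reflection equation is thereby expressed without a flip.\<close>

lemma prod_flip:
  assumes "p \<in> carrier (tensor_module k B A)"
  shows "joint (tensor_flip k B A p) = hom_prod k S \<beta> \<alpha> p"
proof -
  interpret sw: hom_pair k B A S \<beta> \<alpha> by (rule hom_pair_swap)
  show ?thesis
    by (rule sw.tensor_ext[OF S.module_axioms _ _ _ assms])
      (intro linear_maps_compose[OF tensor_flip_linear prod_linear] sw.prod_linear
        | simp add: tensor_flip_pure prod_pure sw.prod_pure commutes)+
qed

lemma hom_pair_pre: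
  assumes "assoc_algebra k A'" "assoc_algebra k B'" "f \<in> algebra_homs k A' A" "g \<in> algebra_homs k B' B"
  shows "hom_pair k A' B' S (\<lambda>x. \<alpha> (f x)) (\<lambda>y. \<beta> (g y))"
  by (intro hom_pair.intro algebra_pair.intro assms S.assoc_algebra_axioms hom_pair_axioms.intro
      algebra_homs_compose[OF assms(3) left_hom] algebra_homs_compose[OF assms(4) right_hom] commutes
      algebra_homs_closed[OF assms(3)] algebra_homs_closed[OF assms(4)])

lemma hom_pair_post:
  assumes "assoc_algebra k S'" and h: "h \<in> algebra_homs k S S'"
  shows "hom_pair k A B S' (\<lambda>x. h (\<alpha> x)) (\<lambda>y. h (\<beta> y))"
proof (intro hom_pair.intro algebra_pair.intro hom_pair_axioms.intro)
  fix x y assume "x \<in> carrier A" "y \<in> carrier B"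
  then show "h (\<alpha> x) \<otimes>\<^bsub>S'\<^esub> h (\<beta> y) = h (\<beta> y) \<otimes>\<^bsub>S'\<^esub> h (\<alpha> x)"
    using commutes[of x y] by (simp add: algebra_homs_mult[OF h, symmetric] left_closed right_closed)
qed (intro assms A.assoc_algebra_axioms B.assoc_algebra_axioms algebra_homs_compose[OF left_hom h]
    algebra_homs_compose[OF right_hom h])+

lemma prod_post:
  assumes "assoc_algebra k S'" and h: "h \<in> algebra_homs k S S'" and p: "p \<in> carrier T"
  shows "hom_prod k S' (\<lambda>x. h (\<alpha> x)) (\<lambda>y. h (\<beta> y)) p = h (joint p)"
proof -
  interpret post: hom_pair k A B S' "\<lambda>x. h (\<alpha> x)" "\<lambda>y. h (\<beta> y)"
    by (rule hom_pair_post) fact+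
  show ?thesis
    by (rule tensor_ext[OF post.S.module_axioms _ _ _ p])
      (intro linear_maps_compose[OF prod_linear algebra_homs_linear[OF h]] post.prod_linear
        | simp add: prod_pure post.prod_pure algebra_homs_mult[OF h] left_closed right_closed)+
qed

end

context algebra_pair
begin

lemma canonical_hom_pair: "hom_pair k A B TA (\<lambda>x. pt x \<one>\<^bsub>B\<^esub>) (\<lambda>y. pt \<one>\<^bsub>A\<^esub> y)"
  by unfold_locales (auto intro: pure_left_hom pure_right_hom simp: TA_mult_pure)

text \<open>\<open>A \<otimes> B\<close> is a test algebra for itself, because
  \<open>x \<otimes> y\<close> is the product of \<open>x \<otimes> 1\<close> and
  \<open>1 \<otimes> y\<close>.\<close>

lemma canonical_prod:
  assumes p: "p \<in> carrier T"
  shows "hom_prod k TA (\<lambda>x. pt x \<one>\<^bsub>B\<^esub>) (\<lambda>y. pt \<one>\<^bsub>A\<^esub> y) p = p"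
proof -
  interpret can: hom_pair k A B TA "\<lambda>x. pt x \<one>\<^bsub>B\<^esub>" "\<lambda>y. pt \<one>\<^bsub>A\<^esub> y"
    by (rule canonical_hom_pair)
  show ?thesis
    by (rule tensor_ext[OF T_module _ _ _ p])
      (use can.prod_linear in \<open>simp_all add: can.prod_pure TA_mult_pure linear_maps_id\<close>)
qed

end

section \<open>Commuting triples of homomorphisms and leg notation\<close>

locale hom_triple =
    AB: hom_pair k A B S \<alpha> \<beta> + AC: hom_pair k A C S \<alpha> \<gamma> + BC: hom_pair k B C S \<beta> \<gamma>
  for k :: "'k ring" and A :: "('k, 'a) module" and B :: "('k, 'b) module"
    and C :: "('k, 'c) module" and S :: "('k, 's) module"
    and \<alpha> :: "'a \<Rightarrow> 's" and \<beta> :: "'b \<Rightarrow> 's" and \<gamma> :: "'c \<Rightarrow> 's"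
begin

text \<open>Pairwise commutation is enough: by \<open>prod_commutes\<close>, \<open>\<gamma>\<close>
  commutes with all of the joint image of \<open>A \<otimes> B\<close>, so the construction can be
  iterated.\<close>

sublocale ABC: hom_pair k "tensor_algebra k A B" C S AB.joint \<gamma>
proof (intro hom_pair.intro algebra_pair.intro hom_pair_axioms.intro)
  fix p z assume "p \<in> carrier (tensor_algebra k A B)" "z \<in> carrier C"
  then show "AB.joint p \<otimes>\<^bsub>S\<^esub> \<gamma> z = \<gamma> z \<otimes>\<^bsub>S\<^esub> AB.joint p"
    by (intro AB.prod_commutes[symmetric]) (simp_all add: AC.commutes BC.commutes AC.right_closed)
qed (intro AB.TA_algebra AC.B.assoc_algebra_axioms AB.S.assoc_algebra_axioms AB.prod_hom AC.right_hom)+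

text \<open>The unit inserted into the remaining factor is sent to the unit of \<open>S\<close>. So
  a leg evaluates to the joint map of the two homomorphisms concerned; the same reason gives the
  versions for \<open>leg13\<close> and \<open>leg23\<close>.\<close>

lemma prod_leg12:
  assumes "p \<in> carrier AB.T"
  shows "ABC.joint (leg12 k A B C p) = AB.joint p"
  using assms by (simp add: leg12_def ABC.prod_pure AB.prod_closed algebra_homs_one[OF AC.right_hom])

lemma leg12_closed: "p \<in> carrier AB.T \<Longrightarrow> leg12 k A B C p \<in> carrier ABC.T"
  by (simp add: leg12_def ABC.pure_closed)

lemma leg13_closed: "p \<in> carrier AC.T \<Longrightarrow> leg13 k A B C p \<in> carrier ABC.T"
  unfolding leg13_def
  by (rule linear_maps_closed[OF ABC.tensor_map_linear[OF AB.A.module_axioms AC.B.module_axioms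
      algebra_homs_linear[OF AB.pure_left_hom] linear_maps_id]])

lemma leg23_closed: "p \<in> carrier BC.T \<Longrightarrow> leg23 k A B C p \<in> carrier ABC.T"
  unfolding leg23_def
  by (rule linear_maps_closed[OF ABC.tensor_map_linear[OF AB.B.module_axioms AC.B.module_axioms
      algebra_homs_linear[OF AB.pure_right_hom] linear_maps_id]])

lemma prod_leg13:
  assumes "p \<in> carrier AC.T"
  shows "ABC.joint (leg13 k A B C p) = AC.joint p"
proof -
  have "ABC.joint (leg13 k A B C p) = hom_prod k S (\<lambda>x. AB.joint (AB.pt x \<one>\<^bsub>B\<^esub>)) \<gamma> p"
    unfolding leg13_def
    by (rule ABC.prod_tensor_map[OF AB.A.module_axioms AC.B.module_axioms
        algebra_homs_linear[OF AB.pure_left_hom] linear_maps_id assms])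
  also have "\<dots> = AC.joint p"
    by (rule AC.prod_cong) (simp_all add: AB.prod_pure algebra_homs_one[OF AB.right_hom] AB.left_closed assms)
  finally show ?thesis .
qed

lemma prod_leg23:
  assumes "p \<in> carrier BC.T"
  shows "ABC.joint (leg23 k A B C p) = BC.joint p"
proof -
  have "ABC.joint (leg23 k A B C p) = hom_prod k S (\<lambda>x. AB.joint (AB.pt \<one>\<^bsub>A\<^esub> x)) \<gamma> p"
    unfolding leg23_def
    by (rule ABC.prod_tensor_map[OF AB.B.module_axioms AC.B.module_axioms
        algebra_homs_linear[OF AB.pure_right_hom] linear_maps_id assms])
  also have "\<dots> = BC.joint p"
    by (rule BC.prod_cong) (simp_all add: AB.prod_pure algebra_homs_one[OF AB.left_hom] AB.right_closed assms)
  finally show ?thesis .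
qed

lemma A_BC_hom_pair: "hom_pair k A (tensor_algebra k B C) S \<alpha> BC.joint"
proof (intro hom_pair.intro algebra_pair.intro hom_pair_axioms.intro)
  fix x p assume "x \<in> carrier A" "p \<in> carrier (tensor_algebra k B C)"
  then show "\<alpha> x \<otimes>\<^bsub>S\<^esub> BC.joint p = BC.joint p \<otimes>\<^bsub>S\<^esub> \<alpha> x"
    by (intro BC.prod_commutes) (simp_all add: AC.commutes AB.commutes AB.left_closed)
qed (intro BC.TA_algebra AB.A.assoc_algebra_axioms AB.S.assoc_algebra_axioms BC.prod_hom AB.left_hom)+

text \<open>Both bracketings send \<open>x\<close>, \<open>y\<close>, \<open>z\<close> to the
  product of their three images in \<open>S\<close>. Hence the canonical map
  \<open>tensor_assoc\<close> disappears on evaluation; the comparison is made on pure tensors,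
  first in \<open>B \<otimes> C\<close> and then in the outer product.\<close>

lemma prod_assoc:
  assumes p: "p \<in> carrier (tensor_module k A (tensor_algebra k B C))"
  shows "ABC.joint (tensor_assoc k A B C p) = hom_prod k S \<alpha> BC.joint p"
proof -
  interpret R: hom_pair k A "tensor_algebra k B C" S \<alpha> BC.joint by (rule A_BC_hom_pair)
  let ?i = "\<lambda>x. tensor_lift k ABC.T (\<lambda>y z. ABC.pt (AB.pt x y) z)"
  have assoc: "tensor_assoc k A B C = tensor_lift k ABC.T ?i"
    by (simp add: tensor_assoc_def Let_def tensor_module_tensor_algebra pure_tensor_tensor_algebra)
  have b1: "(\<lambda>y z. ABC.pt (AB.pt x y) z) \<in> bilinear_maps k B C ABC.T" if "x \<in> carrier A" for x
    by (intro ABC.tensor_map_bilinear[where g = "\<lambda>z. z"] AB.B.module_axioms AC.B.module_axioms linear_maps_id)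
      (simp add: bilinear_maps_linear(1)[OF AB.pure_bilinear that])
  have b2: "(\<lambda>x. AB.pt x y) \<in> linear_maps k A (tensor_algebra k A B)" if "y \<in> carrier B" for y
    using bilinear_maps_linear(2)[OF AB.pure_bilinear that] by simp
  have b: "?i \<in> bilinear_maps k A (tensor_algebra k B C) ABC.T"
    using BC.tensor_lift_bilinear[OF ABC.T_module AB.A.module_axioms b1 
        linear_maps_compose[OF b2 bilinear_maps_linear(2)[OF ABC.pure_bilinear]]]
    by (simp add: bilinear_maps_def)
  have eq: "ABC.joint (?i x q) = \<alpha> x \<otimes>\<^bsub>S\<^esub> BC.joint q" if x: "x \<in> carrier A" and q: "q \<in> carrier BC.T" for x q
    by (rule BC.tensor_ext[OF AB.S.module_axioms _ _ _ q])
      (intro linear_maps_compose[OF BC.tensor_lift_linear[OF ABC.T_module b1[OF x]] ABC.prod_linear]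
        linear_maps_compose[OF BC.prod_linear bilinear_maps_linear(1)[OF mult_bilinear[OF AB.S.assoc_algebra_axioms] AB.left_closed[OF x]]]
      | simp add: BC.tensor_lift_pure[OF ABC.T_module b1[OF x]] ABC.prod_pure AB.prod_pure BC.prod_pure x
        AB.pure_closed AB.S.m_assoc AB.left_closed AB.right_closed AC.right_closed)+
  show ?thesis unfolding assoc
    by (rule R.tensor_ext[OF AB.S.module_axioms _ _ _ p])
      (intro linear_maps_compose[OF R.tensor_lift_linear[OF ABC.T_module b] ABC.prod_linear] R.prod_linear
      | simp add: R.tensor_lift_pure[OF ABC.T_module b] R.prod_pure eq)+
qed

end

locale algebra_triple = AB: algebra_pair k A B + C: assoc_algebra k C
  for k :: "'k ring" and A :: "('k, 'a) module" and B :: "('k, 'b) module" and C :: "('k, 'c) module"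
begin

sublocale ABC: algebra_pair k "tensor_algebra k A B" C
  by unfold_locales

abbreviation "inc1 \<equiv> \<lambda>x. ABC.pt (AB.pt x \<one>\<^bsub>B\<^esub>) \<one>\<^bsub>C\<^esub>"
abbreviation "inc2 \<equiv> \<lambda>y. ABC.pt (AB.pt \<one>\<^bsub>A\<^esub> y) \<one>\<^bsub>C\<^esub>"
abbreviation "inc3 \<equiv> \<lambda>z. ABC.pt (AB.pt \<one>\<^bsub>A\<^esub> \<one>\<^bsub>B\<^esub>) z"

lemma canonical_hom_triple: "hom_triple k A B C (tensor3 k A B C) inc1 inc2 inc3"
proof (rule hom_triple.intro)
  interpret can: hom_pair k "tensor_algebra k A B" C "tensor3 k A B C"
      "\<lambda>p. ABC.pt p \<one>\<^bsub>C\<^esub>" "\<lambda>z. ABC.pt \<one>\<^bsub>tensor_algebra k A B\<^esub> z"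
    by (rule ABC.canonical_hom_pair)
  show "hom_pair k A B (tensor3 k A B C) inc1 inc2"
    by (rule hom_pair.hom_pair_post[OF AB.canonical_hom_pair ABC.TA_algebra ABC.pure_left_hom])
  show "hom_pair k A C (tensor3 k A B C) inc1 inc3"
    using can.hom_pair_pre[OF AB.A.assoc_algebra_axioms C.assoc_algebra_axioms AB.pure_left_hom algebra_homs_id]
    by simp
  show "hom_pair k B C (tensor3 k A B C) inc2 inc3"
    using can.hom_pair_pre[OF AB.B.assoc_algebra_axioms C.assoc_algebra_axioms AB.pure_right_hom algebra_homs_id]
    by simp
qed

sublocale can: hom_triple k A B C "tensor3 k A B C" inc1 inc2 inc3
  by (rule canonical_hom_triple)

text \<open>This is what leads back from identities in a test algebra to identities in the triple
  tensor algebra: there, evaluation is the identity, and the legs are themselves values of joint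
  maps.\<close>

lemma canonical_prod3:
  assumes p: "p \<in> carrier ABC.T"
  shows "can.ABC.joint p = p"
proof -
  have "can.AB.joint q = ABC.pt q \<one>\<^bsub>C\<^esub>" if "q \<in> carrier AB.T" for q
    using hom_pair.prod_post[OF AB.canonical_hom_pair ABC.TA_algebra ABC.pure_left_hom that]
      AB.canonical_prod[OF that] by simp
  then have "can.ABC.joint p = hom_prod k (tensor3 k A B C) (\<lambda>p. ABC.pt p \<one>\<^bsub>C\<^esub>) (\<lambda>z. ABC.pt \<one>\<^bsub>tensor_algebra k A B\<^esub> z) p"
    using p algebra_homs_linear[OF ABC.pure_left_hom] algebra_homs_linear[OF ABC.pure_right_hom]
    by (intro ABC.hom_prod_cong ABC.TA_algebra) auto
  then show ?thesis using ABC.canonical_prod[OF p] by simp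
qed

lemma leg_eq_prod:
  "p \<in> carrier AB.T \<Longrightarrow> leg12 k A B C p = can.AB.joint p"
  "q \<in> carrier can.AC.T \<Longrightarrow> leg13 k A B C q = can.AC.joint q"
  "r \<in> carrier can.BC.T \<Longrightarrow> leg23 k A B C r = can.BC.joint r"
  using can.prod_leg12 can.prod_leg13 can.prod_leg23 canonical_prod3
    can.leg12_closed can.leg13_closed can.leg23_closed by metis+

end

lemma (in algebra_pair) tensor_map_hom:
  assumes "assoc_algebra k A'" "assoc_algebra k B'" and f: "f \<in> algebra_homs k A' A" and g: "g \<in> algebra_homs k B' B"
  shows "tensor_map k A B f g \<in> algebra_homs k (tensor_algebra k A' B') TA"
proof -
  interpret P': algebra_pair k A' B' using assms by (intro algebra_pair.intro)
  have "tensor_lift k TA (\<lambda>x y. pt (f x) (g y)) \<in> algebra_homs k (tensor_algebra k A' B') TA"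
    using tensor_map_bilinear[OF P'.A.module_axioms P'.B.module_axioms algebra_homs_linear[OF f] algebra_homs_linear[OF g]]
    by (intro P'.tensor_lift_hom TA_algebra)
      (simp_all add: bilinear_maps_def TA_mult_pure algebra_homs_mult[OF f] algebra_homs_mult[OF g]
        algebra_homs_one[OF f] algebra_homs_one[OF g] algebra_homs_closed[OF f] algebra_homs_closed[OF g])
  \<comment> \<open>\<open>tensor_map\<close> lifts into the module, \<open>tensor_lift_hom\<close>
    into the algebra. Sums and scaling read only the fields in which the two records agree.\<close>
  moreover have "tensor_lift k TA (\<lambda>x y. pt (f x) (g y)) = tensor_lift k T (\<lambda>x y. pt (f x) (g y))"
    by (simp add: fun_eq_iff tensor_lift_def free_lift_def finsum_def)
  ultimately show ?thesis by (simp add: tensor_map_def)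
qed

lemma algebra_homs_inverse:
  assumes "assoc_algebra k A" and h: "h \<in> algebra_homs k A B" and u: "u \<in> Units A"
  shows "h (inv\<^bsub>A\<^esub> u) \<otimes>\<^bsub>B\<^esub> h u = \<one>\<^bsub>B\<^esub>" "h u \<otimes>\<^bsub>B\<^esub> h (inv\<^bsub>A\<^esub> u) = \<one>\<^bsub>B\<^esub>"
proof -
  interpret assoc_algebra k A by fact
  show "h (inv\<^bsub>A\<^esub> u) \<otimes>\<^bsub>B\<^esub> h u = \<one>\<^bsub>B\<^esub>" "h u \<otimes>\<^bsub>B\<^esub> h (inv\<^bsub>A\<^esub> u) = \<one>\<^bsub>B\<^esub>"
    using u algebra_homs_one[OF h]
    by (simp_all add: algebra_homs_mult[OF h, symmetric] Units_closed Units_inv_closed Units_l_inv Units_r_inv)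
qed

lemma algebra_homs_Units:
  assumes "assoc_algebra k A" and h: "h \<in> algebra_homs k A B" and u: "u \<in> Units A"
  shows "h u \<in> Units B"
proof -
  interpret assoc_algebra k A by fact
  show ?thesis
    using algebra_homs_inverse[OF assms] algebra_homs_closed[OF h] u Units_closed Units_inv_closed
    unfolding Units_def[of B] by blast
qed

lemma hom_triple_swap12: "hom_triple k A B C S \<alpha> \<beta> \<eta> \<Longrightarrow> hom_triple k B A C S \<beta> \<alpha> \<eta>"
  by (simp add: hom_triple_def hom_pair.hom_pair_swap)

lemma hom_triple_swap23: "hom_triple k A B C S \<alpha> \<beta> \<eta> \<Longrightarrow> hom_triple k A C B S \<alpha> \<eta> \<beta>"
  by (simp add: hom_triple_def hom_pair.hom_pair_swap)

section \<open>The Yang--Baxter equation\<close>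

context quasitriangular_hopf_algebra
begin

lemma R_closed: "\<R> \<in> carrier (tensor_module k H H)"
  using R_invertible by (auto simp: Units_def)

lemma coproduct_closed: "x \<in> carrier H \<Longrightarrow> \<Delta> x \<in> carrier (tensor_module k H H)"
  using algebra_homs_closed[OF coproduct] by simp

lemma hom_prod_coproduct_hom:
  assumes "hom_pair k H H S \<alpha> \<beta>"
  shows "(\<lambda>x. hom_prod k S \<alpha> \<beta> (\<Delta> x)) \<in> algebra_homs k H S"
  by (rule algebra_homs_compose[OF coproduct hom_pair.prod_hom[OF assms]])

text \<open>The axiom for \<open>(\<Delta> \<otimes> id) \<R>\<close>, carried to \<open>S\<close>
  by the joint map of the triple.\<close>

lemma hom_prod_R_left:
  assumes "hom_triple k H H H S \<alpha> \<beta> \<eta>"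
  shows "hom_prod k S (\<lambda>x. hom_prod k S \<alpha> \<beta> (\<Delta> x)) \<eta> \<R> = hom_prod k S \<alpha> \<eta> \<R> \<otimes>\<^bsub>S\<^esub> hom_prod k S \<beta> \<eta> \<R>"
proof -
  interpret t: hom_triple k H H H S \<alpha> \<beta> \<eta> by fact
  have "hom_prod k S (\<lambda>x. hom_prod k S \<alpha> \<beta> (\<Delta> x)) \<eta> \<R>
      = t.ABC.joint (tensor_map k (tensor_algebra k H H) H \<Delta> (\<lambda>z. z) \<R>)"
    by (rule t.ABC.prod_tensor_map[OF H.module_axioms H.module_axioms
          algebra_homs_linear[OF coproduct] linear_maps_id R_closed, symmetric])
  also have "\<dots> = hom_prod k S \<alpha> \<eta> \<R> \<otimes>\<^bsub>S\<^esub> hom_prod k S \<beta> \<eta> \<R>"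
    unfolding R_coproduct_left
    by (simp add: t.ABC.prod_mult t.leg13_closed t.leg23_closed t.prod_leg13 t.prod_leg23 R_closed)
  finally show ?thesis .
qed

text \<open>Here \<open>id \<otimes> \<Delta>\<close> takes values in
  \<open>H \<otimes> (H \<otimes> H)\<close>, whereas the axiom lives in
  \<open>(H \<otimes> H) \<otimes> H\<close>; \<open>prod_assoc\<close> connects the evaluations of
  the two bracketings.\<close>

lemma hom_prod_R_right:
  assumes "hom_triple k H H H S \<alpha> \<beta> \<eta>"
  shows "hom_prod k S \<alpha> (\<lambda>x. hom_prod k S \<beta> \<eta> (\<Delta> x)) \<R> = hom_prod k S \<alpha> \<eta> \<R> \<otimes>\<^bsub>S\<^esub> hom_prod k S \<alpha> \<beta> \<R>"
proof -
  interpret t: hom_triple k H H H S \<alpha> \<beta> \<eta> by fact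
  interpret r: hom_pair k H "tensor_algebra k H H" S \<alpha> t.BC.joint by (rule t.A_BC_hom_pair)
  let ?m = "tensor_map k H (tensor_algebra k H H) (\<lambda>z. z) \<Delta>"
  have cl: "?m \<R> \<in> carrier (tensor_module k H (tensor_algebra k H H))"
    by (rule linear_maps_closed[OF r.tensor_map_linear[OF H.module_axioms H.module_axioms
          linear_maps_id algebra_homs_linear[OF coproduct]] R_closed])
  have "hom_prod k S \<alpha> (\<lambda>x. hom_prod k S \<beta> \<eta> (\<Delta> x)) \<R> = r.joint (?m \<R>)"
    by (rule r.prod_tensor_map[OF H.module_axioms H.module_axioms
          linear_maps_id algebra_homs_linear[OF coproduct] R_closed, symmetric])
  also have "\<dots> = t.ABC.joint (tensor_assoc k H H H (?m \<R>))"
    by (rule t.prod_assoc[OF cl, symmetric])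
  also have "\<dots> = hom_prod k S \<alpha> \<eta> \<R> \<otimes>\<^bsub>S\<^esub> hom_prod k S \<alpha> \<beta> \<R>"
    unfolding R_coproduct_right
    by (simp add: t.ABC.prod_mult t.leg13_closed t.leg12_closed t.prod_leg13 t.prod_leg12 R_closed)
  finally show ?thesis .
qed

lemma hom_prod_R_intertwines:
  assumes "hom_pair k H H S \<alpha> \<beta>" and x: "x \<in> carrier H"
  shows "hom_prod k S \<alpha> \<beta> \<R> \<otimes>\<^bsub>S\<^esub> hom_prod k S \<alpha> \<beta> (\<Delta> x)
    = hom_prod k S \<beta> \<alpha> (\<Delta> x) \<otimes>\<^bsub>S\<^esub> hom_prod k S \<alpha> \<beta> \<R>"
proof -
  interpret p: hom_pair k H H S \<alpha> \<beta> by fact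
  have cl: "tensor_flip k H H (\<Delta> x) \<in> carrier p.T"
    by (rule linear_maps_closed[OF p.tensor_flip_linear coproduct_closed[OF x]])
  have "p.joint (\<R> \<otimes>\<^bsub>p.TA\<^esub> \<Delta> x) = p.joint (tensor_flip k H H (\<Delta> x) \<otimes>\<^bsub>p.TA\<^esub> \<R>)"
    by (simp only: R_intertwines[OF x])
  then show ?thesis
    by (simp add: p.prod_mult R_closed coproduct_closed[OF x] cl p.prod_flip)
qed

text \<open>\<open>R12\<close> intertwines the coproduct with its opposite in the first two places
  and commutes with the third. Applied to the first factor of \<open>\<R>\<close>, this exchanges
  \<open>\<alpha>\<close> and \<open>\<beta>\<close> in \<open>(\<Delta> \<otimes> id) \<R>\<close>;
  factorising both sides by the coproduct axiom gives the equation.\<close>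

lemma yang_baxter:
  assumes "hom_triple k H H H S \<alpha> \<beta> \<eta>"
  defines "R12 \<equiv> hom_prod k S \<alpha> \<beta> \<R>" and "R13 \<equiv> hom_prod k S \<alpha> \<eta> \<R>" and "R23 \<equiv> hom_prod k S \<beta> \<eta> \<R>"
  shows "R12 \<otimes>\<^bsub>S\<^esub> (R13 \<otimes>\<^bsub>S\<^esub> R23) = R23 \<otimes>\<^bsub>S\<^esub> (R13 \<otimes>\<^bsub>S\<^esub> R12)"
proof -
  interpret t: hom_triple k H H H S \<alpha> \<beta> \<eta> by fact
  let ?l = "\<lambda>x. hom_prod k S \<alpha> \<beta> (\<Delta> x)" and ?r = "\<lambda>x. hom_prod k S \<beta> \<alpha> (\<Delta> x)"
  have l: "?l \<in> linear_maps k H S" and r: "?r \<in> linear_maps k H S"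
    using hom_prod_coproduct_hom[OF t.AB.hom_pair_axioms]
      hom_prod_coproduct_hom[OF t.AB.hom_pair_swap] by (auto intro: algebra_homs_linear)
  note S = t.AB.S.assoc_algebra_axioms
  note mb = mult_bilinear[OF S]
  note ll = t.AB.hom_prod_linear[OF S l t.AC.right_linear] and lp = t.AB.hom_prod_pure[OF S l t.AC.right_linear]
  note rl = t.AB.hom_prod_linear[OF S r t.AC.right_linear] and rp = t.AB.hom_prod_pure[OF S r t.AC.right_linear]
  have R12: "R12 \<in> carrier S" unfolding R12_def by (rule t.AB.prod_closed[OF R_closed])
  have cl: "R13 \<in> carrier S" "R23 \<in> carrier S"
    unfolding R13_def R23_def by (intro t.AC.prod_closed t.BC.prod_closed R_closed)+
  have comm: "R12 \<otimes>\<^bsub>S\<^esub> \<eta> z = \<eta> z \<otimes>\<^bsub>S\<^esub> R12" if "z \<in> carrier H" for z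
    unfolding R12_def using t.ABC.commutes[of \<R> z] that R_closed by simp
  have eq: "R12 \<otimes>\<^bsub>S\<^esub> (?l x \<otimes>\<^bsub>S\<^esub> \<eta> z) = ?r x \<otimes>\<^bsub>S\<^esub> \<eta> z \<otimes>\<^bsub>S\<^esub> R12"
    if x: "x \<in> carrier H" and z: "z \<in> carrier H" for x z
  proof -
    note c = R12 linear_maps_closed[OF l x] linear_maps_closed[OF r x] t.AC.right_closed[OF z]
    have "R12 \<otimes>\<^bsub>S\<^esub> (?l x \<otimes>\<^bsub>S\<^esub> \<eta> z) = (R12 \<otimes>\<^bsub>S\<^esub> ?l x) \<otimes>\<^bsub>S\<^esub> \<eta> z"
      using c by (simp add: t.AB.S.m_assoc)
    also have "\<dots> = ?r x \<otimes>\<^bsub>S\<^esub> R12 \<otimes>\<^bsub>S\<^esub> \<eta> z"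
      unfolding R12_def by (simp only: hom_prod_R_intertwines[OF t.AB.hom_pair_axioms x])
    also have "\<dots> = ?r x \<otimes>\<^bsub>S\<^esub> \<eta> z \<otimes>\<^bsub>S\<^esub> R12"
      using c by (simp add: t.AB.S.m_assoc comm[OF z])
    finally show ?thesis .
  qed
  \<comment> \<open>\<open>R12\<close> is held fixed and only the tensor inside the outer
    \<open>hom_prod\<close> varies. Both sides are linear in it, so \<open>eq\<close> on pure
    tensors suffices.\<close>
  have "R12 \<otimes>\<^bsub>S\<^esub> hom_prod k S ?l \<eta> \<R> = hom_prod k S ?r \<eta> \<R> \<otimes>\<^bsub>S\<^esub> R12"
    by (rule t.AB.tensor_ext[OF t.AB.S.module_axioms _ _ _ R_closed])
      (intro linear_maps_compose[OF ll bilinear_maps_linear(1)[OF mb R12]]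
         linear_maps_compose[OF rl bilinear_maps_linear(2)[OF mb R12]]
       | simp add: lp rp eq)+
  then show ?thesis
    using R12 cl
    by (simp add: hom_prod_R_left[OF assms(1)] hom_prod_R_left[OF hom_triple_swap12[OF assms(1)]]
      R13_def[symmetric] R23_def[symmetric] t.AB.S.m_assoc)
qed

end

section \<open>Fusion of solutions of the reflection equation\<close>

context monoid
begin

text \<open>
  The words below are those of a tensor product \<open>ab\<close> of two representations against a third
  one \<open>c\<close>: with \<open>R\<^bsub>ab,c\<^esub> = Rac Rbc\<close>, \<open>R\<^bsub>c,ab\<^esub> = Rcb Rca\<close>
  and \<open>J = Rab\<^sup>-\<^sup>1\<close>.
\<close>

lemma fused_reflection_words:
  assumes cl: "Rab \<in> carrier G" "J \<in> carrier G" "Rac \<in> carrier G" "Rbc \<in> carrier G" "Rca \<in> carrier G"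
      "Rcb \<in> carrier G" "Ka \<in> carrier G" "Kb \<in> carrier G" "Kc \<in> carrier G"
    and inv: "J \<otimes> Rab = \<one>" "Rab \<otimes> J = \<one>"
    and comm: "Rcb \<otimes> Ka = Ka \<otimes> Rcb" "Rbc \<otimes> Ka = Ka \<otimes> Rbc"
      "Rac \<otimes> Kb = Kb \<otimes> Rac" "Rca \<otimes> Kb = Kb \<otimes> Rca" "Rab \<otimes> Kc = Kc \<otimes> Rab"
    and yb: "Rca \<otimes> (Rcb \<otimes> Rab) = Rab \<otimes> (Rcb \<otimes> Rca)"
      "Rac \<otimes> (Rab \<otimes> Rcb) = Rcb \<otimes> (Rab \<otimes> Rac)"
      "Rab \<otimes> (Rac \<otimes> Rbc) = Rbc \<otimes> (Rac \<otimes> Rab)"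
  shows
    "\<lbrakk>Rca \<otimes> Ka \<otimes> Rac \<otimes> Kc = Kc \<otimes> Rca \<otimes> Ka \<otimes> Rac; Rcb \<otimes> Kb \<otimes> Rbc \<otimes> Kc = Kc \<otimes> Rcb \<otimes> Kb \<otimes> Rbc\<rbrakk> \<Longrightarrow>
     (Rcb \<otimes> Rca) \<otimes> (J \<otimes> Ka \<otimes> Rab \<otimes> Kb) \<otimes> (Rac \<otimes> Rbc) \<otimes> Kc
      = Kc \<otimes> (Rcb \<otimes> Rca) \<otimes> (J \<otimes> Ka \<otimes> Rab \<otimes> Kb) \<otimes> (Rac \<otimes> Rbc)" (is "\<lbrakk>?p1; ?p2\<rbrakk> \<Longrightarrow> ?g1")
    and "\<lbrakk>Rac \<otimes> Kc \<otimes> Rca \<otimes> Ka = Ka \<otimes> Rac \<otimes> Kc \<otimes> Rca; Rbc \<otimes> Kc \<otimes> Rcb \<otimes> Kb = Kb \<otimes> Rbc \<otimes> Kc \<otimes> Rcb\<rbrakk> \<Longrightarrow>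
     (Rac \<otimes> Rbc) \<otimes> Kc \<otimes> (Rcb \<otimes> Rca) \<otimes> (J \<otimes> Ka \<otimes> Rab \<otimes> Kb)
      = (J \<otimes> Ka \<otimes> Rab \<otimes> Kb) \<otimes> (Rac \<otimes> Rbc) \<otimes> Kc \<otimes> (Rcb \<otimes> Rca)" (is "\<lbrakk>?q1; ?q2\<rbrakk> \<Longrightarrow> ?g2")
proof -
  note a = m_assoc cl m_closed
  \<comment> \<open>Words are kept bracketed to the right. \<open>e2\<close>, \<open>e3\<close> and
    \<open>e4\<close> apply an identity between subwords of two, three and four letters in front of
    a tail \<open>z\<close>.\<close>
  have e2: "x \<otimes> (y \<otimes> z) = u \<otimes> (v \<otimes> z)" if "x \<otimes> y = u \<otimes> v"
      "x \<in> carrier G" "y \<in> carrier G" "u \<in> carrier G" "v \<in> carrier G" "z \<in> carrier G" for x y z u v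
    using that by (simp add: m_assoc[symmetric])
  have e3: "x \<otimes> (y \<otimes> (w \<otimes> z)) = u \<otimes> (v \<otimes> (t \<otimes> z))" if "x \<otimes> (y \<otimes> w) = u \<otimes> (v \<otimes> t)"
      "x \<in> carrier G" "y \<in> carrier G" "w \<in> carrier G" "u \<in> carrier G" "v \<in> carrier G" "t \<in> carrier G" "z \<in> carrier G" for x y w z u v t
    using that by (simp add: m_assoc[symmetric])
  have e4: "x \<otimes> (y \<otimes> (w \<otimes> (s \<otimes> z))) = u \<otimes> (v \<otimes> (t \<otimes> (r \<otimes> z)))" if "x \<otimes> y \<otimes> w \<otimes> s = u \<otimes> v \<otimes> t \<otimes> r"
      "x \<in> carrier G" "y \<in> carrier G" "w \<in> carrier G" "s \<in> carrier G" "u \<in> carrier G" "v \<in> carrier G" "t \<in> carrier G" "r \<in> carrier G" "z \<in> carrier G" for x y w s z u v t r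
    using that by (simp add: m_assoc[symmetric])
  have JR: "J \<otimes> (Rab \<otimes> z) = z" "Rab \<otimes> (J \<otimes> z) = z" if "z \<in> carrier G" for z
    using that cl inv by (simp_all add: m_assoc[symmetric])
  \<comment> \<open>The Yang--Baxter relation \<open>yb(1)\<close> multiplied by \<open>J\<close> on
    both sides: passing \<open>J\<close> to the left through \<open>R_{c,ab}\<close> reverses the
    order of its two factors. Likewise \<open>s2\<close> for \<open>R_{ab,c}\<close>, with
    \<open>yb(3)\<close>.\<close>
  have s1: "Rcb \<otimes> (Rca \<otimes> (J \<otimes> z)) = J \<otimes> (Rca \<otimes> (Rcb \<otimes> z))" if z: "z \<in> carrier G" for z
  proof -
    have "Rcb \<otimes> (Rca \<otimes> (J \<otimes> z)) = J \<otimes> (Rab \<otimes> (Rcb \<otimes> (Rca \<otimes> (J \<otimes> z))))"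
      using z cl by (simp add: JR)
    also have "\<dots> = J \<otimes> (Rca \<otimes> (Rcb \<otimes> (Rab \<otimes> (J \<otimes> z))))"
      using z cl by (simp add: e3[OF yb(1)])
    finally show ?thesis using z cl by (simp add: JR)
  qed
  have s2: "Rac \<otimes> (Rbc \<otimes> (J \<otimes> z)) = J \<otimes> (Rbc \<otimes> (Rac \<otimes> z))" if z: "z \<in> carrier G" for z
  proof -
    have "Rac \<otimes> (Rbc \<otimes> (J \<otimes> z)) = J \<otimes> (Rab \<otimes> (Rac \<otimes> (Rbc \<otimes> (J \<otimes> z))))"
      using z cl by (simp add: JR)
    also have "\<dots> = J \<otimes> (Rbc \<otimes> (Rac \<otimes> (Rab \<otimes> (J \<otimes> z))))"
      using z cl by (simp add: e3[OF yb(3)])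
    finally show ?thesis using z cl by (simp add: JR)
  qed
  have JK: "J \<otimes> (Kc \<otimes> z) = Kc \<otimes> (J \<otimes> z)" if z: "z \<in> carrier G" for z
  proof -
    have "J \<otimes> (Kc \<otimes> z) = J \<otimes> (Kc \<otimes> (Rab \<otimes> (J \<otimes> z)))" using z cl by (simp add: JR)
    also have "\<dots> = J \<otimes> (Rab \<otimes> (Kc \<otimes> (J \<otimes> z)))" using z cl by (simp add: e2[OF comm(5)])
    finally show ?thesis using z cl by (simp add: JR)
  qed
  show ?g1 if p1: ?p1 and p2: ?p2
  proof -
    \<comment> \<open>This sorts the word into the block \<open>Rca Ka Rac\<close>, then
      \<open>Rab\<close>, then \<open>Rcb Kb\<close> followed by the tail. With \<open>Rbc\<close>
      leading the tail, both blocks have the form met in the reflection equations, so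
      \<open>Kc\<close> passes through them by \<open>p2\<close> and \<open>p1\<close>. Used once
      forwards with tail \<open>Rbc Kc\<close> and once backwards with tail
      \<open>Rbc\<close>.\<close>
    have core: "J \<otimes> (Rca \<otimes> (Rcb \<otimes> (Ka \<otimes> (Rab \<otimes> (Kb \<otimes> (Rac \<otimes> z))))))
        = J \<otimes> (Rca \<otimes> (Ka \<otimes> (Rac \<otimes> (Rab \<otimes> (Rcb \<otimes> (Kb \<otimes> z))))))" if z: "z \<in> carrier G" for z
    proof -
      have "J \<otimes> (Rca \<otimes> (Rcb \<otimes> (Ka \<otimes> (Rab \<otimes> (Kb \<otimes> (Rac \<otimes> z))))))
          = J \<otimes> (Rca \<otimes> (Ka \<otimes> (Rcb \<otimes> (Rab \<otimes> (Kb \<otimes> (Rac \<otimes> z))))))"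
        using z cl by (simp add: e2[OF comm(1)])
      also have "\<dots> = J \<otimes> (Rca \<otimes> (Ka \<otimes> (Rcb \<otimes> (Rab \<otimes> (Rac \<otimes> (Kb \<otimes> z))))))"
        using z cl by (simp add: e2[OF comm(3)])
      also have "\<dots> = J \<otimes> (Rca \<otimes> (Ka \<otimes> (Rac \<otimes> (Rab \<otimes> (Rcb \<otimes> (Kb \<otimes> z))))))"
        using z cl by (simp add: e3[OF yb(2)])
      finally show ?thesis .
    qed
    have "(Rcb \<otimes> Rca) \<otimes> (J \<otimes> Ka \<otimes> Rab \<otimes> Kb) \<otimes> (Rac \<otimes> Rbc) \<otimes> Kc
        = J \<otimes> (Rca \<otimes> (Rcb \<otimes> (Ka \<otimes> (Rab \<otimes> (Kb \<otimes> (Rac \<otimes> (Rbc \<otimes> Kc)))))))"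
      using cl by (simp add: m_assoc s1)
    also have "\<dots> = J \<otimes> (Rca \<otimes> (Ka \<otimes> (Rac \<otimes> (Rab \<otimes> (Rcb \<otimes> (Kb \<otimes> (Rbc \<otimes> Kc)))))))"
      using cl by (simp add: core)
    also have "Rcb \<otimes> (Kb \<otimes> (Rbc \<otimes> Kc)) = Kc \<otimes> (Rcb \<otimes> (Kb \<otimes> Rbc))"
      using p2 cl by (simp add: m_assoc)
    also have "Rab \<otimes> (Kc \<otimes> (Rcb \<otimes> (Kb \<otimes> Rbc))) = Kc \<otimes> (Rab \<otimes> (Rcb \<otimes> (Kb \<otimes> Rbc)))"
      using cl by (simp add: e2[OF comm(5)])
    also have "Rca \<otimes> (Ka \<otimes> (Rac \<otimes> (Kc \<otimes> (Rab \<otimes> (Rcb \<otimes> (Kb \<otimes> Rbc))))))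
        = Kc \<otimes> (Rca \<otimes> (Ka \<otimes> (Rac \<otimes> (Rab \<otimes> (Rcb \<otimes> (Kb \<otimes> Rbc))))))"
      using cl by (simp add: e4[OF p1])
    also have "J \<otimes> \<dots> = Kc \<otimes> (J \<otimes> (Rca \<otimes> (Ka \<otimes> (Rac \<otimes> (Rab \<otimes> (Rcb \<otimes> (Kb \<otimes> Rbc)))))))"
      using cl by (simp add: JK)
    also have "\<dots> = Kc \<otimes> (J \<otimes> (Rca \<otimes> (Rcb \<otimes> (Ka \<otimes> (Rab \<otimes> (Kb \<otimes> (Rac \<otimes> Rbc)))))))"
      using cl by (simp add: core)
    also have "\<dots> = Kc \<otimes> (Rcb \<otimes> Rca) \<otimes> (J \<otimes> Ka \<otimes> Rab \<otimes> Kb) \<otimes> (Rac \<otimes> Rbc)"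
      using cl by (simp add: m_assoc s1)
    finally show ?thesis .
  qed
  show ?g2 if q1: ?q1 and q2: ?q2
  proof -
    \<comment> \<open>With the fused matrix on the right it is \<open>Ka\<close> and
      \<open>Kb\<close> that travel left: \<open>Ka\<close> through \<open>Rac Kc Rca\<close> by
      \<open>q1\<close>, \<open>Kb\<close> through \<open>Rbc Kc Rcb\<close> by \<open>q2\<close>.
      In between, Yang--Baxter carries \<open>Rab\<close> to the left, so that
      \<open>J Ka Rab Kb\<close> is reassembled in front.\<close>
    have "(Rac \<otimes> Rbc) \<otimes> Kc \<otimes> (Rcb \<otimes> Rca) \<otimes> (J \<otimes> Ka \<otimes> Rab \<otimes> Kb)
        = Rac \<otimes> (Rbc \<otimes> (Kc \<otimes> (J \<otimes> (Rca \<otimes> (Rcb \<otimes> (Ka \<otimes> (Rab \<otimes> Kb)))))))"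
      using cl by (simp add: m_assoc s1)
    also have "\<dots> = J \<otimes> (Rbc \<otimes> (Rac \<otimes> (Kc \<otimes> (Rca \<otimes> (Rcb \<otimes> (Ka \<otimes> (Rab \<otimes> Kb)))))))"
      using cl by (simp add: JK[symmetric] s2)
    also have "Rcb \<otimes> (Ka \<otimes> (Rab \<otimes> Kb)) = Ka \<otimes> (Rcb \<otimes> (Rab \<otimes> Kb))"
      using cl by (simp add: e2[OF comm(1)])
    also have "Rac \<otimes> (Kc \<otimes> (Rca \<otimes> (Ka \<otimes> (Rcb \<otimes> (Rab \<otimes> Kb)))))
        = Ka \<otimes> (Rac \<otimes> (Kc \<otimes> (Rca \<otimes> (Rcb \<otimes> (Rab \<otimes> Kb)))))"
      using cl by (simp add: e4[OF q1])
    also have "Rca \<otimes> (Rcb \<otimes> (Rab \<otimes> Kb)) = Rab \<otimes> (Rcb \<otimes> (Rca \<otimes> Kb))"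
      using cl by (simp add: e3[OF yb(1)])
    also have "Rca \<otimes> Kb = Kb \<otimes> Rca" by (rule comm)
    also have "Kc \<otimes> (Rab \<otimes> (Rcb \<otimes> (Kb \<otimes> Rca))) = Rab \<otimes> (Kc \<otimes> (Rcb \<otimes> (Kb \<otimes> Rca)))"
      using cl by (simp add: e2[OF comm(5)])
    also have "Rbc \<otimes> (Ka \<otimes> (Rac \<otimes> (Rab \<otimes> (Kc \<otimes> (Rcb \<otimes> (Kb \<otimes> Rca))))))
        = Ka \<otimes> (Rbc \<otimes> (Rac \<otimes> (Rab \<otimes> (Kc \<otimes> (Rcb \<otimes> (Kb \<otimes> Rca))))))"
      using cl by (simp add: e2[OF comm(2)])
    also have "Rbc \<otimes> (Rac \<otimes> (Rab \<otimes> (Kc \<otimes> (Rcb \<otimes> (Kb \<otimes> Rca)))))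
        = Rab \<otimes> (Rac \<otimes> (Rbc \<otimes> (Kc \<otimes> (Rcb \<otimes> (Kb \<otimes> Rca)))))"
      using cl by (simp add: e3[OF yb(3)])
    also have "Rbc \<otimes> (Kc \<otimes> (Rcb \<otimes> (Kb \<otimes> Rca))) = Kb \<otimes> (Rbc \<otimes> (Kc \<otimes> (Rcb \<otimes> Rca)))"
      using cl by (simp add: e4[OF q2])
    also have "Rac \<otimes> (Kb \<otimes> (Rbc \<otimes> (Kc \<otimes> (Rcb \<otimes> Rca)))) = Kb \<otimes> (Rac \<otimes> (Rbc \<otimes> (Kc \<otimes> (Rcb \<otimes> Rca))))"
      using cl by (simp add: e2[OF comm(3)])
    finally show ?thesis using cl by (simp add: m_assoc)
  qed
qed

end

section \<open>Endomorphism algebras\<close>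

lemma End_algebra_simps:
  "carrier (End_algebra k V) = linear_maps k V V \<inter> extensional (carrier V)"
  "monoid.mult (End_algebra k V) = compose (carrier V)"
  "one (End_algebra k V) = (\<lambda>v\<in>carrier V. v)"
  "ring.zero (End_algebra k V) = (\<lambda>v\<in>carrier V. \<zero>\<^bsub>V\<^esub>)"
  "add (End_algebra k V) = (\<lambda>f g. \<lambda>v\<in>carrier V. f v \<oplus>\<^bsub>V\<^esub> g v)"
  "smult (End_algebra k V) = (\<lambda>c f. \<lambda>v\<in>carrier V. c \<odot>\<^bsub>V\<^esub> f v)"
  by (simp_all add: End_algebra_def)

lemma End_closedI:
  assumes "module k V" "f \<in> linear_maps k V V"
  shows "restrict f (carrier V) \<in> carrier (End_algebra k V)"
  using assms linear_maps_cong[OF _ assms(1), of "restrict f (carrier V)" f V]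
  by (simp add: End_algebra_simps)

lemma End_linear: "f \<in> carrier (End_algebra k V) \<Longrightarrow> f \<in> linear_maps k V V"
  by (simp add: End_algebra_simps)

lemma End_ext:
  assumes "f \<in> carrier (End_algebra k V)" "g \<in> carrier (End_algebra k V)"
    and "\<And>v. v \<in> carrier V \<Longrightarrow> f v = g v"
  shows "f = g"
  using assms by (auto simp: End_algebra_simps intro: extensionalityI)

text \<open>Extensionality makes \<open>End_ext\<close> applicable, so that each equational law is
  checked pointwise in \<open>V\<close>.\<close>

lemma End_algebra_algebra:
  assumes "module k V"
  shows "assoc_algebra k (End_algebra k V)"
proof -
  interpret V: module k V by fact
  let ?E = "End_algebra k V"
  note lin = End_linear
  note cl = linear_maps_closed[OF End_linear]
  have add: "f \<oplus>\<^bsub>?E\<^esub> g \<in> carrier ?E" if "f \<in> carrier ?E" "g \<in> carrier ?E" for f g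
    using End_closedI[OF assms linear_maps_add_fun[OF assms lin lin]] that by (simp add: End_algebra_simps(5))
  have smult: "c \<odot>\<^bsub>?E\<^esub> f \<in> carrier ?E" if "c \<in> carrier k" "f \<in> carrier ?E" for c f
    using End_closedI[OF assms linear_maps_smult_fun[OF assms lin]] that by (simp add: End_algebra_simps(6))
  have mult: "f \<otimes>\<^bsub>?E\<^esub> g \<in> carrier ?E" if "f \<in> carrier ?E" "g \<in> carrier ?E" for f g
    using End_closedI[OF assms linear_maps_compose[OF lin lin]] that
    by (simp add: End_algebra_simps(2) compose_def)
  have one: "\<one>\<^bsub>?E\<^esub> \<in> carrier ?E"
    using End_closedI[OF assms linear_maps_id] by (simp add: End_algebra_simps(3))
  have zero: "\<zero>\<^bsub>?E\<^esub> \<in> carrier ?E"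
    using End_closedI[OF assms, of "\<lambda>v. \<zero>\<^bsub>V\<^esub>"] by (simp add: End_algebra_simps(4) linear_maps_def)
  note clE = add smult mult one zero
  have app: "(f \<oplus>\<^bsub>?E\<^esub> g) v = f v \<oplus>\<^bsub>V\<^esub> g v" "(c \<odot>\<^bsub>?E\<^esub> f) v = c \<odot>\<^bsub>V\<^esub> f v"
      "(f \<otimes>\<^bsub>?E\<^esub> g) v = f (g v)" "\<one>\<^bsub>?E\<^esub> v = v" "\<zero>\<^bsub>?E\<^esub> v = \<zero>\<^bsub>V\<^esub>" if "v \<in> carrier V" for f g c v
    using that by (simp_all add: End_algebra_simps compose_def)
  note la = linear_maps_add[OF End_linear] and ls = linear_maps_smult[OF End_linear]
  have neg: "\<exists>g\<in>carrier ?E. g \<oplus>\<^bsub>?E\<^esub> f = \<zero>\<^bsub>?E\<^esub>" if f: "f \<in> carrier ?E" for f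
  proof
    show m: "(\<ominus>\<^bsub>k\<^esub> \<one>\<^bsub>k\<^esub>) \<odot>\<^bsub>?E\<^esub> f \<in> carrier ?E" using f by (intro smult) auto
    show "((\<ominus>\<^bsub>k\<^esub> \<one>\<^bsub>k\<^esub>) \<odot>\<^bsub>?E\<^esub> f) \<oplus>\<^bsub>?E\<^esub> f = \<zero>\<^bsub>?E\<^esub>"
      by (rule End_ext[of _ k V]) (use m f in \<open>simp_all add: clE app cl V.smult_l_minus V.M.l_neg\<close>)
  qed
  have mod: "module k ?E"
  proof (rule moduleI)
    show "abelian_group ?E"
      by (rule abelian_groupI)
        ((rule End_ext[of _ k V], simp_all add: clE app cl V.M.a_ac) | simp add: clE neg)+
  qed (simp add: clE V.R.is_cring | (rule End_ext[of _ k V];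
      simp add: clE app cl V.smult_l_distr V.smult_r_distr V.smult_assoc1))+
  moreover have "ring ?E"
  proof (rule ringI)
    show "abelian_group ?E" using mod by (simp add: module_def)
    show "monoid ?E"
      by (rule monoidI) (simp add: clE | (rule End_ext[of _ k V]; simp add: clE app cl))+
  qed ((rule End_ext[of _ k V]; simp add: clE app cl la))+
  moreover have "assoc_algebra_axioms k ?E"
    by unfold_locales ((rule End_ext[of _ k V]; simp add: clE app cl ls))+
  ultimately show ?thesis by (simp add: assoc_algebra_def)
qed

lemma End_apply:
  assumes "v \<in> carrier V"
  shows "(f \<oplus>\<^bsub>End_algebra k V\<^esub> g) v = f v \<oplus>\<^bsub>V\<^esub> g v" "(c \<odot>\<^bsub>End_algebra k V\<^esub> f) v = c \<odot>\<^bsub>V\<^esub> f v"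
      "(f \<otimes>\<^bsub>End_algebra k V\<^esub> g) v = f (g v)" "\<one>\<^bsub>End_algebra k V\<^esub> v = v"
  using assms by (simp_all add: End_algebra_simps compose_def)

text \<open>Elements of \<open>End (V \<otimes> W)\<close> are determined by their values at pure
  tensors (fact \<open>ext\<close>), and there \<open>f \<otimes> g\<close> acts as \<open>f\<close>
  on the first and \<open>g\<close> on the second factor. Bilinearity in \<open>(f, g)\<close>,
  multiplicativity and the unit law all follow from this.\<close>

lemma End_tensor_hom:
  assumes V: "module k V" and W: "module k W"
  shows "End_tensor k V W \<in> algebra_homs k (tensor_algebra k (End_algebra k V) (End_algebra k W))
    (End_algebra k (tensor_module k V W))"
proof -
  interpret VW: module_pair k V W using V W by (rule module_pair.intro)
  let ?EV = "End_algebra k V" and ?EW = "End_algebra k W"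
  interpret E: algebra_pair k ?EV ?EW
    by (intro algebra_pair.intro End_algebra_algebra V W)
  let ?T = "tensor_module k V W" and ?ET = "End_algebra k (tensor_module k V W)"
  let ?\<phi> = "\<lambda>f g. restrict (tensor_map k V W f g) (carrier ?T)"
  interpret ET: assoc_algebra k ?ET by (intro End_algebra_algebra VW.T_module)
  note pc = bilinear_maps_closed[OF VW.pure_bilinear]
  note tl = VW.tensor_map_linear[OF V W End_linear End_linear]
  have cl: "?\<phi> f g \<in> carrier ?ET" if "f \<in> carrier ?EV" "g \<in> carrier ?EW" for f g
    using that by (intro End_closedI VW.T_module tl)
  have pure: "?\<phi> f g (pure_tensor k V W v w) = pure_tensor k V W (f v) (g w)"
    if "f \<in> carrier ?EV" "g \<in> carrier ?EW" "v \<in> carrier V" "w \<in> carrier W" for f g v w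
    using that VW.tensor_map_pure[OF V W End_linear End_linear] by (simp add: pc)
  have ext: "f = g" if "f \<in> carrier ?ET" "g \<in> carrier ?ET"
    "\<And>v w. \<lbrakk>v \<in> carrier V; w \<in> carrier W\<rbrakk> \<Longrightarrow> f (pure_tensor k V W v w) = g (pure_tensor k V W v w)" for f g
    by (rule End_ext[OF that(1,2)], rule VW.tensor_ext[OF VW.T_module End_linear[OF that(1)] End_linear[OF that(2)] that(3)])
  note lc = linear_maps_closed[OF End_linear[of _ k V]] linear_maps_closed[OF End_linear[of _ k W]]
  note pb1 = bilinear_maps_linear(1)[OF VW.pure_bilinear] and pb2 = bilinear_maps_linear(2)[OF VW.pure_bilinear]
  note pa = linear_maps_add[OF pb1] linear_maps_add[OF pb2] linear_maps_smult[OF pb1] linear_maps_smult[OF pb2]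
  have bil: "?\<phi> \<in> bilinear_maps k ?EV ?EW ?ET"
  proof (intro bilinear_mapsI linear_mapsI)
    fix f g assume f: "f \<in> carrier ?EV" and g: "g \<in> carrier ?EW"
    show "?\<phi> f g \<in> carrier ?ET" using f g by (rule cl)
    show "?\<phi> f (g \<oplus>\<^bsub>?EW\<^esub> g') = ?\<phi> f g \<oplus>\<^bsub>?ET\<^esub> ?\<phi> f g'" if "g' \<in> carrier ?EW" for g'
      by (rule ext) (simp_all add: f g that cl pure End_apply pc lc pa del: restrict_apply)
    show "?\<phi> (f \<oplus>\<^bsub>?EV\<^esub> f') g = ?\<phi> f g \<oplus>\<^bsub>?ET\<^esub> ?\<phi> f' g" if "f' \<in> carrier ?EV" for f'
      by (rule ext) (simp_all add: f g that cl pure End_apply pc lc pa del: restrict_apply)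
    fix c assume c: "c \<in> carrier k"
    show "?\<phi> f (c \<odot>\<^bsub>?EW\<^esub> g) = c \<odot>\<^bsub>?ET\<^esub> ?\<phi> f g"
      by (rule ext) (simp_all add: f g c cl pure End_apply pc lc pa del: restrict_apply)
    show "?\<phi> (c \<odot>\<^bsub>?EV\<^esub> f) g = c \<odot>\<^bsub>?ET\<^esub> ?\<phi> f g"
      by (rule ext) (simp_all add: f g c cl pure End_apply pc lc pa del: restrict_apply)
  qed (rule cl)
  show ?thesis unfolding End_tensor_def
  proof (rule E.tensor_lift_hom[OF ET.assoc_algebra_axioms bil])
    fix a b a' b' assume "a \<in> carrier ?EV" "b \<in> carrier ?EW" "a' \<in> carrier ?EV" "b' \<in> carrier ?EW"
    then show "?\<phi> (a \<otimes>\<^bsub>?EV\<^esub> a') (b \<otimes>\<^bsub>?EW\<^esub> b') = ?\<phi> a b \<otimes>\<^bsub>?ET\<^esub> ?\<phi> a' b'"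
      by (intro ext) (simp_all add: cl pure End_apply pc lc del: restrict_apply)
  next
    show "?\<phi> \<one>\<^bsub>?EV\<^esub> \<one>\<^bsub>?EW\<^esub> = \<one>\<^bsub>?ET\<^esub>"
      by (intro ext) (simp_all add: cl pure End_apply pc lc del: restrict_apply)
  qed
qed

section \<open>Free modules of finite rank\<close>

text \<open>\<open>k\<close> as an algebra over itself, in the form of a module record. Coordinate
  functionals become members of \<open>linear_maps\<close>, and the product of two functionals on a
  tensor product becomes an instance of \<open>hom_prod\<close>.\<close>

definition regular_algebra :: "'k ring \<Rightarrow> ('k, 'k) module" where
  "regular_algebra k = \<lparr>carrier = carrier k, monoid.mult = monoid.mult k, one = \<one>\<^bsub>k\<^esub>,
     ring.zero = \<zero>\<^bsub>k\<^esub>, ring.add = add k, smult = monoid.mult k\<rparr>"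

lemma regular_algebra_simps:
  "carrier (regular_algebra k) = carrier k"
  "monoid.mult (regular_algebra k) = monoid.mult k"
  "one (regular_algebra k) = \<one>\<^bsub>k\<^esub>"
  "ring.zero (regular_algebra k) = \<zero>\<^bsub>k\<^esub>"
  "add (regular_algebra k) = add k"
  "smult (regular_algebra k) = monoid.mult k"
  by (simp_all add: regular_algebra_def)

lemma regular_algebra_algebra:
  assumes "cring k"
  shows "assoc_algebra k (regular_algebra k)"
proof -
  interpret cring k by fact
  have ag: "abelian_group (regular_algebra k)"
    by (rule abelian_groupI) (auto simp: regular_algebra_simps a_ac intro: bexI[of _ "\<ominus>\<^bsub>k\<^esub> _"] l_neg)
  have "ring (regular_algebra k)"
    by (rule ringI[OF ag]) (auto simp: regular_algebra_simps l_distr r_distr intro!: monoidI m_assoc)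
  moreover have "module k (regular_algebra k)"
    by (rule moduleI[OF assms ag]) (auto simp: regular_algebra_simps l_distr r_distr m_assoc)
  moreover have "assoc_algebra_axioms k (regular_algebra k)"
    by unfold_locales (auto simp: regular_algebra_simps m_ac)
  ultimately show ?thesis by (simp add: assoc_algebra_def)
qed

lemma (in abelian_monoid) finsum_product:
  assumes "finite I" "finite J" "\<And>i j. i \<in> I \<Longrightarrow> j \<in> J \<Longrightarrow> g i j \<in> carrier G"
  shows "(\<Oplus>p\<in>I \<times> J. g (fst p) (snd p)) = (\<Oplus>i\<in>I. \<Oplus>j\<in>J. g i j)"
  using assms(1,3)
proof (induction I rule: finite_induct)
  case empty
  then show ?case by simp
next
  case (insert i I)
  have "(\<Oplus>p\<in>insert i I \<times> J. g (fst p) (snd p))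
      = (\<Oplus>p\<in>Pair i ` J \<union> I \<times> J. g (fst p) (snd p))"
    by (rule arg_cong[where f = "finsum G _"]) auto
  also have "\<dots> = (\<Oplus>p\<in>Pair i ` J. g (fst p) (snd p)) \<oplus> (\<Oplus>p\<in>I \<times> J. g (fst p) (snd p))"
    using insert.hyps insert.prems assms(2) by (intro finsum_Un_disjoint) auto
  also have "(\<Oplus>p\<in>Pair i ` J. g (fst p) (snd p)) = (\<Oplus>j\<in>J. g i j)"
    using insert.prems by (subst finsum_reindex) (auto simp: inj_on_def)
  also have "(\<Oplus>p\<in>I \<times> J. g (fst p) (snd p)) = (\<Oplus>i\<in>I. \<Oplus>j\<in>J. g i j)"
    using insert.prems by (intro insert.IH) auto
  also have "(\<Oplus>j\<in>J. g i j) \<oplus> (\<Oplus>i\<in>I. \<Oplus>j\<in>J. g i j) = (\<Oplus>i\<in>insert i I. \<Oplus>j\<in>J. g i j)"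
    using insert.hyps insert.prems by (subst finsum_insert) (auto intro!: finsum_closed)
  finally show ?case .
qed

lemma linear_maps_finsum_fun:
  assumes "module k M" "module k N" "\<And>i. i \<in> I \<Longrightarrow> f i \<in> linear_maps k M N"
  shows "(\<lambda>x. \<Oplus>\<^bsub>N\<^esub>i\<in>I. f i x) \<in> linear_maps k M N"
proof -
  interpret M: module k M by fact
  interpret N: module k N by fact
  have cl: "(\<lambda>i. f i x) \<in> I \<rightarrow> carrier N" if "x \<in> carrier M" for x
    using linear_maps_closed[OF assms(3)] that by auto
  show ?thesis
  proof (rule linear_mapsI)
    fix x y assume x: "x \<in> carrier M" and y: "y \<in> carrier M"
    show "(\<Oplus>\<^bsub>N\<^esub>i\<in>I. f i x) \<in> carrier N" using cl[OF x] by (rule N.M.finsum_closed)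
    have "(\<Oplus>\<^bsub>N\<^esub>i\<in>I. f i (x \<oplus>\<^bsub>M\<^esub> y)) = (\<Oplus>\<^bsub>N\<^esub>i\<in>I. f i x \<oplus>\<^bsub>N\<^esub> f i y)"
      using cl[OF x] cl[OF y] linear_maps_add[OF assms(3) x y] by (intro N.M.finsum_cong') auto
    then show "(\<Oplus>\<^bsub>N\<^esub>i\<in>I. f i (x \<oplus>\<^bsub>M\<^esub> y)) = (\<Oplus>\<^bsub>N\<^esub>i\<in>I. f i x) \<oplus>\<^bsub>N\<^esub> (\<Oplus>\<^bsub>N\<^esub>i\<in>I. f i y)"
      using cl x y by (simp add: N.M.finsum_addf)
  next
    fix c x assume c: "c \<in> carrier k" and x: "x \<in> carrier M"
    have "c \<odot>\<^bsub>N\<^esub> (\<Oplus>\<^bsub>N\<^esub>i\<in>I. f i x) = (\<Oplus>\<^bsub>N\<^esub>i\<in>I. c \<odot>\<^bsub>N\<^esub> f i x)"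
    proof (cases "finite I")
      case True
      then show ?thesis using c cl[OF x] by (rule N.finsum_smult_ldistr)
    next
      case False
      then show ?thesis using c by simp
    qed
    also have "\<dots> = (\<Oplus>\<^bsub>N\<^esub>i\<in>I. f i (c \<odot>\<^bsub>M\<^esub> x))"
      using c cl[of "c \<odot>\<^bsub>M\<^esub> x"] x linear_maps_smult[OF assms(3) c x] by (intro N.M.finsum_cong') auto
    finally show "(\<Oplus>\<^bsub>N\<^esub>i\<in>I. f i (c \<odot>\<^bsub>M\<^esub> x)) = c \<odot>\<^bsub>N\<^esub> (\<Oplus>\<^bsub>N\<^esub>i\<in>I. f i x)" by simp
  qed
qed

text \<open>Uniqueness of coefficients forces them to depend linearly on the vector. Passing from
  unique expansions to linear functionals is what makes the notion amenable to tensor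
  products.\<close>

lemma free_of_finite_rank_dual_basis:
  assumes "free_of_finite_rank k V"
  shows "\<exists>B \<chi>. finite B \<and> B \<subseteq> carrier V \<and>
    (\<forall>b\<in>B. \<chi> b \<in> linear_maps k V (regular_algebra k)) \<and>
    (\<forall>v\<in>carrier V. v = (\<Oplus>\<^bsub>V\<^esub>b\<in>B. \<chi> b v \<odot>\<^bsub>V\<^esub> b)) \<and>
    (\<forall>b\<in>B. \<forall>b'\<in>B. \<chi> b b' = (if b = b' then \<one>\<^bsub>k\<^esub> else \<zero>\<^bsub>k\<^esub>))"
proof -
  interpret V: module k V using assms by (simp add: free_of_finite_rank_def)
  obtain B where B: "finite B" "B \<subseteq> carrier V" and "\<forall>v\<in>carrier V.
      \<exists>!c. c \<in> B \<rightarrow>\<^sub>E carrier k \<and> v = (\<Oplus>\<^bsub>V\<^esub>b\<in>B. c b \<odot>\<^bsub>V\<^esub> b)"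
    using assms unfolding free_of_finite_rank_def by blast
  note ex = bspec[OF this(3)]
  define cf where "cf v = (THE c. c \<in> B \<rightarrow>\<^sub>E carrier k \<and> v = (\<Oplus>\<^bsub>V\<^esub>b\<in>B. c b \<odot>\<^bsub>V\<^esub> b))" for v
  have cf: "cf v \<in> B \<rightarrow>\<^sub>E carrier k" "v = (\<Oplus>\<^bsub>V\<^esub>b\<in>B. cf v b \<odot>\<^bsub>V\<^esub> b)" if "v \<in> carrier V" for v
    using theI'[OF ex[OF that]] by (auto simp: cf_def)
  have uniq: "cf v b = c b"
    if "v \<in> carrier V" "c \<in> B \<rightarrow> carrier k" "v = (\<Oplus>\<^bsub>V\<^esub>b\<in>B. c b \<odot>\<^bsub>V\<^esub> b)" "b \<in> B" for v c b
  proof -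
    \<comment> \<open>Uniqueness is available for extensional coefficient functions, so an arbitrary
      \<open>c\<close> is first restricted to \<open>B\<close>.\<close>
    have "(\<Oplus>\<^bsub>V\<^esub>b\<in>B. restrict c B b \<odot>\<^bsub>V\<^esub> b) = (\<Oplus>\<^bsub>V\<^esub>b\<in>B. c b \<odot>\<^bsub>V\<^esub> b)"
      using that B(2) by (intro V.M.finsum_cong') auto
    then have "v = (\<Oplus>\<^bsub>V\<^esub>b\<in>B. restrict c B b \<odot>\<^bsub>V\<^esub> b)" using that(3) by (rule ssubst)
    moreover have "restrict c B \<in> B \<rightarrow>\<^sub>E carrier k" using that by auto
    ultimately have "cf v = restrict c B" using ex[OF that(1)] cf[OF that(1)] by blast
    then show ?thesis using that by simp
  qed
  have cfc: "cf v b \<in> carrier k" if "v \<in> carrier V" "b \<in> B" for v b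
    using cf(1)[OF that(1)] that(2) by auto
  have cfs: "(\<lambda>b. cf v b \<odot>\<^bsub>V\<^esub> b) \<in> B \<rightarrow> carrier V" if "v \<in> carrier V" for v
    using cfc that B(2) by auto
  show ?thesis
  proof (intro exI[of _ B] exI[of _ "\<lambda>b v. cf v b"] conjI ballI)
    show "finite B" "B \<subseteq> carrier V" by fact+
    show "v = (\<Oplus>\<^bsub>V\<^esub>b\<in>B. cf v b \<odot>\<^bsub>V\<^esub> b)" if "v \<in> carrier V" for v using cf(2)[OF that] .
    show "cf b' b = (if b = b' then \<one>\<^bsub>k\<^esub> else \<zero>\<^bsub>k\<^esub>)" if b: "b \<in> B" "b' \<in> B" for b b'
    proof (rule uniq)
      have "(\<Oplus>\<^bsub>V\<^esub>b\<in>B. (if b = b' then \<one>\<^bsub>k\<^esub> else \<zero>\<^bsub>k\<^esub>) \<odot>\<^bsub>V\<^esub> b)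
          = (\<Oplus>\<^bsub>V\<^esub>b\<in>B. if b' = b then b else \<zero>\<^bsub>V\<^esub>)"
        using B(2) by (intro V.M.finsum_cong') auto
      also have "\<dots> = b'" using B b by (intro V.M.finsum_singleton) auto
      finally show "b' = (\<Oplus>\<^bsub>V\<^esub>b\<in>B. (if b = b' then \<one>\<^bsub>k\<^esub> else \<zero>\<^bsub>k\<^esub>) \<odot>\<^bsub>V\<^esub> b)" by simp
    qed (use b B in auto)
    show "(\<lambda>v. cf v b) \<in> linear_maps k V (regular_algebra k)" if b: "b \<in> B" for b
    proof (rule linear_mapsI)
      fix x y assume x: "x \<in> carrier V" and y: "y \<in> carrier V"
      show "cf x b \<in> carrier (regular_algebra k)" using cfc[OF x b] by (simp add: regular_algebra_simps)
      have "(\<Oplus>\<^bsub>V\<^esub>b\<in>B. (cf x b \<oplus>\<^bsub>k\<^esub> cf y b) \<odot>\<^bsub>V\<^esub> b)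
          = (\<Oplus>\<^bsub>V\<^esub>b\<in>B. cf x b \<odot>\<^bsub>V\<^esub> b \<oplus>\<^bsub>V\<^esub> cf y b \<odot>\<^bsub>V\<^esub> b)"
        using cfc[OF x] cfc[OF y] B(2) by (intro V.M.finsum_cong') (auto simp: V.smult_l_distr subset_iff)
      also have "\<dots> = x \<oplus>\<^bsub>V\<^esub> y"
        using cf(2)[OF x] cf(2)[OF y] cfs[OF x] cfs[OF y] by (simp add: V.M.finsum_addf)
      finally have "cf (x \<oplus>\<^bsub>V\<^esub> y) b = cf x b \<oplus>\<^bsub>k\<^esub> cf y b"
        using x y b cfc by (intro uniq) auto
      then show "cf (x \<oplus>\<^bsub>V\<^esub> y) b = cf x b \<oplus>\<^bsub>regular_algebra k\<^esub> cf y b"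
        by (simp add: regular_algebra_simps)
    next
      fix c x assume c: "c \<in> carrier k" and x: "x \<in> carrier V"
      have "(\<Oplus>\<^bsub>V\<^esub>b\<in>B. (c \<otimes>\<^bsub>k\<^esub> cf x b) \<odot>\<^bsub>V\<^esub> b) = (\<Oplus>\<^bsub>V\<^esub>b\<in>B. c \<odot>\<^bsub>V\<^esub> (cf x b \<odot>\<^bsub>V\<^esub> b))"
        using cfc[OF x] B(2) c by (intro V.M.finsum_cong') (auto simp: V.smult_assoc1 subset_iff)
      also have "\<dots> = c \<odot>\<^bsub>V\<^esub> x"
        using cf(2)[OF x] V.finsum_smult_ldistr[OF B(1) c cfs[OF x]] by simp
      finally have "cf (c \<odot>\<^bsub>V\<^esub> x) b = c \<otimes>\<^bsub>k\<^esub> cf x b"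
        using c x b cfc by (intro uniq) auto
      then show "cf (c \<odot>\<^bsub>V\<^esub> x) b = c \<odot>\<^bsub>regular_algebra k\<^esub> cf x b"
        by (simp add: regular_algebra_simps)
    qed
  qed
qed

text \<open>Applying \<open>\<chi> i\<close> to an expansion isolates the coefficient of
  \<open>e i\<close>, which gives uniqueness. An indexed family is used because the product basis of
  a tensor product comes indexed by pairs.\<close>

lemma free_of_finite_rankI:
  assumes V: "module k V" and I: "finite I" and e: "e \<in> I \<rightarrow> carrier V"
    and lin: "\<And>i. i \<in> I \<Longrightarrow> \<chi> i \<in> linear_maps k V (regular_algebra k)"
    and span: "\<And>v. v \<in> carrier V \<Longrightarrow> v = (\<Oplus>\<^bsub>V\<^esub>i\<in>I. \<chi> i v \<odot>\<^bsub>V\<^esub> e i)"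
    and dual: "\<And>i j. \<lbrakk>i \<in> I; j \<in> I\<rbrakk> \<Longrightarrow> \<chi> i (e j) = (if i = j then \<one>\<^bsub>k\<^esub> else \<zero>\<^bsub>k\<^esub>)"
  shows "free_of_finite_rank k V"
proof -
  interpret V: module k V by fact
  interpret r: assoc_algebra k "regular_algebra k"
    by (rule regular_algebra_algebra[OF V.R.is_cring])
  show ?thesis
  proof (cases "\<one>\<^bsub>k\<^esub> = \<zero>\<^bsub>k\<^esub>") \<comment> \<open>over the zero ring \<open>e\<close> need not be injective\<close>
    case True
    have "v = \<zero>\<^bsub>V\<^esub>" if "v \<in> carrier V" for v
      using V.smult_one[OF that] V.smult_l_null[OF that] True by simp
    then show ?thesis unfolding free_of_finite_rank_def
      using V by (intro conjI exI[of _ "{}"]) auto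
  next
    case False
    have inj: "inj_on e I"
    proof (rule inj_onI)
      fix i j assume "i \<in> I" "j \<in> I" "e i = e j"
      then show "i = j" using dual[of i i] dual[of i j] False by (auto split: if_splits)
    qed
    have \<chi>: "\<chi> i v \<in> carrier k" if "i \<in> I" "v \<in> carrier V" for i v
      using linear_maps_closed[OF lin[OF that(1)] that(2)] by (simp add: regular_algebra_simps)
    have reindex: "(\<Oplus>\<^bsub>V\<^esub>b\<in>e ` I. c b \<odot>\<^bsub>V\<^esub> b) = (\<Oplus>\<^bsub>V\<^esub>i\<in>I. c (e i) \<odot>\<^bsub>V\<^esub> e i)"
      if "c \<in> e ` I \<rightarrow> carrier k" for c
      using that e inj by (intro V.M.finsum_reindex) auto
    have coord: "\<chi> i v = c (e i)"
      if c: "c \<in> e ` I \<rightarrow> carrier k" and v: "v = (\<Oplus>\<^bsub>V\<^esub>b\<in>e ` I. c b \<odot>\<^bsub>V\<^esub> b)" and i: "i \<in> I" for c v i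
    proof -
      have ce: "c (e j) \<in> carrier k" "e j \<in> carrier V" if "j \<in> I" for j
        using c e that by auto
      have "\<chi> i v = (\<Oplus>\<^bsub>regular_algebra k\<^esub>j\<in>I. \<chi> i (c (e j) \<odot>\<^bsub>V\<^esub> e j))"
        unfolding v reindex[OF c] using c e by (intro linear_maps_finsum[OF V r.module_axioms lin[OF i]]) auto
      also have "\<dots> = (\<Oplus>\<^bsub>regular_algebra k\<^esub>j\<in>I. if i = j then c (e j) else \<zero>\<^bsub>regular_algebra k\<^esub>)"
        using ce by (intro r.M.finsum_cong')
          (auto simp: linear_maps_smult[OF lin[OF i]] dual[OF i] regular_algebra_simps)
      also have "\<dots> = c (e i)"
        using I i ce by (intro r.M.finsum_singleton) (auto simp: regular_algebra_simps)
      finally show ?thesis .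
    qed
    have "\<exists>!c. c \<in> e ` I \<rightarrow>\<^sub>E carrier k \<and> v = (\<Oplus>\<^bsub>V\<^esub>b\<in>e ` I. c b \<odot>\<^bsub>V\<^esub> b)" if v: "v \<in> carrier V" for v
    proof
      \<comment> \<open>Coefficients are indexed by basis vectors and functionals by
        \<open>I\<close>; the inverse of \<open>e\<close> translates.\<close>
      define c where "c = (\<lambda>b\<in>e ` I. \<chi> (the_inv_into I e b) v)"
      have ce: "c (e i) = \<chi> i v" if "i \<in> I" for i
        using that inj by (simp add: c_def the_inv_into_f_f)
      have c: "c \<in> e ` I \<rightarrow>\<^sub>E carrier k"
        using \<chi> v ce by (auto simp: PiE_iff c_def)
      have "v = (\<Oplus>\<^bsub>V\<^esub>i\<in>I. \<chi> i v \<odot>\<^bsub>V\<^esub> e i)" by (rule span[OF v])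
      also have "\<dots> = (\<Oplus>\<^bsub>V\<^esub>i\<in>I. c (e i) \<odot>\<^bsub>V\<^esub> e i)"
        using \<chi> v e ce by (intro V.M.finsum_cong') auto
      also have "\<dots> = (\<Oplus>\<^bsub>V\<^esub>b\<in>e ` I. c b \<odot>\<^bsub>V\<^esub> b)"
        using c by (intro reindex[symmetric]) auto
      finally show "c \<in> e ` I \<rightarrow>\<^sub>E carrier k \<and> v = (\<Oplus>\<^bsub>V\<^esub>b\<in>e ` I. c b \<odot>\<^bsub>V\<^esub> b)"
        using c by simp
      fix d assume d: "d \<in> e ` I \<rightarrow>\<^sub>E carrier k \<and> v = (\<Oplus>\<^bsub>V\<^esub>b\<in>e ` I. d b \<odot>\<^bsub>V\<^esub> b)"
      have "d b = c b" if "b \<in> e ` I" for b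
        using that coord[of d v] d ce by (auto simp: PiE_def)
      then show "d = c" using d c by (intro PiE_ext) auto
    qed
    then show ?thesis unfolding free_of_finite_rank_def
      using V I e by (intro conjI exI[of _ "e ` I"]) auto
  qed
qed

text \<open>The basis consists of the tensors of basis vectors, the dual family of the products of
  coordinate functionals. The expansion of \<open>t\<close> is linear in \<open>t\<close>, so it is
  verified on pure tensors, where it is the product of the expansions of the two factors.\<close>

lemma free_of_finite_rank_tensor:
  assumes V: "free_of_finite_rank k V" and W: "free_of_finite_rank k W"
  shows "free_of_finite_rank k (tensor_module k V W)"
proof -
  obtain B \<chi> where B: "finite B" "B \<subseteq> carrier V"
    and 1: "\<forall>b\<in>B. \<chi> b \<in> linear_maps k V (regular_algebra k)"
      "\<forall>v\<in>carrier V. v = (\<Oplus>\<^bsub>V\<^esub>b\<in>B. \<chi> b v \<odot>\<^bsub>V\<^esub> b)"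
      "\<forall>b\<in>B. \<forall>b'\<in>B. \<chi> b b' = (if b = b' then \<one>\<^bsub>k\<^esub> else \<zero>\<^bsub>k\<^esub>)"
    using free_of_finite_rank_dual_basis[OF V] by blast
  note \<chi> = bspec[OF 1(1)] and sV = bspec[OF 1(2)] and dV = bspec[OF bspec[OF 1(3)]]
  obtain C \<psi> where C: "finite C" "C \<subseteq> carrier W"
    and 1: "\<forall>b\<in>C. \<psi> b \<in> linear_maps k W (regular_algebra k)"
      "\<forall>v\<in>carrier W. v = (\<Oplus>\<^bsub>W\<^esub>b\<in>C. \<psi> b v \<odot>\<^bsub>W\<^esub> b)"
      "\<forall>b\<in>C. \<forall>b'\<in>C. \<psi> b b' = (if b = b' then \<one>\<^bsub>k\<^esub> else \<zero>\<^bsub>k\<^esub>)"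
    using free_of_finite_rank_dual_basis[OF W] by blast
  note \<psi> = bspec[OF 1(1)] and sW = bspec[OF 1(2)] and dW = bspec[OF bspec[OF 1(3)]]
  interpret VW: module_pair k V W
    using V W by (auto simp: free_of_finite_rank_def intro: module_pair.intro)
  interpret T: module k "tensor_module k V W" by (rule VW.T_module)
  interpret r: assoc_algebra k "regular_algebra k"
    by (rule regular_algebra_algebra[OF VW.M.R.is_cring])
  note r = r.assoc_algebra_axioms
  let ?T = "tensor_module k V W" and ?pt = "pure_tensor k V W"
  let ?e = "\<lambda>p. ?pt (fst p) (snd p)"
  let ?\<theta> = "\<lambda>p. hom_prod k (regular_algebra k) (\<chi> (fst p)) (\<psi> (snd p))"
  note pc = bilinear_maps_closed[OF VW.pure_bilinear]
  note p1 = bilinear_maps_linear(1)[OF VW.pure_bilinear] and p2 = bilinear_maps_linear(2)[OF VW.pure_bilinear]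
  have \<chi>c: "\<chi> b v \<in> carrier k" if "b \<in> B" "v \<in> carrier V" for b v
    using linear_maps_closed[OF \<chi>[OF that(1)] that(2)] by (simp add: regular_algebra_simps)
  have \<psi>c: "\<psi> b v \<in> carrier k" if "b \<in> C" "v \<in> carrier W" for b v
    using linear_maps_closed[OF \<psi>[OF that(1)] that(2)] by (simp add: regular_algebra_simps)
  have lin: "?\<theta> p \<in> linear_maps k ?T (regular_algebra k)" if "p \<in> B \<times> C" for p
    using that by (intro VW.hom_prod_linear r \<chi> \<psi>) auto
  have pure: "?\<theta> p (?pt v w) = \<chi> (fst p) v \<otimes>\<^bsub>k\<^esub> \<psi> (snd p) w"
    if "p \<in> B \<times> C" "v \<in> carrier V" "w \<in> carrier W" for p v w
    using that VW.hom_prod_pure[OF r \<chi> \<psi>] by (auto simp: regular_algebra_simps)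
  have sm: "(\<lambda>x. f x \<odot>\<^bsub>?T\<^esub> t) \<in> linear_maps k ?T ?T"
    if "f \<in> linear_maps k ?T (regular_algebra k)" "t \<in> carrier ?T" for f t
    using that linear_maps_closed[OF that(1)] linear_maps_add[OF that(1)] linear_maps_smult[OF that(1)]
    by (intro linear_mapsI) (auto simp: regular_algebra_simps T.smult_l_distr T.smult_assoc1)
  have span_pure: "?pt v w = (\<Oplus>\<^bsub>?T\<^esub>p\<in>B \<times> C. ?\<theta> p (?pt v w) \<odot>\<^bsub>?T\<^esub> ?e p)"
    if v: "v \<in> carrier V" and w: "w \<in> carrier W" for v w
  proof -
    have inner: "(\<Oplus>\<^bsub>?T\<^esub>c\<in>C. (\<chi> b v \<otimes>\<^bsub>k\<^esub> \<psi> c w) \<odot>\<^bsub>?T\<^esub> ?pt b c) = ?pt (\<chi> b v \<odot>\<^bsub>V\<^esub> b) w" if b: "b \<in> B" for b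
    proof -
      have bc: "b \<in> carrier V" "\<chi> b v \<odot>\<^bsub>V\<^esub> b \<in> carrier V" using b B(2) \<chi>c v by auto
      have "?pt (\<chi> b v \<odot>\<^bsub>V\<^esub> b) w = ?pt (\<chi> b v \<odot>\<^bsub>V\<^esub> b) (\<Oplus>\<^bsub>W\<^esub>c\<in>C. \<psi> c w \<odot>\<^bsub>W\<^esub> c)"
        by (subst sW[OF w]) (rule refl)
      also have "\<dots> = (\<Oplus>\<^bsub>?T\<^esub>c\<in>C. ?pt (\<chi> b v \<odot>\<^bsub>V\<^esub> b) (\<psi> c w \<odot>\<^bsub>W\<^esub> c))"
        using C(2) \<psi>c w by (intro linear_maps_finsum[OF VW.N.module_axioms VW.T_module p1[OF bc(2)]]) auto
      also have "\<dots> = (\<Oplus>\<^bsub>?T\<^esub>c\<in>C. (\<chi> b v \<otimes>\<^bsub>k\<^esub> \<psi> c w) \<odot>\<^bsub>?T\<^esub> ?pt b c)"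
      proof (intro T.M.finsum_cong' refl)
        fix c assume c: "c \<in> C"
        then have cc: "c \<in> carrier W" "\<psi> c w \<in> carrier k" "\<psi> c w \<odot>\<^bsub>W\<^esub> c \<in> carrier W"
          using C(2) \<psi>c w by auto
        show "?pt (\<chi> b v \<odot>\<^bsub>V\<^esub> b) (\<psi> c w \<odot>\<^bsub>W\<^esub> c) = (\<chi> b v \<otimes>\<^bsub>k\<^esub> \<psi> c w) \<odot>\<^bsub>?T\<^esub> ?pt b c"
          using linear_maps_smult[OF p2[OF cc(3)] \<chi>c[OF b v] bc(1)] linear_maps_smult[OF p1[OF bc(1)] cc(2,1)]
          by (simp add: T.smult_assoc1 \<chi>c[OF b v] cc bc pc)
      qed (use \<chi>c[OF b v] \<psi>c[OF _ w] C(2) bc pc in auto)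
      finally show ?thesis by simp
    qed
    have "(\<Oplus>\<^bsub>?T\<^esub>p\<in>B \<times> C. ?\<theta> p (?pt v w) \<odot>\<^bsub>?T\<^esub> ?e p)
        = (\<Oplus>\<^bsub>?T\<^esub>p\<in>B \<times> C. (\<chi> (fst p) v \<otimes>\<^bsub>k\<^esub> \<psi> (snd p) w) \<odot>\<^bsub>?T\<^esub> ?pt (fst p) (snd p))"
      using pure v w \<chi>c \<psi>c pc B C by (intro T.M.finsum_cong') (auto simp: subset_iff)
    also have "\<dots> = (\<Oplus>\<^bsub>?T\<^esub>b\<in>B. \<Oplus>\<^bsub>?T\<^esub>c\<in>C. (\<chi> b v \<otimes>\<^bsub>k\<^esub> \<psi> c w) \<odot>\<^bsub>?T\<^esub> ?pt b c)"
      using \<chi>c \<psi>c v w pc B C by (intro T.M.finsum_product) (auto simp: subset_iff)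
    also have "\<dots> = (\<Oplus>\<^bsub>?T\<^esub>b\<in>B. ?pt (\<chi> b v \<odot>\<^bsub>V\<^esub> b) w)"
      using inner \<chi>c v w pc B(2) by (intro T.M.finsum_cong') auto
    also have "\<dots> = ?pt (\<Oplus>\<^bsub>V\<^esub>b\<in>B. \<chi> b v \<odot>\<^bsub>V\<^esub> b) w"
      using B(2) \<chi>c v by (intro linear_maps_finsum[OF VW.M.module_axioms VW.T_module p2[OF w], symmetric]) auto
    also have "\<dots> = ?pt v w" using sV[OF v] by simp
    finally show ?thesis by simp
  qed
  show ?thesis
  proof (rule free_of_finite_rankI[where I = "B \<times> C" and e = ?e and \<chi> = ?\<theta>])
    show "t = (\<Oplus>\<^bsub>?T\<^esub>p\<in>B \<times> C. ?\<theta> p t \<odot>\<^bsub>?T\<^esub> ?e p)" if t: "t \<in> carrier ?T" for t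
    proof (rule VW.tensor_ext[OF VW.T_module linear_maps_id _ span_pure t])
      show "(\<lambda>t. \<Oplus>\<^bsub>?T\<^esub>p\<in>B \<times> C. ?\<theta> p t \<odot>\<^bsub>?T\<^esub> ?e p) \<in> linear_maps k ?T ?T"
        using B(2) C(2) by (intro linear_maps_finsum_fun VW.T_module sm lin pc) auto
    qed
    show "?\<theta> p (?e q) = (if p = q then \<one>\<^bsub>k\<^esub> else \<zero>\<^bsub>k\<^esub>)" if "p \<in> B \<times> C" "q \<in> B \<times> C" for p q
      using that B(2) C(2) dV dW by (subst pure) (auto simp: prod_eq_iff subset_iff)
  qed (use B C pc lin VW.T_module in \<open>auto simp: subset_iff\<close>)
qed

section \<open>The reflection equation in an arbitrary algebra\<close>

text \<open>The reflection equation as seen in a test algebra: \<open>\<alpha>\<close>,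
  \<open>\<beta>\<close> are the representations composed with maps into \<open>S\<close>,
  \<open>x\<close>, \<open>y\<close> the images of the K-matrices. By \<open>prod_flip\<close>,
  \<open>hom_prod k S \<beta> \<alpha> \<R>\<close> is the image of the flipped R-matrix.\<close>

definition reflection_identity ::
  "'k ring \<Rightarrow> ('h \<times> 'h \<Rightarrow> 'k) set \<Rightarrow> ('k, 's) module \<Rightarrow> ('h \<Rightarrow> 's) \<Rightarrow> 's \<Rightarrow> ('h \<Rightarrow> 's) \<Rightarrow> 's \<Rightarrow> bool" where
  "reflection_identity k \<R> S \<alpha> x \<beta> y \<longleftrightarrow>
     hom_prod k S \<beta> \<alpha> \<R> \<otimes>\<^bsub>S\<^esub> x \<otimes>\<^bsub>S\<^esub> hom_prod k S \<alpha> \<beta> \<R> \<otimes>\<^bsub>S\<^esub> y =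
     y \<otimes>\<^bsub>S\<^esub> hom_prod k S \<beta> \<alpha> \<R> \<otimes>\<^bsub>S\<^esub> x \<otimes>\<^bsub>S\<^esub> hom_prod k S \<alpha> \<beta> \<R>"

text \<open>Shaped to provide the commutation hypotheses of the fusion lemma: a K-matrix has legs in
  its own endomorphism algebra and in \<open>A\<close>, and the image of any other endomorphism
  algebra commutes with both.\<close>

lemma hom_prod_hom_pair_commutes:
  assumes vu: "hom_pair k B C S v u" and va: "hom_pair k B A S v a" and ua: "hom_pair k C A S u a"
    and g: "g \<in> carrier B" and p: "p \<in> carrier (tensor_module k C A)"
  shows "hom_prod k S u a p \<otimes>\<^bsub>S\<^esub> v g = v g \<otimes>\<^bsub>S\<^esub> hom_prod k S u a p"
  by (rule hom_pair.prod_commutes[OF ua algebra_homs_closed[OF hom_pair.left_hom[OF vu] g]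
        hom_pair.commutes[OF vu g] hom_pair.commutes[OF va g] p, symmetric])

context quasitriangular_hopf_algebra
begin

text \<open>Translation of the word calculation: \<open>\<alpha>\<close>, \<open>\<beta>\<close>,
  \<open>\<eta>\<close> belong to \<open>a\<close>, \<open>b\<close>, \<open>c\<close>, and
  \<open>x\<close>, \<open>y\<close>, \<open>z\<close> are \<open>Ka\<close>, \<open>Kb\<close>,
  \<open>Kc\<close>. The map \<open>\<delta>\<close> is the tensor product representation and
  \<open>w\<close> the fused matrix, both seen in \<open>S\<close>.\<close>

lemma reflection_identity_fusion:
  assumes t: "hom_triple k H H H S \<alpha> \<beta> \<eta>"
    and cl: "x \<in> carrier S" "y \<in> carrier S" "z \<in> carrier S" "J \<in> carrier S"
    and J: "J \<otimes>\<^bsub>S\<^esub> hom_prod k S \<alpha> \<beta> \<R> = \<one>\<^bsub>S\<^esub>" "hom_prod k S \<alpha> \<beta> \<R> \<otimes>\<^bsub>S\<^esub> J = \<one>\<^bsub>S\<^esub>"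
    and x: "\<And>h. h \<in> carrier H \<Longrightarrow> x \<otimes>\<^bsub>S\<^esub> \<beta> h = \<beta> h \<otimes>\<^bsub>S\<^esub> x" "\<And>h. h \<in> carrier H \<Longrightarrow> x \<otimes>\<^bsub>S\<^esub> \<eta> h = \<eta> h \<otimes>\<^bsub>S\<^esub> x"
    and y: "\<And>h. h \<in> carrier H \<Longrightarrow> y \<otimes>\<^bsub>S\<^esub> \<alpha> h = \<alpha> h \<otimes>\<^bsub>S\<^esub> y" "\<And>h. h \<in> carrier H \<Longrightarrow> y \<otimes>\<^bsub>S\<^esub> \<eta> h = \<eta> h \<otimes>\<^bsub>S\<^esub> y"
    and z: "\<And>h. h \<in> carrier H \<Longrightarrow> z \<otimes>\<^bsub>S\<^esub> \<alpha> h = \<alpha> h \<otimes>\<^bsub>S\<^esub> z" "\<And>h. h \<in> carrier H \<Longrightarrow> z \<otimes>\<^bsub>S\<^esub> \<beta> h = \<beta> h \<otimes>\<^bsub>S\<^esub> z"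
  defines "\<delta> \<equiv> \<lambda>h. hom_prod k S \<alpha> \<beta> (\<Delta> h)"
    and "w \<equiv> J \<otimes>\<^bsub>S\<^esub> x \<otimes>\<^bsub>S\<^esub> hom_prod k S \<alpha> \<beta> \<R> \<otimes>\<^bsub>S\<^esub> y"
  shows "\<lbrakk>reflection_identity k \<R> S \<alpha> x \<eta> z; reflection_identity k \<R> S \<beta> y \<eta> z\<rbrakk> \<Longrightarrow>
      reflection_identity k \<R> S \<delta> w \<eta> z"
    and "\<lbrakk>reflection_identity k \<R> S \<eta> z \<alpha> x; reflection_identity k \<R> S \<eta> z \<beta> y\<rbrakk> \<Longrightarrow>
      reflection_identity k \<R> S \<eta> z \<delta> w"
proof -
  interpret t: hom_triple k H H H S \<alpha> \<beta> \<eta> by fact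
  note acb = hom_triple_swap23[OF t]
  note cab = hom_triple_swap12[OF acb]
  have sw: "hom_pair k H H S \<beta> \<alpha>" "hom_pair k H H S \<eta> \<alpha>" "hom_pair k H H S \<eta> \<beta>"
    by (intro t.AB.hom_pair_swap t.AC.hom_pair_swap t.BC.hom_pair_swap)+
  note c = t.AB.prod_closed[OF R_closed] t.AC.prod_closed[OF R_closed] t.BC.prod_closed[OF R_closed]
    hom_pair.prod_closed[OF sw(2) R_closed] hom_pair.prod_closed[OF sw(3) R_closed]
  have comm: "hom_prod k S \<eta> \<beta> \<R> \<otimes>\<^bsub>S\<^esub> x = x \<otimes>\<^bsub>S\<^esub> hom_prod k S \<eta> \<beta> \<R>"
    "hom_prod k S \<beta> \<eta> \<R> \<otimes>\<^bsub>S\<^esub> x = x \<otimes>\<^bsub>S\<^esub> hom_prod k S \<beta> \<eta> \<R>"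
    "hom_prod k S \<alpha> \<eta> \<R> \<otimes>\<^bsub>S\<^esub> y = y \<otimes>\<^bsub>S\<^esub> hom_prod k S \<alpha> \<eta> \<R>"
    "hom_prod k S \<eta> \<alpha> \<R> \<otimes>\<^bsub>S\<^esub> y = y \<otimes>\<^bsub>S\<^esub> hom_prod k S \<eta> \<alpha> \<R>"
    "hom_prod k S \<alpha> \<beta> \<R> \<otimes>\<^bsub>S\<^esub> z = z \<otimes>\<^bsub>S\<^esub> hom_prod k S \<alpha> \<beta> \<R>"
    using hom_pair.prod_commutes[OF sw(3) cl(1) x(2,1) R_closed]
      t.BC.prod_commutes[OF cl(1) x R_closed]
      t.AC.prod_commutes[OF cl(2) y R_closed]
      hom_pair.prod_commutes[OF sw(2) cl(2) y(2,1) R_closed]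
      t.AB.prod_commutes[OF cl(3) z R_closed]
    by simp_all
  \<comment> \<open>The three Yang--Baxter relations are those for the orders \<open>cab\<close>,
    \<open>acb\<close> and \<open>abc\<close>.\<close>
  note words = t.AB.S.fused_reflection_words[OF c(1) cl(4) c(2,3,4,5) cl(1-3) J comm
      yang_baxter[OF cab] yang_baxter[OF acb] yang_baxter[OF t]]
  show "\<lbrakk>reflection_identity k \<R> S \<alpha> x \<eta> z; reflection_identity k \<R> S \<beta> y \<eta> z\<rbrakk> \<Longrightarrow>
      reflection_identity k \<R> S \<delta> w \<eta> z"
    unfolding reflection_identity_def \<delta>_def w_def hom_prod_R_left[OF t] hom_prod_R_right[OF cab]
    by (rule words(1))
  show "\<lbrakk>reflection_identity k \<R> S \<eta> z \<alpha> x; reflection_identity k \<R> S \<eta> z \<beta> y\<rbrakk> \<Longrightarrow>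
      reflection_identity k \<R> S \<eta> z \<delta> w"
    unfolding reflection_identity_def \<delta>_def w_def hom_prod_R_left[OF t] hom_prod_R_right[OF cab]
    by (rule words(2))
qed

section \<open>Passage between the reflection equation and identities in a test algebra\<close>

lemma R_image_closed:
  assumes "module k V" "module k W" "\<rho> \<in> algebra_homs k H (End_algebra k V)" "\<sigma> \<in> algebra_homs k H (End_algebra k W)"
  shows "R_image k \<R> \<rho> V \<sigma> W \<in> carrier (tensor_module k (End_algebra k V) (End_algebra k W))"
proof -
  interpret E: algebra_pair k "End_algebra k V" "End_algebra k W"
    by (intro algebra_pair.intro End_algebra_algebra assms)
  show ?thesis unfolding R_image_def
    by (rule linear_maps_closed[OF E.tensor_map_linear[OF H.module_axioms H.module_axioms
          algebra_homs_linear[OF assms(3)] algebra_homs_linear[OF assms(4)]] R_closed])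
qed

text \<open>The joint map of the triple is an algebra homomorphism on the triple tensor algebra; it
  is applied to both sides of the equation and evaluated leg by leg.\<close>

lemma reflection_eq_imp_identity:
  assumes t: "hom_triple k (End_algebra k V) (End_algebra k W) A S b c a"
    and V: "module k V" and W: "module k W"
    and \<rho>: "\<rho> \<in> algebra_homs k H (End_algebra k V)" and \<sigma>: "\<sigma> \<in> algebra_homs k H (End_algebra k W)"
    and K: "K \<in> carrier (tensor_module k (End_algebra k V) A)"
    and L: "L \<in> carrier (tensor_module k (End_algebra k W) A)"
    and eq: "reflection_eq k \<R> A (\<rho>, V, K) (\<sigma>, W, L)"
  shows "reflection_identity k \<R> S (\<lambda>h. b (\<rho> h)) (hom_prod k S b a K) (\<lambda>h. c (\<sigma> h)) (hom_prod k S c a L)"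
proof -
  interpret t: hom_triple k "End_algebra k V" "End_algebra k W" A S b c a by fact
  interpret WV: hom_pair k "End_algebra k W" "End_algebra k V" S c b
    by (rule t.AB.hom_pair_swap)
  let ?R = "R_image k \<R> \<rho> V \<sigma> W" and ?R' = "R_image k \<R> \<sigma> W \<rho> V"
  note R = R_image_closed[OF V W \<rho> \<sigma>] and R' = R_image_closed[OF W V \<sigma> \<rho>]
  have F: "tensor_flip k (End_algebra k W) (End_algebra k V) ?R' \<in> carrier t.AB.T"
    by (rule linear_maps_closed[OF t.AB.tensor_flip_linear R'])
  have r: "t.AB.joint ?R = hom_prod k S (\<lambda>h. b (\<rho> h)) (\<lambda>h. c (\<sigma> h)) \<R>"
    unfolding R_image_def by (rule t.AB.prod_tensor_map[OF H.module_axioms H.module_axioms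
      algebra_homs_linear[OF \<rho>] algebra_homs_linear[OF \<sigma>] R_closed])
  have r': "WV.joint ?R' = hom_prod k S (\<lambda>h. c (\<sigma> h)) (\<lambda>h. b (\<rho> h)) \<R>"
    unfolding R_image_def by (rule WV.prod_tensor_map[OF H.module_axioms H.module_axioms
      algebra_homs_linear[OF \<sigma>] algebra_homs_linear[OF \<rho>] R_closed])
  note legs = t.leg12_closed[OF R] t.leg12_closed[OF F] t.leg13_closed[OF K] t.leg23_closed[OF L]
  note imgs = t.prod_leg12[OF R, unfolded r] t.prod_leg12[OF F, unfolded t.AB.prod_flip[OF R'] r']
    t.prod_leg13[OF K] t.prod_leg23[OF L]
  show ?thesis
    using arg_cong[where f = t.ABC.joint, OF eq[unfolded reflection_eq_def Let_def prod.case]]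
    unfolding reflection_identity_def
    by (simp add: t.ABC.prod_mult bilinear_maps_closed[OF t.ABC.TA_mult_bilinear] legs imgs)
qed

text \<open>The converse passage, with the triple tensor algebra as test algebra. The homomorphisms
  in \<open>id\<close> are arbitrary, so users of the rule need not know the canonical inclusions at
  which it is instantiated.\<close>

lemma reflection_eqI:
  assumes A: "assoc_algebra k A" and V: "module k V" and W: "module k W"
    and \<rho>: "\<rho> \<in> algebra_homs k H (End_algebra k V)" and \<sigma>: "\<sigma> \<in> algebra_homs k H (End_algebra k W)"
    and K: "K \<in> carrier (tensor_module k (End_algebra k V) A)"
    and L: "L \<in> carrier (tensor_module k (End_algebra k W) A)"
    and id: "\<And>b c a. hom_triple k (End_algebra k V) (End_algebra k W) A
        (tensor3 k (End_algebra k V) (End_algebra k W) A) b c a \<Longrightarrow>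
      reflection_identity k \<R> (tensor3 k (End_algebra k V) (End_algebra k W) A)
        (\<lambda>h. b (\<rho> h)) (hom_prod k (tensor3 k (End_algebra k V) (End_algebra k W) A) b a K)
        (\<lambda>h. c (\<sigma> h)) (hom_prod k (tensor3 k (End_algebra k V) (End_algebra k W) A) c a L)"
  shows "reflection_eq k \<R> A (\<rho>, V, K) (\<sigma>, W, L)"
proof -
  let ?EV = "End_algebra k V" and ?EW = "End_algebra k W"
  interpret t3: algebra_triple k ?EV ?EW A
    by (intro algebra_triple.intro algebra_pair.intro End_algebra_algebra V W A)
  interpret WV: hom_pair k ?EW ?EV "tensor3 k ?EV ?EW A" t3.inc2 t3.inc1
    by (rule t3.can.AB.hom_pair_swap)
  let ?R = "R_image k \<R> \<rho> V \<sigma> W" and ?R' = "R_image k \<R> \<sigma> W \<rho> V"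
  note R = R_image_closed[OF V W \<rho> \<sigma>] and R' = R_image_closed[OF W V \<sigma> \<rho>]
  have F: "tensor_flip k ?EW ?EV ?R' \<in> carrier t3.AB.T"
    by (rule linear_maps_closed[OF t3.AB.tensor_flip_linear R'])
  have r: "t3.can.AB.joint ?R = hom_prod k (tensor3 k ?EV ?EW A) (\<lambda>h. t3.inc1 (\<rho> h)) (\<lambda>h. t3.inc2 (\<sigma> h)) \<R>"
    unfolding R_image_def by (rule t3.can.AB.prod_tensor_map[OF H.module_axioms H.module_axioms
      algebra_homs_linear[OF \<rho>] algebra_homs_linear[OF \<sigma>] R_closed])
  have r': "WV.joint ?R' = hom_prod k (tensor3 k ?EV ?EW A) (\<lambda>h. t3.inc2 (\<sigma> h)) (\<lambda>h. t3.inc1 (\<rho> h)) \<R>"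
    unfolding R_image_def by (rule WV.prod_tensor_map[OF H.module_axioms H.module_axioms
      algebra_homs_linear[OF \<sigma>] algebra_homs_linear[OF \<rho>] R_closed])
  note legs = t3.leg_eq_prod(1)[OF R, unfolded r] t3.leg_eq_prod(1)[OF F, unfolded t3.can.AB.prod_flip[OF R'] r']
    t3.leg_eq_prod(2)[OF K] t3.leg_eq_prod(3)[OF L]
  show ?thesis
    using id[OF t3.canonical_hom_triple]
    unfolding reflection_identity_def reflection_eq_def Let_def prod.case legs .
qed

lemma tensor_rep_hom:
  assumes V: "module k V" and W: "module k W"
    and \<rho>: "\<rho> \<in> algebra_homs k H (End_algebra k V)" and \<sigma>: "\<sigma> \<in> algebra_homs k H (End_algebra k W)"
  shows "tensor_rep k \<Delta> \<rho> V \<sigma> W \<in> algebra_homs k H (End_algebra k (tensor_module k V W))"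
proof -
  interpret E: algebra_pair k "End_algebra k V" "End_algebra k W"
    by (intro algebra_pair.intro End_algebra_algebra V W)
  show ?thesis unfolding tensor_rep_def[abs_def]
    by (rule algebra_homs_compose[OF algebra_homs_compose[OF coproduct
        E.tensor_map_hom[OF H.assoc_algebra_axioms H.assoc_algebra_axioms \<rho> \<sigma>]] End_tensor_hom[OF V W]])
qed

text \<open>Makes the \<open>inv\<close> in \<open>fused_K\<close> a genuine two-sided inverse:
  homomorphisms preserve units, and \<open>\<R>\<close> is one.\<close>

lemma R_image_Units:
  assumes V: "module k V" and W: "module k W"
    and \<rho>: "\<rho> \<in> algebra_homs k H (End_algebra k V)" and \<sigma>: "\<sigma> \<in> algebra_homs k H (End_algebra k W)"
  shows "R_image k \<R> \<rho> V \<sigma> W \<in> Units (tensor_algebra k (End_algebra k V) (End_algebra k W))"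
proof -
  interpret E: algebra_pair k "End_algebra k V" "End_algebra k W"
    by (intro algebra_pair.intro End_algebra_algebra V W)
  interpret HH: algebra_pair k H H by (intro algebra_pair.intro H.assoc_algebra_axioms)
  show ?thesis unfolding R_image_def
    by (rule algebra_homs_Units[OF HH.TA_algebra
        E.tensor_map_hom[OF H.assoc_algebra_axioms H.assoc_algebra_axioms \<rho> \<sigma>] R_invertible])
qed

text \<open>A test algebra for the fused triple against \<open>(\<tau>, U, M)\<close> is also one
  for each constituent against it, since \<open>e\<close> can be pulled back along
  \<open>End_tensor\<close>. The given equations thus become identities in the same
  \<open>S\<close>, where fusion applies.\<close>

lemma fused_reflection_identity:
  assumes A: "assoc_algebra k A" and V: "module k V" and W: "module k W" and U: "module k U"
    and \<rho>: "\<rho> \<in> algebra_homs k H (End_algebra k V)" and \<sigma>: "\<sigma> \<in> algebra_homs k H (End_algebra k W)"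
    and \<tau>: "\<tau> \<in> algebra_homs k H (End_algebra k U)"
    and K: "K \<in> carrier (tensor_module k (End_algebra k V) A)"
    and L: "L \<in> carrier (tensor_module k (End_algebra k W) A)"
    and M: "M \<in> carrier (tensor_module k (End_algebra k U) A)"
    and t: "hom_triple k (End_algebra k (tensor_module k V W)) (End_algebra k U) A S e c a"
  defines "N \<equiv> fused_K k \<R> A (\<rho>, V, K) (\<sigma>, W, L)"
  shows "N \<in> carrier (tensor_module k (End_algebra k (tensor_module k V W)) A)"
    and "\<lbrakk>reflection_eq k \<R> A (\<rho>, V, K) (\<tau>, U, M); reflection_eq k \<R> A (\<sigma>, W, L) (\<tau>, U, M)\<rbrakk> \<Longrightarrow>
      reflection_identity k \<R> S (\<lambda>h. e (tensor_rep k \<Delta> \<rho> V \<sigma> W h)) (hom_prod k S e a N)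
        (\<lambda>h. c (\<tau> h)) (hom_prod k S c a M)"
    and "\<lbrakk>reflection_eq k \<R> A (\<tau>, U, M) (\<rho>, V, K); reflection_eq k \<R> A (\<tau>, U, M) (\<sigma>, W, L)\<rbrakk> \<Longrightarrow>
      reflection_identity k \<R> S (\<lambda>h. c (\<tau> h)) (hom_prod k S c a M)
        (\<lambda>h. e (tensor_rep k \<Delta> \<rho> V \<sigma> W h)) (hom_prod k S e a N)"
proof -
  let ?EV = "End_algebra k V" and ?EW = "End_algebra k W" and ?EU = "End_algebra k U"
    and ?E = "End_algebra k (tensor_module k V W)" and ?\<theta> = "End_tensor k V W"
  interpret t: hom_triple k ?E ?EU A S e c a by fact
  interpret E: algebra_pair k ?EV ?EW
    by (intro algebra_pair.intro End_algebra_algebra V W)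
  note S = t.AB.S.assoc_algebra_axioms
  note \<theta> = End_tensor_hom[OF V W]
  \<comment> \<open>The two factors of \<open>End V \<otimes> End W\<close>, sent to
    \<open>S\<close> through \<open>End (V \<otimes> W)\<close>. They commute with each other inside
    the tensor product and inherit commutation with \<open>c\<close> and \<open>a\<close> from
    \<open>e\<close>.\<close>
  define b1 where "b1 f = e (?\<theta> (E.pt f \<one>\<^bsub>?EW\<^esub>))" for f
  define b2 where "b2 g = e (?\<theta> (E.pt \<one>\<^bsub>?EV\<^esub> g))" for g
  note e\<theta> = algebra_homs_compose[OF \<theta> t.AB.left_hom]
  note j1 = algebra_homs_compose[OF E.pure_left_hom \<theta>] and j2 = algebra_homs_compose[OF E.pure_right_hom \<theta>]
  have p12: "hom_pair k ?EV ?EW S b1 b2"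
    unfolding b1_def b2_def by (rule hom_pair.hom_pair_post[OF E.canonical_hom_pair S e\<theta>])
  have p1c: "hom_pair k ?EV ?EU S b1 c" and p2c: "hom_pair k ?EW ?EU S b2 c"
    and p1a: "hom_pair k ?EV A S b1 a" and p2a: "hom_pair k ?EW A S b2 a"
    unfolding b1_def b2_def
    using t.AB.hom_pair_pre[OF E.A.assoc_algebra_axioms t.AB.B.assoc_algebra_axioms j1 algebra_homs_id]
      t.AB.hom_pair_pre[OF E.B.assoc_algebra_axioms t.AB.B.assoc_algebra_axioms j2 algebra_homs_id]
      t.AC.hom_pair_pre[OF E.A.assoc_algebra_axioms A j1 algebra_homs_id]
      t.AC.hom_pair_pre[OF E.B.assoc_algebra_axioms A j2 algebra_homs_id]
    by simp_all
  have pca: "hom_pair k ?EU A S c a" by (rule t.BC.hom_pair_axioms)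
  have t12a: "hom_triple k ?EV ?EW A S b1 b2 a" and t1ca: "hom_triple k ?EV ?EU A S b1 c a"
    and t2ca: "hom_triple k ?EW ?EU A S b2 c a"
    by (intro hom_triple.intro p12 p1c p2c p1a p2a pca)+
  interpret t12a: hom_triple k ?EV ?EW A S b1 b2 a by fact
  \<comment> \<open>Through \<open>b1\<close> and \<open>b2\<close> one evaluates exactly
    \<open>e\<close> after \<open>End_tensor\<close>. This identifies both the fused matrix and the
    tensor product representation in \<open>S\<close>.\<close>
  have joint: "hom_prod k S b1 b2 p = e (?\<theta> p)" if "p \<in> carrier E.T" for p
    unfolding b1_def b2_def
    using hom_pair.prod_post[OF E.canonical_hom_pair S e\<theta> that] E.canonical_prod[OF that] by simp
  let ?\<alpha> = "\<lambda>h. b1 (\<rho> h)" and ?\<beta> = "\<lambda>h. b2 (\<sigma> h)" and ?\<eta> = "\<lambda>h. c (\<tau> h)"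
  have tH: "hom_triple k H H H S ?\<alpha> ?\<beta> ?\<eta>"
    by (intro hom_triple.intro hom_pair.hom_pair_pre[OF p12] hom_pair.hom_pair_pre[OF p1c]
        hom_pair.hom_pair_pre[OF p2c] H.assoc_algebra_axioms \<rho> \<sigma> \<tau>)
  let ?R = "R_image k \<R> \<rho> V \<sigma> W"
  note R = R_image_closed[OF V W \<rho> \<sigma>] and RU = R_image_Units[OF V W \<rho> \<sigma>]
  let ?I = "inv\<^bsub>E.TA\<^esub> ?R"
  have I: "?I \<in> carrier E.T" using E.TA.Units_inv_closed[OF RU] by simp
  have r: "t12a.AB.joint ?R = hom_prod k S ?\<alpha> ?\<beta> \<R>"
    unfolding R_image_def by (rule t12a.AB.prod_tensor_map[OF H.module_axioms H.module_axioms
      algebra_homs_linear[OF \<rho>] algebra_homs_linear[OF \<sigma>] R_closed])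
  note J = algebra_homs_inverse[OF E.TA_algebra t12a.AB.prod_hom RU, unfolded r]
  let ?J = "t12a.AB.joint ?I"
  let ?x = "hom_prod k S b1 a K" and ?y = "hom_prod k S b2 a L" and ?z = "hom_prod k S c a M"
  let ?T3 = "tensor3 k ?EV ?EW A"
  let ?w = "leg12 k ?EV ?EW A ?I \<otimes>\<^bsub>?T3\<^esub> leg13 k ?EV ?EW A K \<otimes>\<^bsub>?T3\<^esub>
           leg12 k ?EV ?EW A ?R \<otimes>\<^bsub>?T3\<^esub> leg23 k ?EV ?EW A L"
  note legs = t12a.leg12_closed[OF I] t12a.leg12_closed[OF R] t12a.leg13_closed[OF K] t12a.leg23_closed[OF L]
  note mc = bilinear_maps_closed[OF t12a.ABC.TA_mult_bilinear]
  have w: "?w \<in> carrier t12a.ABC.T" by (simp add: mc legs)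
  have N: "N = tensor_map k ?E A ?\<theta> (\<lambda>a. a) ?w"
    by (simp add: N_def fused_K_def Let_def)
  note \<theta>l = algebra_homs_linear[OF \<theta>]
  show "N \<in> carrier (tensor_module k ?E A)"
    unfolding N by (rule linear_maps_closed[OF t.AC.tensor_map_linear[OF E.TA.module_axioms
      t.AC.B.module_axioms \<theta>l linear_maps_id] w])
  have "hom_prod k S e a N = hom_prod k S (\<lambda>p. e (?\<theta> p)) a ?w"
    unfolding N by (rule t.AC.prod_tensor_map[OF E.TA.module_axioms t.AC.B.module_axioms \<theta>l linear_maps_id w])
  also have "\<dots> = t12a.ABC.joint ?w"
    by (rule t12a.ABC.prod_cong) (simp_all add: joint w)
  also have "\<dots> = ?J \<otimes>\<^bsub>S\<^esub> ?x \<otimes>\<^bsub>S\<^esub> hom_prod k S ?\<alpha> ?\<beta> \<R> \<otimes>\<^bsub>S\<^esub> ?y"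
    by (simp add: t12a.ABC.prod_mult mc legs t12a.prod_leg12 t12a.prod_leg13 t12a.prod_leg23 I R K L r)
  finally have NS: "hom_prod k S e a N = ?J \<otimes>\<^bsub>S\<^esub> ?x \<otimes>\<^bsub>S\<^esub> hom_prod k S ?\<alpha> ?\<beta> \<R> \<otimes>\<^bsub>S\<^esub> ?y" .
  \<comment> \<open>This equality is known on the carrier of \<open>H\<close> only, so
    \<open>cong1\<close> and \<open>cong2\<close> are needed to use it inside
    \<open>hom_prod\<close>.\<close>
  have \<delta>: "e (tensor_rep k \<Delta> \<rho> V \<sigma> W h) = hom_prod k S ?\<alpha> ?\<beta> (\<Delta> h)" if h: "h \<in> carrier H" for h
  proof -
    let ?m = "tensor_map k ?EV ?EW \<rho> \<sigma> (\<Delta> h)"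
    have m: "?m \<in> carrier E.T"
      by (rule linear_maps_closed[OF E.tensor_map_linear[OF H.module_axioms H.module_axioms
          algebra_homs_linear[OF \<rho>] algebra_homs_linear[OF \<sigma>]] coproduct_closed[OF h]])
    have "hom_prod k S ?\<alpha> ?\<beta> (\<Delta> h) = t12a.AB.joint ?m"
      by (rule t12a.AB.prod_tensor_map[OF H.module_axioms H.module_axioms
        algebra_homs_linear[OF \<rho>] algebra_homs_linear[OF \<sigma>] coproduct_closed[OF h], symmetric])
    then show ?thesis by (simp add: joint[OF m] tensor_rep_def)
  qed
  interpret tH: hom_triple k H H H S ?\<alpha> ?\<beta> ?\<eta> by (rule tH)
  note \<delta>l = algebra_homs_linear[OF hom_prod_coproduct_hom[OF tH.AB.hom_pair_axioms]]
  note \<eta>l = tH.AC.right_linear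
  have cong1: "hom_prod k S (\<lambda>h. e (tensor_rep k \<Delta> \<rho> V \<sigma> W h)) ?\<eta> \<R> = hom_prod k S (\<lambda>h. hom_prod k S ?\<alpha> ?\<beta> (\<Delta> h)) ?\<eta> \<R>"
    by (rule tH.AB.hom_prod_cong[OF S \<delta>l \<eta>l \<delta> refl R_closed])
  have cong2: "hom_prod k S ?\<eta> (\<lambda>h. e (tensor_rep k \<Delta> \<rho> V \<sigma> W h)) \<R> = hom_prod k S ?\<eta> (\<lambda>h. hom_prod k S ?\<alpha> ?\<beta> (\<Delta> h)) \<R>"
    by (rule tH.AB.hom_prod_cong[OF S \<eta>l \<delta>l refl \<delta> R_closed])
  have xyz: "?x \<in> carrier S" "?y \<in> carrier S" "?z \<in> carrier S" "?J \<in> carrier S"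
    using hom_pair.prod_closed[OF p1a K] hom_pair.prod_closed[OF p2a L] hom_pair.prod_closed[OF pca M]
      t12a.AB.prod_closed[OF I] by auto
  note \<rho>c = algebra_homs_closed[OF \<rho>] and \<sigma>c = algebra_homs_closed[OF \<sigma>] and \<tau>c = algebra_homs_closed[OF \<tau>]
  note fusion = reflection_identity_fusion[OF tH xyz J,
      OF hom_prod_hom_pair_commutes[OF hom_pair.hom_pair_swap[OF p12] p2a p1a \<sigma>c K] hom_prod_hom_pair_commutes[OF hom_pair.hom_pair_swap[OF p1c] pca p1a \<tau>c K]
        hom_prod_hom_pair_commutes[OF p12 p1a p2a \<rho>c L] hom_prod_hom_pair_commutes[OF hom_pair.hom_pair_swap[OF p2c] pca p2a \<tau>c L]
        hom_prod_hom_pair_commutes[OF p1c p1a pca \<rho>c M] hom_prod_hom_pair_commutes[OF p2c p2a pca \<sigma>c M]]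
  show "reflection_identity k \<R> S (\<lambda>h. e (tensor_rep k \<Delta> \<rho> V \<sigma> W h)) (hom_prod k S e a N) ?\<eta> ?z"
    if "reflection_eq k \<R> A (\<rho>, V, K) (\<tau>, U, M)" "reflection_eq k \<R> A (\<sigma>, W, L) (\<tau>, U, M)"
    unfolding reflection_identity_def cong1 cong2 NS unfolding reflection_identity_def[symmetric]
    by (rule fusion(1)[OF _ _ _ _ _ _ reflection_eq_imp_identity[OF t1ca V U \<rho> \<tau> K M that(1)]
        reflection_eq_imp_identity[OF t2ca W U \<sigma> \<tau> L M that(2)]])
  show "reflection_identity k \<R> S ?\<eta> ?z (\<lambda>h. e (tensor_rep k \<Delta> \<rho> V \<sigma> W h)) (hom_prod k S e a N)"
    if "reflection_eq k \<R> A (\<tau>, U, M) (\<rho>, V, K)" "reflection_eq k \<R> A (\<tau>, U, M) (\<sigma>, W, L)"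
    unfolding reflection_identity_def cong1 cong2 NS unfolding reflection_identity_def[symmetric]
    by (rule fusion(2)[OF _ _ _ _ _ _ reflection_eq_imp_identity[OF hom_triple_swap12[OF t1ca] U V \<tau> \<rho> M K that(1)]
        reflection_eq_imp_identity[OF hom_triple_swap12[OF t2ca] U W \<tau> \<sigma> M L that(2)]])
qed

end

section \<open>Fused triples as members of an RE data\<close>

context quasitriangular_hopf_algebra
begin

lemma re_tripleD:
  assumes "re_triple k H A (\<rho>, V, K)"
  shows "free_of_finite_rank k V" "module k V" "\<rho> \<in> algebra_homs k H (End_algebra k V)"
    "K \<in> carrier (tensor_module k (End_algebra k V) A)"
  using assms by (simp_all add: re_triple_def free_of_finite_rank_def)

lemma re_triple_fused:
  assumes A: "assoc_algebra k A" and s: "re_triple k H A (\<rho>, V, K)" and t: "re_triple k H A (\<sigma>, W, L)"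
  shows "re_triple k H A (tensor_rep k \<Delta> \<rho> V \<sigma> W, tensor_module k V W, fused_K k \<R> A (\<rho>, V, K) (\<sigma>, W, L))"
proof -
  note s = re_tripleD[OF s] and t = re_tripleD[OF t]
  have VW: "module k (tensor_module k V W)"
    by (rule module_pair.T_module[OF module_pair.intro[OF s(2) t(2)]])
  interpret t3: algebra_triple k "End_algebra k (tensor_module k V W)" "End_algebra k W" A
    by (intro algebra_triple.intro algebra_pair.intro End_algebra_algebra VW t(2) A)
  show ?thesis
    \<comment> \<open>Membership of the fused matrix is stated together with the identities against
      a third triple; \<open>(\<sigma>, W, L)\<close> fills that place, and the canonical triple
      tensor algebra serves as \<open>S\<close>.\<close>
    using fused_reflection_identity(1)[OF A s(2) t(2) t(2) s(3) t(3) t(3) s(4) t(4) t(4) t3.canonical_hom_triple]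
    by (simp add: re_triple_def free_of_finite_rank_tensor[OF s(1) t(1)] tensor_rep_hom[OF s(2) t(2) s(3) t(3)])
qed

lemma reflection_eq_fused:
  assumes A: "assoc_algebra k A" and s: "re_triple k H A (\<rho>, V, K)" and t: "re_triple k H A (\<sigma>, W, L)"
    and u: "re_triple k H A (\<tau>, U, M)"
  defines "st \<equiv> (tensor_rep k \<Delta> \<rho> V \<sigma> W, tensor_module k V W, fused_K k \<R> A (\<rho>, V, K) (\<sigma>, W, L))"
  shows "\<lbrakk>reflection_eq k \<R> A (\<rho>, V, K) (\<tau>, U, M); reflection_eq k \<R> A (\<sigma>, W, L) (\<tau>, U, M)\<rbrakk> \<Longrightarrow>
      reflection_eq k \<R> A st (\<tau>, U, M)"
    and "\<lbrakk>reflection_eq k \<R> A (\<tau>, U, M) (\<rho>, V, K); reflection_eq k \<R> A (\<tau>, U, M) (\<sigma>, W, L)\<rbrakk> \<Longrightarrow>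
      reflection_eq k \<R> A (\<tau>, U, M) st"
proof -
  note f = re_tripleD[OF re_triple_fused[OF A s t]]
  note s = re_tripleD[OF s] and t = re_tripleD[OF t] and u = re_tripleD[OF u]
  note fusion = fused_reflection_identity[OF A s(2) t(2) u(2) s(3) t(3) u(3) s(4) t(4) u(4)]
  show "reflection_eq k \<R> A st (\<tau>, U, M)"
    if "reflection_eq k \<R> A (\<rho>, V, K) (\<tau>, U, M)" "reflection_eq k \<R> A (\<sigma>, W, L) (\<tau>, U, M)"
    unfolding st_def by (rule reflection_eqI[OF A f(2) u(2) f(3) u(3) f(4) u(4) fusion(2)[OF _ that]])
  show "reflection_eq k \<R> A (\<tau>, U, M) st"
    if "reflection_eq k \<R> A (\<tau>, U, M) (\<rho>, V, K)" "reflection_eq k \<R> A (\<tau>, U, M) (\<sigma>, W, L)"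
    unfolding st_def
    by (rule reflection_eqI[OF A u(2) f(2) u(3) f(3) u(4) f(4) fusion(3)[OF hom_triple_swap12 that]])
qed

end

theorem theorem17:
  fixes F :: "'f ring" and \<iota> :: "'f \<Rightarrow> 'k" and k :: "'k ring"
    and H :: "('k, 'h) module" and \<Delta> :: "'h \<Rightarrow> ('h \<times> 'h \<Rightarrow> 'k) set"
    and \<epsilon> :: "'h \<Rightarrow> 'k" and \<gamma> :: "'h \<Rightarrow> 'h" and \<R> :: "('h \<times> 'h \<Rightarrow> 'k) set"
    and A :: "('k, 'a) module"
    and I :: "'i set" and \<rho> :: "'i \<Rightarrow> 'h \<Rightarrow> 'v \<Rightarrow> 'v" and V :: "'i \<Rightarrow> ('k, 'v) module"
    and K :: "'i \<Rightarrow> (('v \<Rightarrow> 'v) \<times> 'a \<Rightarrow> 'k) set"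
  assumes "field F" and "\<And>n::nat. n > 0 \<Longrightarrow> [n] \<cdot>\<^bsub>F\<^esub> \<one>\<^bsub>F\<^esub> \<noteq> \<zero>\<^bsub>F\<^esub>"
    and "cring k" and "\<iota> \<in> ring_hom F k"
    and "quasitriangular_hopf_algebra k H \<Delta> \<epsilon> \<gamma> \<R>"
    and "assoc_algebra k A"
    and "RE_data k H \<R> A {(\<rho> i, V i, K i) | i. i \<in> I}"
  shows "RE_data_union k H \<R> A
           {(\<rho> i, V i, K i) | i. i \<in> I}
           {(tensor_rep k \<Delta> (\<rho> i) (V i) (\<rho> j) (V j),
             tensor_module k (V i) (V j),
             fused_K k \<R> A (\<rho> i, V i, K i) (\<rho> j, V j, K j)) | i j. (i, j) \<in> I \<times> I}"
proof -
  interpret quasitriangular_hopf_algebra k H \<Delta> \<epsilon> \<gamma> \<R> by (rule assms(5))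
  note A = \<open>assoc_algebra k A\<close>
  let ?t = "\<lambda>i. (\<rho> i, V i, K i)"
  let ?f = "\<lambda>i j. (tensor_rep k \<Delta> (\<rho> i) (V i) (\<rho> j) (V j), tensor_module k (V i) (V j),
    fused_K k \<R> A (\<rho> i, V i, K i) (\<rho> j, V j, K j))"
  have t: "re_triple k H A (?t i)" if "i \<in> I" for i
    using assms(7) that unfolding RE_data_def by blast
  have f: "re_triple k H A (?f i j)" if "i \<in> I" "j \<in> I" for i j
    using re_triple_fused[OF A t t] that .
  have tt: "reflection_eq k \<R> A (?t i) (?t j)" if "i \<in> I" "j \<in> I" for i j
    using assms(7) that unfolding RE_data_def by blast
  have ft: "reflection_eq k \<R> A (?f i j) (?t l)" if "i \<in> I" "j \<in> I" "l \<in> I" for i j l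
    by (rule reflection_eq_fused(1)[OF A t[OF that(1)] t[OF that(2)] t[OF that(3)] tt[OF that(1,3)] tt[OF that(2,3)]])
  have tf: "reflection_eq k \<R> A (?t l) (?f i j)" if "i \<in> I" "j \<in> I" "l \<in> I" for i j l
    by (rule reflection_eq_fused(2)[OF A t[OF that(1)] t[OF that(2)] t[OF that(3)] tt[OF that(3,1)] tt[OF that(3,2)]])
  \<comment> \<open>The types of the three modules in \<open>reflection_eq_fused\<close> are
    independent, so the pair \<open>l, m\<close> may enter as a single, already fused, third triple.
    The two equations required are instances of \<open>tf\<close>.\<close>
  have ff: "reflection_eq k \<R> A (?f i j) (?f l m)" if "i \<in> I" "j \<in> I" "l \<in> I" "m \<in> I" for i j l m
    by (rule reflection_eq_fused(1)[OF A t[OF that(1)] t[OF that(2)] f[OF that(3,4)] tf[OF that(3,4,1)] tf[OF that(3,4,2)]])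
  show ?thesis
    unfolding RE_data_union_def by (safe intro!: t f tt ft tf ff)
qed

end
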